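(* Let $*:\hat S\to\widehat{{}^*S}$ be an enlargement, let $\mathcal T$ be an $\hat S$-small triangulated category and let $\mathcal D\subset\mathcal T$ be a thick subcategory. Then ${}^*\mathcal D\subset{}^*\mathcal T$ is again thick, and there is a canonical isomorphism $${}^*\mathcal T/{}^*\mathcal D\xrightarrow{\sim}{}^*(\mathcal T/\mathcal D)$$ of triangulated categories.
   Context: Superstructures: a base set $S$ is an infinite set whose elements are not sets; $S_0=S$, $S_n=S_{n-1}\cup\mathcal P(S_{n-1})$, and $\hat S=\bigcup_{n\ge 0}S_n$. Formulas in $\hat S$ are built from $=$, $\in$, constants in $\hat S$, variables, ordered pairs and function application by $\neg$, $\wedge$ and bounded quantifiers $\forall x\in t$; statements are formulas without free variables. For $\varphi$ a formula in $\hat S$, ${}^*\varphi$ is obtained by replacing each constant $\tau$ by ${}^*\tau$. Enlargement: a map $*:\hat S\to\hat W$ between superstructures with (1) ${}^*S=W$; (2) ${}^*s=s$ for $s\in S$; (3) (transfer) a statement $\varphi$ in $\hat S$ is true iff ${}^*\varphi$ is true; (4) (saturation) with $\mathcal I=\bigcup_{A\in\hat S\setminus S}{}^*A$ (the internal elements), every nonempty family $\{U_i\}_{i\in I}$ of nonempty sets $U_i\in\mathcal I$ with $|I|\le|\hat S|$ and the finite intersection property has nonempty intersection. $\hat S$-small category: a category $\mathcal T=\langle M,s,t,c\rangle$ given by its set of morphisms $M\in\hat S\setminus S$, the maps $s,t:M\to M$ sending a morphism to the identity of its source resp. target, and the composition relation $c$; objects are identified with their identity morphisms. Its enlargement is ${}^*\mathcal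 T=\langle{}^*M,{}^*s,{}^*t,{}^*c\rangle$ (with ${}^*P$ as addition of morphisms if $P\subseteq M^3$ records addition in an additive $\mathcal T$). A functor $F$ (a map on morphism sets) has an enlargement ${}^*F$. An $\hat S$-small triangulated category is a triple $(\mathcal T,\Sigma,\Delta)$ with $\mathcal T$ an additive $\hat S$-small category, $\Sigma$ an automorphism of $\mathcal T$ and $\Delta$ a set of triangles satisfying the usual axioms; its enlargement is the triangulated category $({}^*\mathcal T,{}^*\Sigma,{}^*\Delta)$. A triangulated subcategory $\mathcal D$ of $\mathcal T$ is thick if for all $x,y\in\mathrm{Ob}(\mathcal T)$, $x\oplus y\in\mathrm{Ob}(\mathcal D)$ implies $x\in\mathrm{Ob}(\mathcal D)$. $\mathcal T/\mathcal D$ denotes the (Verdier) quotient triangulated category. The canonical functor is the one induced, via the universal property of the quotient, by the enlargement ${}^*\mathcal T\to{}^*(\mathcal T/\mathcal D)$ of the quotient functor $\mathcal T\to\mathcal T/\mathcal D$. *)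

theory Defs
  imports Main "HOL-Library.Equipollence"
begin

section \<open>Sets with urelements\<close>

text \<open>The ambient universe in which superstructures are formed: Zermelo set theory with
  urelements, with separation for arbitrary HOL predicates. It costs no generality: the
  superstructure over any base set is closed under pairing, separation, union and power set,
  and is therefore itself a type of this class. No foundation axiom is needed.\<close>

class zermelo =
  fixes atom :: "'a \<Rightarrow> bool"
    and elts :: "'a \<Rightarrow> 'a set"
  assumes elts_atom: "atom x \<Longrightarrow> elts x = {}"
    and set_ext: "\<lbrakk>\<not> atom x; \<not> atom y; elts x = elts y\<rbrakk> \<Longrightarrow> x = y"
    and ex_upair: "\<exists>p. \<not> atom p \<and> elts p = {x, y}"
    and ex_subset: "A \<subseteq> elts x \<Longrightarrow> \<exists>y. \<not> atom y \<and> elts y = A"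
    and ex_power: "\<exists>p. \<not> atom p \<and> elts p = {y. \<not> atom y \<and> elts y \<subseteq> elts x}"
    and ex_Union: "\<exists>u. \<not> atom u \<and> elts u = (\<Union>y\<in>elts x. elts y)"

text \<open>Only meaningful if \<open>A\<close> is the extension of a set of the universe.\<close>

definition mkset :: "'v::zermelo set \<Rightarrow> 'v" where
  "mkset A = (THE x. \<not> atom x \<and> elts x = A)"

definition opair :: "'v::zermelo \<Rightarrow> 'v \<Rightarrow> 'v" where
  "opair x y = mkset {mkset {x}, mkset {x, y}}"

text \<open>Triples are nested to the left, so that a ternary relation that is univalent in its last
  argument is literally a partial function on pairs.\<close>

definition triple :: "'v::zermelo \<Rightarrow> 'v \<Rightarrow> 'v \<Rightarrow> 'v" where
  "triple x y z = opair (opair x y) z"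

definition pairs :: "'v::zermelo set \<Rightarrow> 'v set \<Rightarrow> 'v set" where
  "pairs A B = {opair x y | x y. x \<in> A \<and> y \<in> B}"

definition triples :: "'v::zermelo set \<Rightarrow> 'v set" where
  "triples A = {triple x y z | x y z. x \<in> A \<and> y \<in> A \<and> z \<in> A}"

text \<open>Function application; by convention the value is the empty set when \<open>f\<close> does not
  determine a unique value at \<open>x\<close>.\<close>

definition app :: "'v::zermelo \<Rightarrow> 'v \<Rightarrow> 'v" where
  "app f x = (if \<exists>!y. opair x y \<in> elts f then THE y. opair x y \<in> elts f else mkset {})"

definition is_function :: "'v::zermelo \<Rightarrow> 'v \<Rightarrow> 'v \<Rightarrow> bool" where
  "is_function F A B \<longleftrightarrow>
     \<not> atom F \<and> elts F \<subseteq> pairs (elts A) (elts B) \<and>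
     (\<forall>x\<in>elts A. \<exists>!y. opair x y \<in> elts F)"

definition is_relation3 :: "'v::zermelo \<Rightarrow> 'v \<Rightarrow> bool" where
  "is_relation3 R A \<longleftrightarrow> \<not> atom R \<and> elts R \<subseteq> triples (elts A)"


section \<open>Superstructures and enlargements\<close>

definition base_set :: "'v::zermelo \<Rightarrow> bool" where
  "base_set S \<longleftrightarrow> \<not> atom S \<and> infinite (elts S) \<and> (\<forall>s\<in>elts S. atom s)"

primrec level :: "'v::zermelo \<Rightarrow> nat \<Rightarrow> 'v set" where
  "level S 0 = elts S"
| "level S (Suc n) = level S n \<union> {x. \<not> atom x \<and> elts x \<subseteq> level S n}"

definition hat :: "'v::zermelo \<Rightarrow> 'v set" where
  "hat S = (\<Union>n. level S n)"

text \<open>Every subset of a level really is a set of the universe, so each step from one level to the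
  next adjoins the full power set.\<close>

lemma ex_set_level: "\<exists>x. \<not> atom x \<and> elts x = level S n" for S :: "'v::zermelo"
proof (induction n)
  case 0
  show ?case using ex_subset[of "elts S" S] by simp
next
  case (Suc n)
  then obtain x where x: "\<not> atom x" "elts x = level S n" by blast
  obtain p where p: "\<not> atom p" "elts p = {y. \<not> atom y \<and> elts y \<subseteq> elts x}"
    using ex_power[of x] by blast
  obtain q where q: "elts q = {x, p}" using ex_upair[of x p] by blast
  obtain u where u: "\<not> atom u" "elts u = (\<Union>y\<in>elts q. elts y)" using ex_Union[of q] by blast
  have "elts u = level S (Suc n)" using u q p x by auto
  with u show ?case by blast
qed

lemma ex_set_subset_level:
  fixes S :: "'v::zermelo"
  assumes "A \<subseteq> level S n"
  shows "\<exists>x. \<not> atom x \<and> elts x = A \<and> x \<in> level S (Suc n)"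
proof -
  obtain y where "elts y = level S n" using ex_set_level[of S n] by blast
  then obtain x where "\<not> atom x" "elts x = A" using ex_subset[of A y] assms by blast
  then show ?thesis using assms by auto
qed

datatype 'v tm =
    Const 'v
  | Var nat
  | OPair "'v tm" "'v tm"
  | Apply "'v tm" "'v tm"

datatype 'v fm =
    Equal "'v tm" "'v tm"
  | Elem "'v tm" "'v tm"
  | Neg "'v fm"
  | Conj "'v fm" "'v fm"
  | BAll nat "'v tm" "'v fm"

primrec tm_val :: "(nat \<Rightarrow> 'v::zermelo) \<Rightarrow> 'v tm \<Rightarrow> 'v" where
  "tm_val e (Const a) = a"
| "tm_val e (Var n) = e n"
| "tm_val e (OPair t u) = opair (tm_val e t) (tm_val e u)"
| "tm_val e (Apply t u) = app (tm_val e t) (tm_val e u)"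

primrec sat :: "(nat \<Rightarrow> 'v::zermelo) \<Rightarrow> 'v fm \<Rightarrow> bool" where
  "sat e (Equal t u) \<longleftrightarrow> tm_val e t = tm_val e u"
| "sat e (Elem t u) \<longleftrightarrow> tm_val e t \<in> elts (tm_val e u)"
| "sat e (Neg p) \<longleftrightarrow> \<not> sat e p"
| "sat e (Conj p q) \<longleftrightarrow> sat e p \<and> sat e q"
| "sat e (BAll n t p) \<longleftrightarrow> (\<forall>x\<in>elts (tm_val e t). sat (e(n := x)) p)"

primrec tm_vars :: "'v tm \<Rightarrow> nat set" where
  "tm_vars (Const a) = {}"
| "tm_vars (Var n) = {n}"
| "tm_vars (OPair t u) = tm_vars t \<union> tm_vars u"
| "tm_vars (Apply t u) = tm_vars t \<union> tm_vars u"

primrec free_vars :: "'v fm \<Rightarrow> nat set" where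
  "free_vars (Equal t u) = tm_vars t \<union> tm_vars u"
| "free_vars (Elem t u) = tm_vars t \<union> tm_vars u"
| "free_vars (Neg p) = free_vars p"
| "free_vars (Conj p q) = free_vars p \<union> free_vars q"
| "free_vars (BAll n t p) = tm_vars t \<union> (free_vars p - {n})"

text \<open>The set \<open>set_fm p\<close> consists of the constants of \<open>p\<close>. As quantifiers are bounded
  and members of sets of \<open>hat S\<close> lie in \<open>hat S\<close>, evaluating in the ambient universe is
  the same as evaluating in \<open>hat S\<close>.\<close>

definition statement_in :: "'v::zermelo set \<Rightarrow> 'v fm \<Rightarrow> bool" where
  "statement_in X p \<longleftrightarrow> free_vars p = {} \<and> set_fm p \<subseteq> X"

definition is_true :: "'v::zermelo fm \<Rightarrow> bool" where
  "is_true p \<longleftrightarrow> (\<forall>e. sat e p)"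

definition internal :: "'v::zermelo \<Rightarrow> ('v \<Rightarrow> 'v) \<Rightarrow> 'v set" where
  "internal S star = (\<Union>A \<in> hat S - elts S. elts (star A))"

text \<open>The target superstructure is the one over the base set \<open>star S\<close>. In the saturation
  clause, index sets of cardinality at most that of \<open>hat S\<close> may be taken inside the universe.\<close>

definition enlargement :: "'v::zermelo \<Rightarrow> ('v \<Rightarrow> 'v) \<Rightarrow> bool" where
  "enlargement S star \<longleftrightarrow>
     base_set S \<and> base_set (star S) \<and>
     (\<forall>x \<in> hat S. star x \<in> hat (star S)) \<and>
     (\<forall>s \<in> elts S. star s = s) \<and>
     (\<forall>p. statement_in (hat S) p \<longrightarrow> (is_true p \<longleftrightarrow> is_true (map_fm star p))) \<and>
     (\<forall>(I :: 'v set) U. I \<noteq> {} \<and> I \<lesssim> hat S \<and>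
        (\<forall>i\<in>I. U i \<in> internal S star \<and> \<not> atom (U i) \<and> elts (U i) \<noteq> {}) \<and>
        (\<forall>J. J \<subseteq> I \<and> finite J \<and> J \<noteq> {} \<longrightarrow> (\<Inter>i\<in>J. elts (U i)) \<noteq> {})
        \<longrightarrow> (\<Inter>i\<in>I. elts (U i)) \<noteq> {})"


section \<open>Small triangulated categories\<close>

record 'v small_cat =
  Mor :: 'v
  Src :: 'v
  Tgt :: 'v
  Cmp :: 'v   \<comment> \<open>triples \<open>(g, f, g \<circ> f)\<close>\<close>

record 'v shift_cat = "'v small_cat" +
  Add :: 'v   \<comment> \<open>triples \<open>(f, g, f + g)\<close>\<close>
  Shift :: 'v

record 'v tri_cat = "'v shift_cat" +
  Tri :: 'v   \<comment> \<open>triples \<open>(f, g, h)\<close> with \<open>f : x \<rightarrow> y\<close>, \<open>g : y \<rightarrow> z\<close>, \<open>h : z \<rightarrow> \<Sigma>x\<close>\<close>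

definition mor :: "('v::zermelo, 'b) small_cat_scheme \<Rightarrow> 'v set" where
  "mor C = elts (Mor C)"

definition src :: "('v::zermelo, 'b) small_cat_scheme \<Rightarrow> 'v \<Rightarrow> 'v" where
  "src C f = app (Src C) f"

definition tgt :: "('v::zermelo, 'b) small_cat_scheme \<Rightarrow> 'v \<Rightarrow> 'v" where
  "tgt C f = app (Tgt C) f"

definition cmp :: "('v::zermelo, 'b) small_cat_scheme \<Rightarrow> 'v \<Rightarrow> 'v \<Rightarrow> 'v" where
  "cmp C g f = app (Cmp C) (opair g f)"

definition add :: "('v::zermelo, 'b) shift_cat_scheme \<Rightarrow> 'v \<Rightarrow> 'v \<Rightarrow> 'v" where
  "add C f g = app (Add C) (opair f g)"

definition shift :: "('v::zermelo, 'b) shift_cat_scheme \<Rightarrow> 'v \<Rightarrow> 'v" where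
  "shift C f = app (Shift C) f"

definition dist :: "('v::zermelo, 'b) tri_cat_scheme \<Rightarrow> 'v \<Rightarrow> 'v \<Rightarrow> 'v \<Rightarrow> bool" where
  "dist C f g h \<longleftrightarrow> triple f g h \<in> elts (Tri C)"

text \<open>Objects are identified with their identity morphisms.\<close>

definition ob :: "('v::zermelo, 'b) small_cat_scheme \<Rightarrow> 'v set" where
  "ob C = {x \<in> mor C. src C x = x}"

definition hom :: "('v::zermelo, 'b) small_cat_scheme \<Rightarrow> 'v \<Rightarrow> 'v \<Rightarrow> 'v set" where
  "hom C x y = {f \<in> mor C. src C f = x \<and> tgt C f = y}"

definition category :: "('v::zermelo, 'b) small_cat_scheme \<Rightarrow> bool" where
  "category C \<longleftrightarrow>
     \<not> atom (Mor C) \<and>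
     is_function (Src C) (Mor C) (Mor C) \<and>
     is_function (Tgt C) (Mor C) (Mor C) \<and>
     is_relation3 (Cmp C) (Mor C) \<and>
     (\<forall>f\<in>mor C. src C (src C f) = src C f \<and> tgt C (src C f) = src C f \<and>
                src C (tgt C f) = tgt C f \<and> tgt C (tgt C f) = tgt C f) \<and>
     (\<forall>f\<in>mor C. \<forall>g\<in>mor C. (\<exists>h. triple g f h \<in> elts (Cmp C)) \<longleftrightarrow> src C g = tgt C f) \<and>
     (\<forall>f g h h'. triple g f h \<in> elts (Cmp C) \<and> triple g f h' \<in> elts (Cmp C) \<longrightarrow> h = h') \<and>
     (\<forall>f\<in>mor C. \<forall>g\<in>mor C. src C g = tgt C f \<longrightarrow>
        src C (cmp C g f) = src C f \<and> tgt C (cmp C g f) = tgt C g) \<and>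
     (\<forall>f\<in>mor C. cmp C f (src C f) = f \<and> cmp C (tgt C f) f = f) \<and>
     (\<forall>f\<in>mor C. \<forall>g\<in>mor C. \<forall>h\<in>mor C. src C g = tgt C f \<and> src C h = tgt C g \<longrightarrow>
        cmp C h (cmp C g f) = cmp C (cmp C h g) f)"

definition iso :: "('v::zermelo, 'b) small_cat_scheme \<Rightarrow> 'v \<Rightarrow> bool" where
  "iso C a \<longleftrightarrow> a \<in> mor C \<and>
     (\<exists>b \<in> hom C (tgt C a) (src C a). cmp C b a = src C a \<and> cmp C a b = tgt C a)"

definition zero_object :: "('v::zermelo, 'b) small_cat_scheme \<Rightarrow> 'v \<Rightarrow> bool" where
  "zero_object C z \<longleftrightarrow> z \<in> ob C \<and>
     (\<forall>x \<in> ob C. (\<exists>!f. f \<in> hom C z x) \<and> (\<exists>!f. f \<in> hom C x z))"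

text \<open>The zero morphism and the negative of a morphism, as given by the group structure on
  \<open>hom C x y\<close>.\<close>

definition zero :: "('v::zermelo, 'b) shift_cat_scheme \<Rightarrow> 'v \<Rightarrow> 'v \<Rightarrow> 'v" where
  "zero C x y = (THE z. z \<in> hom C x y \<and> (\<forall>f \<in> hom C x y. add C z f = f))"

definition neg :: "('v::zermelo, 'b) shift_cat_scheme \<Rightarrow> 'v \<Rightarrow> 'v" where
  "neg C f = (THE g. g \<in> hom C (src C f) (tgt C f) \<and> add C f g = zero C (src C f) (tgt C f))"

definition preadditive :: "('v::zermelo, 'b) shift_cat_scheme \<Rightarrow> bool" where
  "preadditive C \<longleftrightarrow>
     category C \<and>
     is_relation3 (Add C) (Mor C) \<and>
     (\<forall>f\<in>mor C. \<forall>g\<in>mor C. (\<exists>h. triple f g h \<in> elts (Add C)) \<longleftrightarrow>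
        src C f = src C g \<and> tgt C f = tgt C g) \<and>
     (\<forall>f g h h'. triple f g h \<in> elts (Add C) \<and> triple f g h' \<in> elts (Add C) \<longrightarrow> h = h') \<and>
     (\<forall>x\<in>ob C. \<forall>y\<in>ob C.
        (\<forall>f\<in>hom C x y. \<forall>g\<in>hom C x y. add C f g \<in> hom C x y) \<and>
        (\<forall>f\<in>hom C x y. \<forall>g\<in>hom C x y. \<forall>h\<in>hom C x y.
           add C (add C f g) h = add C f (add C g h)) \<and>
        (\<forall>f\<in>hom C x y. \<forall>g\<in>hom C x y. add C f g = add C g f) \<and>
        (\<exists>z\<in>hom C x y. (\<forall>f\<in>hom C x y. add C z f = f) \<and>
           (\<forall>f\<in>hom C x y. \<exists>g\<in>hom C x y. add C f g = z))) \<and>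
     (\<forall>x\<in>ob C. \<forall>y\<in>ob C. \<forall>z\<in>ob C.
        (\<forall>f\<in>hom C x y. \<forall>g\<in>hom C y z. \<forall>g'\<in>hom C y z.
           cmp C (add C g g') f = add C (cmp C g f) (cmp C g' f)) \<and>
        (\<forall>f\<in>hom C x y. \<forall>f'\<in>hom C x y. \<forall>g\<in>hom C y z.
           cmp C g (add C f f') = add C (cmp C g f) (cmp C g f')))"

definition biproduct ::
  "('v::zermelo, 'b) shift_cat_scheme \<Rightarrow> 'v \<Rightarrow> 'v \<Rightarrow> 'v \<Rightarrow> 'v \<Rightarrow> 'v \<Rightarrow> 'v \<Rightarrow> 'v \<Rightarrow> bool" where
  "biproduct C x y b i j p q \<longleftrightarrow>
     b \<in> ob C \<and> i \<in> hom C x b \<and> j \<in> hom C y b \<and> p \<in> hom C b x \<and> q \<in> hom C b y \<and>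
     cmp C p i = x \<and> cmp C q j = y \<and> cmp C p j = zero C y x \<and> cmp C q i = zero C x y \<and>
     add C (cmp C i p) (cmp C j q) = b"

definition additive_cat :: "('v::zermelo, 'b) shift_cat_scheme \<Rightarrow> bool" where
  "additive_cat C \<longleftrightarrow>
     preadditive C \<and> (\<exists>z. zero_object C z) \<and>
     (\<forall>x\<in>ob C. \<forall>y\<in>ob C. \<exists>b i j p q. biproduct C x y b i j p q)"

definition is_functor ::
  "('v::zermelo, 'b) small_cat_scheme \<Rightarrow> ('v, 'c) small_cat_scheme \<Rightarrow> 'v \<Rightarrow> bool" where
  "is_functor A B F \<longleftrightarrow>
     category A \<and> category B \<and> is_function F (Mor A) (Mor B) \<and>
     (\<forall>f\<in>mor A. app F (src A f) = src B (app F f) \<and> app F (tgt A f) = tgt B (app F f)) \<and>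
     (\<forall>f\<in>mor A. \<forall>g\<in>mor A. src A g = tgt A f \<longrightarrow>
        app F (cmp A g f) = cmp B (app F g) (app F f))"

definition is_additive ::
  "('v::zermelo, 'b) shift_cat_scheme \<Rightarrow> ('v, 'c) shift_cat_scheme \<Rightarrow> 'v \<Rightarrow> bool" where
  "is_additive A B F \<longleftrightarrow>
     (\<forall>f\<in>mor A. \<forall>g\<in>mor A. src A f = src A g \<and> tgt A f = tgt A g \<longrightarrow>
        app F (add A f g) = add B (app F f) (app F g))"

definition triangle ::
  "('v::zermelo, 'b) shift_cat_scheme \<Rightarrow> 'v \<Rightarrow> 'v \<Rightarrow> 'v \<Rightarrow> bool" where
  "triangle C f g h \<longleftrightarrow>
     f \<in> mor C \<and> g \<in> mor C \<and> h \<in> mor C \<and>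
     src C g = tgt C f \<and> src C h = tgt C g \<and> tgt C h = shift C (src C f)"

definition triangle_mor ::
  "('v::zermelo, 'b) shift_cat_scheme \<Rightarrow>
     'v \<Rightarrow> 'v \<Rightarrow> 'v \<Rightarrow> 'v \<Rightarrow> 'v \<Rightarrow> 'v \<Rightarrow> 'v \<Rightarrow> 'v \<Rightarrow> 'v \<Rightarrow> bool" where
  "triangle_mor C f g h f' g' h' a b c \<longleftrightarrow>
     a \<in> hom C (src C f) (src C f') \<and> b \<in> hom C (src C g) (src C g') \<and>
     c \<in> hom C (src C h) (src C h') \<and>
     cmp C b f = cmp C f' a \<and> cmp C c g = cmp C g' b \<and>
     cmp C (shift C a) h = cmp C h' c"

definition triangle_iso ::
  "('v::zermelo, 'b) shift_cat_scheme \<Rightarrow> 'v \<Rightarrow> 'v \<Rightarrow> 'v \<Rightarrow> 'v \<Rightarrow> 'v \<Rightarrow> 'v \<Rightarrow> bool" where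
  "triangle_iso C f g h f' g' h' \<longleftrightarrow>
     (\<exists>a b c. iso C a \<and> iso C b \<and> iso C c \<and> triangle_mor C f g h f' g' h' a b c)"

definition triangulated :: "'v::zermelo tri_cat \<Rightarrow> bool" where
  "triangulated T \<longleftrightarrow>
     additive_cat T \<and>
     is_functor T T (Shift T) \<and> is_additive T T (Shift T) \<and>
     bij_betw (shift T) (mor T) (mor T) \<and>
     is_relation3 (Tri T) (Mor T) \<and>
     (\<forall>f g h. dist T f g h \<longrightarrow> triangle T f g h) \<and>
     \<comment> \<open>TR1\<close>
     (\<forall>f g h f' g' h'. dist T f g h \<and> triangle T f' g' h' \<and> triangle_iso T f g h f' g' h' \<longrightarrow>
        dist T f' g' h') \<and>
     (\<forall>x z. x \<in> ob T \<and> zero_object T z \<longrightarrow> dist T x (zero T x z) (zero T z (shift T x))) \<and>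
     (\<forall>f\<in>mor T. \<exists>g h. dist T f g h) \<and>
     \<comment> \<open>TR2\<close>
     (\<forall>f g h. triangle T f g h \<longrightarrow> (dist T f g h \<longleftrightarrow> dist T g h (neg T (shift T f)))) \<and>
     \<comment> \<open>TR3\<close>
     (\<forall>f g h f' g' h' a b. dist T f g h \<and> dist T f' g' h' \<and>
        a \<in> hom T (src T f) (src T f') \<and> b \<in> hom T (tgt T f) (tgt T f') \<and>
        cmp T b f = cmp T f' a \<longrightarrow>
        (\<exists>c. triangle_mor T f g h f' g' h' a b c)) \<and>
     \<comment> \<open>TR4, the octahedral axiom\<close>
     (\<forall>f f1 f2 g g1 g2 k1 k2. src T g = tgt T f \<and>
        dist T f f1 f2 \<and> dist T g g1 g2 \<and> dist T (cmp T g f) k1 k2 \<longrightarrow>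
        (\<exists>u v. dist T u v (cmp T (shift T f1) g2) \<and>
           triangle_mor T f f1 f2 (cmp T g f) k1 k2 (src T f) g u \<and>
           triangle_mor T (cmp T g f) k1 k2 g g1 g2 f (tgt T g) v))"

text \<open>The remaining components of a triangulated \<open>T\<close> then lie in \<open>hat S\<close> as well.\<close>

definition hat_small :: "'v::zermelo \<Rightarrow> 'v tri_cat \<Rightarrow> bool" where
  "hat_small S T \<longleftrightarrow> Mor T \<in> hat S - elts S"

definition triangulated_functor :: "'v::zermelo tri_cat \<Rightarrow> 'v tri_cat \<Rightarrow> 'v \<Rightarrow> bool" where
  "triangulated_functor A B F \<longleftrightarrow>
     triangulated A \<and> triangulated B \<and> is_functor A B F \<and> is_additive A B F \<and>
     (\<forall>f\<in>mor A. app F (shift A f) = shift B (app F f)) \<and>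
     (\<forall>f g h. dist A f g h \<longrightarrow> dist B (app F f) (app F g) (app F h))"

definition triangulated_isomorphism :: "'v::zermelo tri_cat \<Rightarrow> 'v tri_cat \<Rightarrow> 'v \<Rightarrow> bool" where
  "triangulated_isomorphism A B F \<longleftrightarrow>
     triangulated_functor A B F \<and>
     (\<exists>G. triangulated_functor B A G \<and>
        (\<forall>f\<in>mor A. app G (app F f) = f) \<and> (\<forall>g\<in>mor B. app F (app G g) = g))"

definition enlarge :: "('v \<Rightarrow> 'v) \<Rightarrow> 'v::zermelo tri_cat \<Rightarrow> 'v tri_cat" where
  "enlarge star T =
     \<lparr>Mor = star (Mor T), Src = star (Src T), Tgt = star (Tgt T), Cmp = star (Cmp T),
      Add = star (Add T), Shift = star (Shift T), Tri = star (Tri T)\<rparr>"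


section \<open>Thick subcategories\<close>

definition full_subcategory :: "'v::zermelo tri_cat \<Rightarrow> 'v tri_cat \<Rightarrow> bool" where
  "full_subcategory T D \<longleftrightarrow>
     \<not> atom (Mor D) \<and> mor D \<subseteq> mor T \<and>
     (\<forall>f\<in>mor T. f \<in> mor D \<longleftrightarrow> src T f \<in> mor D \<and> tgt T f \<in> mor D) \<and>
     Src D = mkset (elts (Src T) \<inter> pairs (mor D) (mor D)) \<and>
     Tgt D = mkset (elts (Tgt T) \<inter> pairs (mor D) (mor D)) \<and>
     Cmp D = mkset (elts (Cmp T) \<inter> triples (mor D)) \<and>
     Add D = mkset (elts (Add T) \<inter> triples (mor D)) \<and>
     Shift D = mkset (elts (Shift T) \<inter> pairs (mor D) (mor D)) \<and>
     Tri D = mkset (elts (Tri T) \<inter> triples (mor D))"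

text \<open>Closure under cones and shifts makes \<open>D\<close>, with the induced structure, a triangulated
  category whose inclusion is exact.\<close>

definition triangulated_subcategory :: "'v::zermelo tri_cat \<Rightarrow> 'v tri_cat \<Rightarrow> bool" where
  "triangulated_subcategory T D \<longleftrightarrow>
     triangulated T \<and> full_subcategory T D \<and>
     (\<exists>z \<in> ob D. zero_object T z) \<and>
     (\<forall>a. iso T a \<and> src T a \<in> ob D \<longrightarrow> tgt T a \<in> ob D) \<and>
     (\<forall>x \<in> ob T. x \<in> ob D \<longleftrightarrow> shift T x \<in> ob D) \<and>
     (\<forall>f g h. dist T f g h \<and> src T f \<in> ob D \<and> tgt T f \<in> ob D \<longrightarrow> tgt T g \<in> ob D)"

definition thick :: "'v::zermelo tri_cat \<Rightarrow> 'v tri_cat \<Rightarrow> bool" where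
  "thick T D \<longleftrightarrow>
     triangulated_subcategory T D \<and>
     (\<forall>x\<in>ob T. \<forall>y\<in>ob T. \<forall>b i j p q. biproduct T x y b i j p q \<and> b \<in> ob D \<longrightarrow> x \<in> ob D)"


section \<open>Verdier quotients\<close>

text \<open>Morphisms \<open>x \<rightarrow> y\<close> of the quotient are equivalence classes of roofs
  \<open>x \<leftarrow> z \<rightarrow> y\<close> whose left leg \<open>s\<close> has its cone in \<open>D\<close>.\<close>

definition cone_in :: "'v::zermelo tri_cat \<Rightarrow> 'v tri_cat \<Rightarrow> 'v set" where
  "cone_in T D = {s \<in> mor T. \<exists>g h. dist T s g h \<and> tgt T g \<in> ob D}"

definition roof :: "'v::zermelo tri_cat \<Rightarrow> 'v tri_cat \<Rightarrow> 'v \<Rightarrow> 'v \<Rightarrow> bool" where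
  "roof T D s f \<longleftrightarrow> s \<in> cone_in T D \<and> f \<in> mor T \<and> src T f = src T s"

definition roof_equiv :: "'v::zermelo tri_cat \<Rightarrow> 'v tri_cat \<Rightarrow> 'v \<Rightarrow> 'v \<Rightarrow> 'v \<Rightarrow> 'v \<Rightarrow> bool" where
  "roof_equiv T D s f s' f' \<longleftrightarrow>
     roof T D s f \<and> roof T D s' f' \<and> tgt T s = tgt T s' \<and> tgt T f = tgt T f' \<and>
     (\<exists>w\<in>ob T. \<exists>u \<in> hom T w (src T s). \<exists>v \<in> hom T w (src T s').
        cmp T s u \<in> cone_in T D \<and> cmp T s u = cmp T s' v \<and> cmp T f u = cmp T f' v)"

definition roof_class :: "'v::zermelo tri_cat \<Rightarrow> 'v tri_cat \<Rightarrow> 'v \<Rightarrow> 'v \<Rightarrow> 'v" where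
  "roof_class T D s f = mkset {opair s' f' | s' f'. roof_equiv T D s f s' f'}"

definition quotient_shift_cat :: "'v::zermelo tri_cat \<Rightarrow> 'v tri_cat \<Rightarrow> 'v shift_cat" where
  "quotient_shift_cat T D =
     \<lparr>Mor = mkset {roof_class T D s f | s f. roof T D s f},
      Src = mkset {opair (roof_class T D s f) (roof_class T D (tgt T s) (tgt T s)) | s f.
              roof T D s f},
      Tgt = mkset {opair (roof_class T D s f) (roof_class T D (tgt T f) (tgt T f)) | s f.
              roof T D s f},
      \<comment> \<open>with \<open>f u = r w\<close>, the roofs \<open>(s, f)\<close> and \<open>(r, g)\<close> compose to \<open>(s u, g w)\<close>\<close>
      Cmp = mkset {triple (roof_class T D r g) (roof_class T D s f)
                     (roof_class T D (cmp T s u) (cmp T g w)) | s f r g u w.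
              roof T D s f \<and> roof T D r g \<and> tgt T r = tgt T f \<and>
              u \<in> cone_in T D \<and> w \<in> mor T \<and> src T u = src T w \<and>
              tgt T u = src T s \<and> tgt T w = src T r \<and> cmp T f u = cmp T r w},
      Add = mkset {triple (roof_class T D s f) (roof_class T D s g)
                     (roof_class T D s (add T f g)) | s f g.
              roof T D s f \<and> roof T D s g \<and> tgt T f = tgt T g},
      Shift = mkset {opair (roof_class T D s f) (roof_class T D (shift T s) (shift T f)) | s f.
              roof T D s f}\<rparr>"

text \<open>The distinguished triangles of the quotient are the triangles isomorphic to the image of a
  distinguished triangle of \<open>T\<close>.\<close>

definition verdier_quotient :: "'v::zermelo tri_cat \<Rightarrow> 'v tri_cat \<Rightarrow> 'v tri_cat" where
  "verdier_quotient T D = (let Q = quotient_shift_cat T D; q = (\<lambda>f. roof_class T D (src T f) f) in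
     shift_cat.extend Q
       \<lparr>Tri = mkset {triple a b c | a b c. triangle Q a b c \<and>
          (\<exists>f g h. dist T f g h \<and> triangle_iso Q (q f) (q g) (q h) a b c)}\<rparr>)"

definition quotient_functor :: "'v::zermelo tri_cat \<Rightarrow> 'v tri_cat \<Rightarrow> 'v" where
  "quotient_functor T D = mkset {opair f (roof_class T D (src T f) f) | f. f \<in> mor T}"

text \<open>A functor from the quotient of \<open>T\<close> by \<open>D\<close> to \<open>B\<close> that is induced by
  \<open>F\<close>, a functor from \<open>T\<close> to \<open>B\<close>.\<close>

definition induced_by ::
  "'v::zermelo tri_cat \<Rightarrow> 'v tri_cat \<Rightarrow> 'v tri_cat \<Rightarrow> 'v \<Rightarrow> 'v \<Rightarrow> bool" where
  "induced_by T D B F G \<longleftrightarrow>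
     is_functor (verdier_quotient T D) B G \<and>
     (\<forall>f\<in>mor T. app G (app (quotient_functor T D) f) = app F f)"

end

(* The enlargement of the Verdier quotient is literally the Verdier quotient of the enlargements.
   A roof class is a subset of M x M cut out by a bounded formula, so once the function
   k : (s, f) |-> [s, f] is a constant of the language, every component of the quotient is a set
   {t | P} with t and P expressible, and transfer identifies its star with the same comprehension
   formed from the enlarged data; in particular the classes in the star still consist of pairs of
   morphisms, now of the enlargement. The canonical functor is then the identity. It is
   the only functor compatible with the quotient functors because every morphism of the
   quotient is a fraction. What remains is Verdier's theorem that the quotient is triangulated;
   it follows from the calculus of fractions of the morphisms with cone in D. The octahedral
   axiom is moved along isomorphisms of triangles by the five lemma, available in the quotient
   as soon as the other axioms are. *)

theory Submission
  imports Defs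
begin

section \<open>Sets of the universe\<close>

text \<open>The formal language has no descriptions, no comprehension and no unbounded quantifiers,
  and a urelement has the same elements as the empty set. Each of these shapes the proof.
  \<open>zero\<close> and \<open>neg\<close> are descriptions, so transfer acts on restated axioms
  in which idempotence under addition expresses vanishing. Transfer determines a comprehension only
  up to its elements, so one must also know that the set in question is no urelement; this is
  transferred as avoidance of the base set S, itself a constant of the language. The transferred
  classes are known to be sets only as members of the star of a set of sets; hence the class map
  comes with a second constant, its range.

  The axioms other than TR4 form a locale of their own. TR4 speaks of all choices of cones, while T
  provides octahedra only on images of its own triangles, so cones must be compared in the quotient
  before TR4 is available there. For T itself TR4 enters from the start: it makes the morphisms with
  cone in D closed under composition and cancellation.\<close>

definition small :: "'v::zermelo set \<Rightarrow> bool" where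
  "small A \<longleftrightarrow> (\<exists>x. \<not> atom x \<and> elts x = A)"

lemma smallE:
  assumes "small A"
  obtains x where "\<not> atom x" "elts x = A"
  using assms by (auto simp: small_def)

lemma small_subset: "small A \<Longrightarrow> B \<subseteq> A \<Longrightarrow> small B"
  unfolding small_def using ex_subset by metis

lemma small_elts [simp]: "small (elts x)"
  using ex_subset[of "elts x" x] by (auto simp: small_def)

lemma small_insert2: "small {x, y}"
  unfolding small_def by (rule ex_upair)

lemma small_singleton: "small {x}"
  using small_insert2[of x x] by simp

lemma mkset_works:
  assumes "small A"
  shows "\<not> atom (mkset A) \<and> elts (mkset A) = A"
proof -
  obtain x where x: "\<not> atom x" "elts x = A" using assms by (rule smallE)
  then have "\<exists>!x. \<not> atom x \<and> elts x = A" using set_ext by blast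
  then show ?thesis unfolding mkset_def by (rule theI')
qed

lemmas elts_mkset = mkset_works[THEN conjunct2]
lemmas atom_mkset = mkset_works[THEN conjunct1]

lemma mkset_elts: "\<not> atom x \<Longrightarrow> mkset (elts x) = x"
  using mkset_works[OF small_elts] set_ext by blast

lemma small_Un:
  assumes "small A" "small B"
  shows "small (A \<union> B)"
proof -
  obtain x y where xy: "elts x = A" "elts y = B" using assms by (meson smallE)
  obtain p where "elts p = {x, y}" using small_insert2 by (meson smallE)
  moreover obtain u where "\<not> atom u" "elts u = (\<Union>z\<in>elts p. elts z)" using ex_Union[of p] by blast
  ultimately show ?thesis using xy by (auto simp: small_def)
qed

lemma small_power:
  assumes "small A"
  shows "small {y. \<not> atom y \<and> elts y \<subseteq> A}"
proof -
  obtain x where "elts x = A" using assms by (rule smallE)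
  then show ?thesis using ex_power[of x] by (simp add: small_def)
qed

text \<open>\<open>mkset\<close> is injective on small sets, so Kuratowski pairs can be compared as
  HOL doubletons of HOL doubletons.\<close>

lemma opair_iff: "opair x y = opair x' y' \<longleftrightarrow> x = x' \<and> y = y'"
proof
  assume *: "opair x y = opair x' y'"
  have mk: "mkset A = mkset B \<longleftrightarrow> A = B" if "small A" "small B" for A B :: "'a set"
    using that elts_mkset by metis
  from * have "{{x}, {x, y}} = {{x'}, {x', y'}}"
    by (simp add: opair_def mk small_insert2 small_singleton doubleton_eq_iff)
  then show "x = x' \<and> y = y'" by (auto simp: doubleton_eq_iff)
qed simp

lemma triple_iff: "triple x y z = triple x' y' z' \<longleftrightarrow> x = x' \<and> y = y' \<and> z = z'"
  by (auto simp: triple_def opair_iff)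

text \<open>The Zermelo axioms contain no replacement, so a collection becomes a set by being cut
  out of a larger one: {x} and {x, y} are subsets of A \<union> B, hence a pair is a member of the
  double power set of A \<union> B.\<close>

lemma small_pairs:
  assumes "small A" "small B"
  shows "small (pairs A B)"
proof (rule small_subset[OF small_power[OF small_power[OF small_Un[OF assms]]]], rule subsetI)
  fix z assume "z \<in> pairs A B"
  then obtain x y where "z = opair x y" "x \<in> A" "y \<in> B" by (auto simp: pairs_def)
  then show "z \<in> {y. \<not> atom y \<and> elts y \<subseteq> {y. \<not> atom y \<and> elts y \<subseteq> A \<union> B}}"
    by (auto simp: opair_def small_insert2 small_singleton elts_mkset atom_mkset)
qed

lemma triples_eq: "triples A = pairs (pairs A A) A"
  by (auto simp: triples_def pairs_def triple_def)

lemma small_triples: "small A \<Longrightarrow> small (triples A)"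
  by (simp add: triples_eq small_pairs)

lemma in_pairs [simp]: "opair x y \<in> pairs A B \<longleftrightarrow> x \<in> A \<and> y \<in> B"
  by (auto simp: pairs_def opair_iff)

lemma in_triples [simp]: "triple x y z \<in> triples A \<longleftrightarrow> x \<in> A \<and> y \<in> A \<and> z \<in> A"
  by (auto simp: triples_def triple_iff)

lemma app_eqI:
  assumes "opair x y \<in> elts f" "\<And>z. opair x z \<in> elts f \<Longrightarrow> z = y"
  shows "app f x = y"
proof -
  have "\<exists>!z. opair x z \<in> elts f" using assms by blast
  moreover have "(THE z. opair x z \<in> elts f) = y" using assms by (rule the_equality)
  ultimately show ?thesis by (simp add: app_def)
qed

lemma app_in:
  assumes "opair x y \<in> elts f" "\<And>y z. opair x y \<in> elts f \<Longrightarrow> opair x z \<in> elts f \<Longrightarrow> y = z"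
  shows "opair x (app f x) \<in> elts f"
proof -
  have "app f x = y" by (rule app_eqI[OF assms(1)]) (use assms in blast)
  then show ?thesis using assms(1) by simp
qed

lemma is_function_app:
  assumes "is_function F A B" "x \<in> elts A"
  shows "opair x (app F x) \<in> elts F" and "app F x \<in> elts B"
proof -
  have ex: "\<exists>!y. opair x y \<in> elts F" and sub: "elts F \<subseteq> pairs (elts A) (elts B)"
    using assms unfolding is_function_def by blast+
  from ex show F: "opair x (app F x) \<in> elts F" using app_in by (metis (no_types))
  have "opair x (app F x) \<in> pairs (elts A) (elts B)" by (rule subsetD[OF sub F])
  then show "app F x \<in> elts B" by simp
qed

lemma is_function_elts:
  assumes "is_function F A B"
  shows "elts F = {opair x (app F x) | x. x \<in> elts A}"
proof -
  have "z \<in> elts F \<longleftrightarrow> (\<exists>x\<in>elts A. z = opair x (app F x))" for z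
  proof
    assume z: "z \<in> elts F"
    then obtain x y where xy: "z = opair x y" "x \<in> elts A"
      using assms by (auto simp: is_function_def pairs_def)
    then have "y = app F x"
      using z is_function_app(1)[OF assms] assms unfolding is_function_def by blast
    then show "\<exists>x\<in>elts A. z = opair x (app F x)" using xy by blast
  qed (use is_function_app[OF assms] in blast)
  then show ?thesis by blast
qed

lemma is_function_ext:
  assumes "is_function F A B" "is_function G A B'" "\<And>x. x \<in> elts A \<Longrightarrow> app F x = app G x"
  shows "F = G"
proof (rule set_ext)
  show "elts F = elts G"
    unfolding is_function_elts[OF assms(1)] is_function_elts[OF assms(2)]
    by (rule Collect_cong) (metis assms(3))
qed (use assms in \<open>auto simp: is_function_def\<close>)

text \<open>The passage from a HOL function to a function of the universe. The graph is cut out of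
  the product of A and B, which is why a range B has to be named.\<close>

lemma is_function_graph:
  assumes "\<And>x. x \<in> elts A \<Longrightarrow> \<phi> x \<in> elts B"
  shows "is_function (mkset {opair x (\<phi> x) | x. x \<in> elts A}) A B"
    and "x \<in> elts A \<Longrightarrow> app (mkset {opair x (\<phi> x) | x. x \<in> elts A}) x = \<phi> x"
proof -
  let ?F = "{opair x (\<phi> x) | x. x \<in> elts A}"
  have "?F \<subseteq> pairs (elts A) (elts B)" using assms by auto
  then have "small ?F" using small_subset[OF small_pairs[OF small_elts small_elts]] by blast
  then have F: "\<not> atom (mkset ?F)" "elts (mkset ?F) = ?F" using mkset_works by blast+
  show "is_function (mkset ?F) A B"
    unfolding is_function_def F(2) using F(1) \<open>?F \<subseteq> _\<close> by (auto simp: opair_iff)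
  show "app (mkset ?F) x = \<phi> x" if "x \<in> elts A"
    by (rule app_eqI) (use F(2) that in \<open>auto simp: opair_iff\<close>)
qed

section \<open>Categories and preadditive categories\<close>

locale categ =
  fixes C :: "('v::zermelo, 'b) small_cat_scheme"
  assumes category: "category C"
begin

abbreviation compC (infixr "\<cdot>" 70) where "g \<cdot> f \<equiv> cmp C g f"

lemma
  shows is_function_Src: "is_function (Src C) (Mor C) (Mor C)"
    and is_function_Tgt: "is_function (Tgt C) (Mor C) (Mor C)"
    and is_relation3_Cmp: "is_relation3 (Cmp C) (Mor C)"
    and src_tgt_ax: "\<forall>f\<in>mor C. src C (src C f) = src C f \<and> tgt C (src C f) = src C f \<and>
                src C (tgt C f) = tgt C f \<and> tgt C (tgt C f) = tgt C f"
    and composable_ax: "\<forall>f\<in>mor C. \<forall>g\<in>mor C.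
      (\<exists>h. triple g f h \<in> elts (Cmp C)) \<longleftrightarrow> src C g = tgt C f"
    and Cmp_unique_ax:
      "\<forall>f g h h'. triple g f h \<in> elts (Cmp C) \<and> triple g f h' \<in> elts (Cmp C) \<longrightarrow> h = h'"
    and src_tgt_cmp_ax: "\<forall>f\<in>mor C. \<forall>g\<in>mor C. src C g = tgt C f \<longrightarrow>
        src C (cmp C g f) = src C f \<and> tgt C (cmp C g f) = tgt C g"
    and unit_ax: "\<forall>f\<in>mor C. cmp C f (src C f) = f \<and> cmp C (tgt C f) f = f"
    and assoc_ax: "\<forall>f\<in>mor C. \<forall>g\<in>mor C. \<forall>h\<in>mor C.
      src C g = tgt C f \<and> src C h = tgt C g \<longrightarrow> cmp C h (cmp C g f) = cmp C (cmp C h g) f"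
  by (insert category[unfolded category_def], elim conjE, assumption)+

lemma src_mor [simp]: "f \<in> mor C \<Longrightarrow> src C f \<in> mor C"
  unfolding mor_def src_def by (rule is_function_app(2)[OF is_function_Src])

lemma tgt_mor [simp]: "f \<in> mor C \<Longrightarrow> tgt C f \<in> mor C"
  unfolding mor_def tgt_def by (rule is_function_app(2)[OF is_function_Tgt])

lemma src_tgt_idem [simp]:
  assumes "f \<in> mor C"
  shows "src C (src C f) = src C f" "tgt C (src C f) = src C f"
    "src C (tgt C f) = tgt C f" "tgt C (tgt C f) = tgt C f"
  using src_tgt_ax[rule_format, OF assms] by simp_all

lemma obD [simp]: "x \<in> ob C \<Longrightarrow> x \<in> mor C" "x \<in> ob C \<Longrightarrow> src C x = x"
  by (auto simp: ob_def)

lemma tgt_ob [simp]: "x \<in> ob C \<Longrightarrow> tgt C x = x"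
  using src_tgt_idem(2)[of x] by simp

lemma src_tgt_ob [simp]: "f \<in> mor C \<Longrightarrow> src C f \<in> ob C" "f \<in> mor C \<Longrightarrow> tgt C f \<in> ob C"
  by (simp_all add: ob_def del: obD)

lemma triple_Cmp_unique:
  "triple g f h \<in> elts (Cmp C) \<Longrightarrow> triple g f h' \<in> elts (Cmp C) \<Longrightarrow> h = h'"
  using Cmp_unique_ax by blast

lemma triple_Cmp: "triple g f h \<in> elts (Cmp C) \<Longrightarrow> cmp C g f = h"
  unfolding cmp_def using triple_Cmp_unique by - (rule app_eqI, simp_all add: triple_def)

lemma triple_cmp:
  assumes "f \<in> mor C" "g \<in> mor C" "src C g = tgt C f"
  shows "triple g f (g \<cdot> f) \<in> elts (Cmp C)"
proof -
  obtain h where "triple g f h \<in> elts (Cmp C)"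
    using composable_ax assms by blast
  then show ?thesis using triple_Cmp by simp
qed

lemma cmp_mor [simp]:
  assumes "f \<in> mor C" "g \<in> mor C" "src C g = tgt C f"
  shows "g \<cdot> f \<in> mor C"
  using triple_cmp[OF assms] is_relation3_Cmp
  unfolding is_relation3_def mor_def by (auto dest: subsetD)

lemma src_tgt_cmp [simp]:
  assumes "f \<in> mor C" "g \<in> mor C" "src C g = tgt C f"
  shows "src C (g \<cdot> f) = src C f" "tgt C (g \<cdot> f) = tgt C g"
  using src_tgt_cmp_ax[rule_format, OF assms] by simp_all

lemma cmp_src [simp]: "f \<in> mor C \<Longrightarrow> src C f = x \<Longrightarrow> f \<cdot> x = f"
  using unit_ax by auto

lemma tgt_cmp [simp]: "f \<in> mor C \<Longrightarrow> tgt C f = y \<Longrightarrow> y \<cdot> f = f"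
  using unit_ax by auto

lemma cmp_assoc [simp]:
  assumes "f \<in> mor C" "g \<in> mor C" "h \<in> mor C" "src C g = tgt C f" "src C h = tgt C g"
  shows "(h \<cdot> g) \<cdot> f = h \<cdot> (g \<cdot> f)"
  using assoc_ax[rule_format, OF assms(1-3) conjI, OF assms(4,5)] by simp

text \<open>Composites are normalised to the right by \<open>cmp_assoc\<close>, so the left side of
  an equation g f = g' f' no longer occurs in g (f k). Here the equation is composed with k and
  rebracketed in one go.\<close>

lemma cmp_eq_cmp:
  assumes "g \<cdot> f = g' \<cdot> f'"
    and "f \<in> mor C" "g \<in> mor C" "src C g = tgt C f"
    and "f' \<in> mor C" "g' \<in> mor C" "src C g' = tgt C f'"
    and "k \<in> mor C" "src C f = tgt C k"
  shows "g \<cdot> (f \<cdot> k) = g' \<cdot> (f' \<cdot> k)"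
proof -
  have k: "src C f' = tgt C k" using assms src_tgt_cmp(1) by metis
  have "g \<cdot> (f \<cdot> k) = (g \<cdot> f) \<cdot> k" by (rule cmp_assoc[symmetric]) (use assms in blast)+
  also have "\<dots> = (g' \<cdot> f') \<cdot> k" unfolding assms(1) ..
  also have "\<dots> = g' \<cdot> (f' \<cdot> k)" by (rule cmp_assoc) (use assms k in blast)+
  finally show ?thesis .
qed

lemma hom_iff: "f \<in> hom C x y \<longleftrightarrow> f \<in> mor C \<and> src C f = x \<and> tgt C f = y"
  by (simp add: hom_def)

lemma isoE:
  assumes "iso C a"
  obtains b where "b \<in> mor C" "src C b = tgt C a" "tgt C b = src C a"
    "b \<cdot> a = src C a" "a \<cdot> b = tgt C a"
  using assms by (auto simp: iso_def hom_def)

lemma isoI: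
  "a \<in> mor C \<Longrightarrow> b \<in> mor C \<Longrightarrow> src C b = tgt C a \<Longrightarrow> tgt C b = src C a \<Longrightarrow>
    b \<cdot> a = src C a \<Longrightarrow> a \<cdot> b = tgt C a \<Longrightarrow> iso C a"
  by (auto simp: iso_def hom_def)

lemma iso_mor [simp]: "iso C a \<Longrightarrow> a \<in> mor C"
  by (simp add: iso_def)

lemma iso_ob: "x \<in> ob C \<Longrightarrow> iso C x"
  by (rule isoI[of x x]) simp_all

lemma iso_inverseE:
  assumes "iso C a"
  obtains b where "iso C b" "b \<in> mor C" "src C b = tgt C a" "tgt C b = src C a"
    "b \<cdot> a = src C a" "a \<cdot> b = tgt C a"
proof -
  obtain b where b: "b \<in> mor C" "src C b = tgt C a" "tgt C b = src C a"
    "b \<cdot> a = src C a" "a \<cdot> b = tgt C a" using assms by (rule isoE)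
  then have "iso C b" by (intro isoI[of b a]) (use assms in simp_all)
  then show ?thesis using b that by blast
qed

lemma iso_cmp:
  assumes "iso C a" "iso C a'" "src C a' = tgt C a"
  shows "iso C (a' \<cdot> a)"
proof -
  obtain b where b [simp]: "b \<in> mor C" "src C b = tgt C a" "tgt C b = src C a"
    "b \<cdot> a = src C a" "a \<cdot> b = tgt C a" using assms(1) by (rule isoE)
  obtain b' where b' [simp]: "b' \<in> mor C" "src C b' = tgt C a'" "tgt C b' = src C a'"
    "b' \<cdot> a' = src C a'" "a' \<cdot> b' = tgt C a'" using assms(2) by (rule isoE)
  note [simp] = assms
  have "b' \<cdot> (a' \<cdot> a) = a"
    using cmp_assoc[of a a' b'] by simp
  moreover have "a \<cdot> (b \<cdot> b') = b'"
    using cmp_assoc[of b' b a] by simp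
  ultimately show ?thesis
    by (intro isoI[of "a' \<cdot> a" "b \<cdot> b'"]) simp_all
qed

lemma iso_cancel_right:
  assumes "iso C a" "f \<cdot> a = g \<cdot> a"
    and [simp]: "f \<in> mor C" "g \<in> mor C" "src C f = tgt C a" "src C g = tgt C a"
  shows "f = g"
proof -
  obtain b where b [simp]: "b \<in> mor C" "src C b = tgt C a" "tgt C b = src C a" "a \<cdot> b = tgt C a"
    using assms(1) by (rule isoE)
  note [simp] = iso_mor[OF assms(1)]
  have "(f \<cdot> a) \<cdot> b = (g \<cdot> a) \<cdot> b" using assms(2) by simp
  then show ?thesis by simp
qed

text \<open>An inverse l of d c gives c the left inverse l d, an inverse r of c d gives it the right
  inverse d r, and a left and a right inverse agree.\<close>

lemma iso_of_iso_composites: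
  assumes [simp]: "c \<in> mor C" "d \<in> mor C" "src C d = tgt C c" "tgt C d = src C c"
    and "iso C (d \<cdot> c)" "iso C (c \<cdot> d)"
  shows "iso C c"
proof -
  obtain l where l [simp]: "l \<in> mor C" "src C l = src C c" "tgt C l = src C c"
    and l1: "l \<cdot> (d \<cdot> c) = src C c" using isoE[OF assms(5)] by auto
  obtain r where r [simp]: "r \<in> mor C" "src C r = tgt C c" "tgt C r = tgt C c"
    and r1: "(c \<cdot> d) \<cdot> r = tgt C c" using isoE[OF assms(6)] by auto
  have ld: "(l \<cdot> d) \<cdot> c = src C c" using l1 by simp
  have dr: "c \<cdot> (d \<cdot> r) = tgt C c" using r1 by simp
  have "(l \<cdot> d) \<cdot> (c \<cdot> (d \<cdot> r)) = ((l \<cdot> d) \<cdot> c) \<cdot> (d \<cdot> r)"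
    by simp
  then have "l \<cdot> d = d \<cdot> r" unfolding dr ld by simp
  then show ?thesis using ld dr by (intro isoI[of c "l \<cdot> d"]) simp_all
qed

end

section \<open>Preadditive categories: zero morphisms, negatives and zero objects\<close>

locale preadd =
  fixes C :: "('v::zermelo, 'b) shift_cat_scheme"
  assumes preadditive: "preadditive C"
begin

sublocale categ C
  by unfold_locales (use preadditive in \<open>simp add: preadditive_def\<close>)

abbreviation sumC (infixl "\<oplus>" 65) where "f \<oplus> g \<equiv> add C f g"

lemma
  shows is_relation3_Add: "is_relation3 (Add C) (Mor C)"
    and group_ax: "\<forall>x\<in>ob C. \<forall>y\<in>ob C.
        (\<forall>f\<in>hom C x y. \<forall>g\<in>hom C x y. add C f g \<in> hom C x y) \<and>
        (\<forall>f\<in>hom C x y. \<forall>g\<in>hom C x y. \<forall>h\<in>hom C x y.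
           add C (add C f g) h = add C f (add C g h)) \<and>
        (\<forall>f\<in>hom C x y. \<forall>g\<in>hom C x y. add C f g = add C g f) \<and>
        (\<exists>z\<in>hom C x y. (\<forall>f\<in>hom C x y. add C z f = f) \<and>
           (\<forall>f\<in>hom C x y. \<exists>g\<in>hom C x y. add C f g = z))"
    and bilinear_ax: "\<forall>x\<in>ob C. \<forall>y\<in>ob C. \<forall>z\<in>ob C.
        (\<forall>f\<in>hom C x y. \<forall>g\<in>hom C y z. \<forall>g'\<in>hom C y z.
           cmp C (add C g g') f = add C (cmp C g f) (cmp C g' f)) \<and>
        (\<forall>f\<in>hom C x y. \<forall>f'\<in>hom C x y. \<forall>g\<in>hom C y z.
           cmp C g (add C f f') = add C (cmp C g f) (cmp C g f'))"
  by (insert preadditive[unfolded preadditive_def], elim conjE, assumption)+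

lemma add_hom:
  assumes "f \<in> mor C" "g \<in> mor C" "src C f = src C g" "tgt C f = tgt C g"
  shows "f \<oplus> g \<in> hom C (src C g) (tgt C g)"
proof -
  have "f \<in> hom C (src C g) (tgt C g)" "g \<in> hom C (src C g) (tgt C g)"
    "src C g \<in> ob C" "tgt C g \<in> ob C"
    using assms by (auto simp: hom_def)
  then show ?thesis
    using group_ax by blast
qed

lemma add_mor [simp]:
  assumes "f \<in> mor C" "g \<in> mor C" "src C f = src C g" "tgt C f = tgt C g"
  shows "f \<oplus> g \<in> mor C" "src C (f \<oplus> g) = src C g" "tgt C (f \<oplus> g) = tgt C g"
  using add_hom[OF assms] by (auto simp: hom_def)

lemma add_commute:
  assumes "f \<in> mor C" "g \<in> mor C" "src C f = src C g" "tgt C f = tgt C g"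
  shows "f \<oplus> g = g \<oplus> f"
proof -
  have "f \<in> hom C (src C g) (tgt C g)" "g \<in> hom C (src C g) (tgt C g)"
    "src C g \<in> ob C" "tgt C g \<in> ob C"
    using assms by (auto simp: hom_def)
  then show ?thesis
    using group_ax by blast
qed

lemma add_assoc:
  assumes "f \<in> mor C" "g \<in> mor C" "h \<in> mor C" "src C f = src C h" "tgt C f = tgt C h"
    "src C g = src C h" "tgt C g = tgt C h"
  shows "f \<oplus> g \<oplus> h = f \<oplus> (g \<oplus> h)"
proof -
  have "f \<in> hom C (src C h) (tgt C h)" "g \<in> hom C (src C h) (tgt C h)"
    "h \<in> hom C (src C h) (tgt C h)" "src C h \<in> ob C" "tgt C h \<in> ob C"
    using assms by (auto simp: hom_def)
  then show ?thesis
    using group_ax by blast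
qed

lemma cmp_add:
  assumes "f \<in> mor C" "g \<in> mor C" "g' \<in> mor C"
    "src C g = tgt C f" "src C g' = tgt C f" "tgt C g = tgt C g'"
  shows "(g \<oplus> g') \<cdot> f = (g \<cdot> f) \<oplus> (g' \<cdot> f)"
proof -
  have "f \<in> hom C (src C f) (tgt C f)" "g \<in> hom C (tgt C f) (tgt C g')"
    "g' \<in> hom C (tgt C f) (tgt C g')" "src C f \<in> ob C" "tgt C f \<in> ob C" "tgt C g' \<in> ob C"
    using assms by (auto simp: hom_def)
  then show ?thesis
    using bilinear_ax by blast
qed

lemma add_cmp:
  assumes "f \<in> mor C" "f' \<in> mor C" "g \<in> mor C"
    "src C g = tgt C f" "src C g = tgt C f'" "src C f = src C f'"
  shows "g \<cdot> (f \<oplus> f') = (g \<cdot> f) \<oplus> (g \<cdot> f')"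
proof -
  have "f \<in> hom C (src C f') (src C g)" "f' \<in> hom C (src C f') (src C g)"
    "g \<in> hom C (src C g) (tgt C g)" "src C f' \<in> ob C" "src C g \<in> ob C" "tgt C g \<in> ob C"
    using assms by (auto simp: hom_def)
  then show ?thesis
    using bilinear_ax by blast
qed

lemma ex_zero:
  assumes "x \<in> ob C" "y \<in> ob C"
  shows "\<exists>z\<in>hom C x y. (\<forall>f\<in>hom C x y. z \<oplus> f = f) \<and> (\<forall>f\<in>hom C x y. \<exists>g\<in>hom C x y. f \<oplus> g = z)"
  using group_ax assms by blast

lemma zero_eqI:
  assumes "z \<in> hom C x y" "\<And>f. f \<in> hom C x y \<Longrightarrow> z \<oplus> f = f"
  shows "zero C x y = z"
  unfolding zero_def
proof (rule the_equality)
  fix w assume w: "w \<in> hom C x y \<and> (\<forall>f\<in>hom C x y. w \<oplus> f = f)"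
  have "w = z \<oplus> w" using assms(2) w by simp
  also have "\<dots> = w \<oplus> z" using assms w by - (rule add_commute, auto simp: hom_def)
  also have "\<dots> = z" using assms(1) w by simp
  finally show "w = z" .
qed (use assms in blast)

lemma zero_works:
  assumes "x \<in> ob C" "y \<in> ob C"
  shows "zero C x y \<in> hom C x y \<and> (\<forall>f\<in>hom C x y. zero C x y \<oplus> f = f) \<and>
    (\<forall>f\<in>hom C x y. \<exists>g\<in>hom C x y. f \<oplus> g = zero C x y)"
proof -
  obtain z where z: "z\<in>hom C x y" "\<forall>f\<in>hom C x y. z \<oplus> f = f"
    "\<forall>f\<in>hom C x y. \<exists>g\<in>hom C x y. f \<oplus> g = z" using ex_zero[OF assms] by blast
  then have "zero C x y = z" by - (rule zero_eqI, auto)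
  then show ?thesis using z by blast
qed

lemma zero_mor [simp]:
  assumes "x \<in> ob C" "y \<in> ob C"
  shows "zero C x y \<in> mor C" "src C (zero C x y) = x" "tgt C (zero C x y) = y"
  using zero_works[OF assms] by (auto simp: hom_def)

lemma zero_add [simp]:
  assumes "f \<in> mor C" "src C f = x" "tgt C f = y"
  shows "zero C x y \<oplus> f = f"
  using assms zero_works[of x y] by (auto simp: hom_def)

lemma add_zero [simp]:
  assumes "f \<in> mor C" "src C f = x" "tgt C f = y"
  shows "f \<oplus> zero C x y = f"
  using assms zero_add[OF assms] add_commute[of f "zero C x y"] by auto

lemma ex_neg:
  assumes "f \<in> mor C"
  obtains g where "g \<in> mor C" "src C g = src C f" "tgt C g = tgt C f"
    "f \<oplus> g = zero C (src C f) (tgt C f)"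
proof -
  have "f \<in> hom C (src C f) (tgt C f)" using assms by (simp add: hom_def)
  then show ?thesis using that zero_works[of "src C f" "tgt C f"] assms
    by (auto simp: hom_def)
qed

lemma add_left_cancel:
  assumes [simp]: "f \<in> mor C" "g \<in> mor C" "h \<in> mor C" "src C g = src C f" "tgt C g = tgt C f"
    "src C h = src C f" "tgt C h = tgt C f"
    and eq: "f \<oplus> g = f \<oplus> h"
  shows "g = h"
proof -
  obtain k where [simp]: "k \<in> mor C" "src C k = src C f" "tgt C k = tgt C f"
    and k: "f \<oplus> k = zero C (src C f) (tgt C f)" using assms(1) by (rule ex_neg)
  have "k \<oplus> f = zero C (src C f) (tgt C f)" using k by (simp add: add_commute[of k f])
  moreover have "k \<oplus> f \<oplus> g = k \<oplus> f \<oplus> h" using eq by (simp add: add_assoc)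
  ultimately show ?thesis by simp
qed

text \<open>In a group only the neutral element satisfies e + e = e. Zero morphisms are recognised
  by this throughout: additive maps visibly preserve the equation, and it involves no
  description.\<close>

lemma zero_of_idem:
  assumes "e \<in> mor C" "e \<oplus> e = e"
  shows "e = zero C (src C e) (tgt C e)"
  by (rule add_left_cancel[of e]) (use assms in simp_all)

lemma neg_works:
  assumes "f \<in> mor C"
  shows "neg C f \<in> hom C (src C f) (tgt C f) \<and> f \<oplus> neg C f = zero C (src C f) (tgt C f)"
proof -
  obtain g where "g \<in> mor C" "src C g = src C f" "tgt C g = tgt C f"
    "f \<oplus> g = zero C (src C f) (tgt C f)" using assms by (rule ex_neg)
  then have g: "g \<in> hom C (src C f) (tgt C f) \<and> f \<oplus> g = zero C (src C f) (tgt C f)"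
    by (simp add: hom_def)
  show ?thesis unfolding neg_def
  proof (rule theI[of _ g])
    fix k assume "k \<in> hom C (src C f) (tgt C f) \<and> f \<oplus> k = zero C (src C f) (tgt C f)"
    then show "k = g" using g assms by - (rule add_left_cancel[of f], simp_all add: hom_def)
  qed (rule g)
qed

lemma neg_mor [simp]:
  assumes "f \<in> mor C"
  shows "neg C f \<in> mor C" "src C (neg C f) = src C f" "tgt C (neg C f) = tgt C f"
  using neg_works[OF assms] by (auto simp: hom_def)

lemma add_neg: "f \<in> mor C \<Longrightarrow> f \<oplus> neg C f = zero C (src C f) (tgt C f)"
  using neg_works by blast

lemma neg_eqI:
  assumes "f \<in> mor C" "g \<in> mor C" "src C g = src C f" "tgt C g = tgt C f"
    "f \<oplus> g = zero C (src C f) (tgt C f)"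
  shows "neg C f = g"
  by (rule add_left_cancel[of f]) (use assms add_neg in simp_all)

lemma neg_neg [simp]: "f \<in> mor C \<Longrightarrow> neg C (neg C f) = f"
  by (rule neg_eqI) (simp_all add: add_neg add_commute[of "neg C f" f])

lemma neg_zero [simp]: "x \<in> ob C \<Longrightarrow> y \<in> ob C \<Longrightarrow> neg C (zero C x y) = zero C x y"
  by (rule neg_eqI) simp_all

lemma cmp_zero [simp]:
  assumes [simp]: "f \<in> mor C" "x \<in> ob C" "y = src C f"
  shows "f \<cdot> zero C x y = zero C x (tgt C f)"
proof -
  have "f \<cdot> (zero C x y \<oplus> zero C x y) = f \<cdot> zero C x y \<oplus> f \<cdot> zero C x y"
    by (rule add_cmp) simp_all
  then have "f \<cdot> zero C x y \<oplus> f \<cdot> zero C x y = f \<cdot> zero C x y" by simp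
  from zero_of_idem[OF _ this] show ?thesis by simp
qed

lemma zero_cmp [simp]:
  assumes [simp]: "f \<in> mor C" "y \<in> ob C" "x = tgt C f"
  shows "zero C x y \<cdot> f = zero C (src C f) y"
proof -
  have "(zero C x y \<oplus> zero C x y) \<cdot> f = zero C x y \<cdot> f \<oplus> zero C x y \<cdot> f"
    by (rule cmp_add) simp_all
  then have "zero C x y \<cdot> f \<oplus> zero C x y \<cdot> f = zero C x y \<cdot> f" by simp
  from zero_of_idem[OF _ this] show ?thesis by simp
qed

lemma cmp_neg [simp]:
  assumes [simp]: "f \<in> mor C" "g \<in> mor C" "src C g = tgt C f"
  shows "g \<cdot> neg C f = neg C (g \<cdot> f)"
  by (rule neg_eqI[symmetric]) (simp_all add: add_neg flip: add_cmp)

lemma neg_cmp [simp]: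
  assumes [simp]: "f \<in> mor C" "g \<in> mor C" "src C g = tgt C f"
  shows "neg C g \<cdot> f = neg C (g \<cdot> f)"
  by (rule neg_eqI[symmetric]) (simp_all add: add_neg flip: cmp_add)

lemma neg_inject:
  assumes "f \<in> mor C" "g \<in> mor C" "neg C f = neg C g"
  shows "f = g"
  using assms neg_neg by metis

lemma neg_ob_cancel:
  "f \<in> mor C \<Longrightarrow> src C f = x \<Longrightarrow> f \<cdot> neg C x = neg C f"
  "f \<in> mor C \<Longrightarrow> tgt C f = y \<Longrightarrow> neg C y \<cdot> f = neg C f"
  by auto

lemma iso_neg:
  assumes "iso C a"
  shows "iso C (neg C a)"
proof -
  obtain b where [simp]: "b \<in> mor C" "src C b = tgt C a" "tgt C b = src C a"
    "b \<cdot> a = src C a" "a \<cdot> b = tgt C a" using assms by (rule isoE)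
  note [simp] = iso_mor[OF assms]
  show ?thesis by (rule isoI[of _ "neg C b"]) simp_all
qed

lemma eq_of_add_neg:
  assumes [simp]: "f \<in> mor C" "g \<in> mor C" "src C f = src C g" "tgt C f = tgt C g"
    and eq: "f \<oplus> neg C g = zero C (src C g) (tgt C g)"
  shows "f = g"
proof -
  have "neg C g \<oplus> f = f \<oplus> neg C g" by (rule add_commute) simp_all
  then have "neg C (neg C g) = f" by - (rule neg_eqI, simp_all add: eq)
  then show ?thesis by simp
qed

lemma zero_ob [simp]: "zero_object C z \<Longrightarrow> z \<in> ob C"
  by (simp add: zero_object_def)

lemma zero_object_unique:
  assumes "zero_object C z" "x \<in> ob C"
  shows "\<exists>!f. f \<in> hom C x z" "\<exists>!f. f \<in> hom C z x"
  using assms unfolding zero_object_def by blast+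

lemma to_zero_object:
  assumes "zero_object C z" "f \<in> mor C" "tgt C f = z"
  shows "f = zero C (src C f) z"
proof -
  have "\<exists>!g. g \<in> hom C (src C f) z" by (rule zero_object_unique) (use assms in simp_all)
  moreover have "f \<in> hom C (src C f) z" "zero C (src C f) z \<in> hom C (src C f) z"
    using assms by (simp_all add: hom_def)
  ultimately show ?thesis by blast
qed

lemma from_zero_object:
  assumes "zero_object C z" "f \<in> mor C" "src C f = z"
  shows "f = zero C z (tgt C f)"
proof -
  have "\<exists>!g. g \<in> hom C z (tgt C f)" by (rule zero_object_unique) (use assms in simp_all)
  moreover have "f \<in> hom C z (tgt C f)" "zero C z (tgt C f) \<in> hom C z (tgt C f)"
    using assms by (simp_all add: hom_def)
  ultimately show ?thesis by blast
qed

text \<open>Every morphism into or out of z passes through the identity of z, which is assumed to be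
  zero. As objects are identity morphisms, the assumption can be written as an equation for z
  itself.\<close>

lemma zero_objectI:
  assumes z [simp]: "z \<in> ob C" and id: "z = zero C z z"
  shows "zero_object C z"
  unfolding zero_object_def
proof (intro conjI ballI)
  fix x assume x [simp]: "x \<in> ob C"
  have "f = zero C z x" if "f \<in> hom C z x" for f
  proof -
    have f: "f \<in> mor C" "src C f = z" "tgt C f = x" using that by (simp_all add: hom_def)
    then have "f = f \<cdot> z" by simp
    also have "\<dots> = f \<cdot> zero C z z" using id by (rule arg_cong)
    also have "\<dots> = zero C z x" using f by simp
    finally show ?thesis .
  qed
  moreover have "zero C z x \<in> hom C z x" by (simp add: hom_def)
  ultimately show "\<exists>!f. f \<in> hom C z x" by blast
  have "f = zero C x z" if "f \<in> hom C x z" for f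
  proof -
    have f: "f \<in> mor C" "src C f = x" "tgt C f = z" using that by (simp_all add: hom_def)
    then have "f = z \<cdot> f" by simp
    also have "\<dots> = zero C z z \<cdot> f" using id by (rule arg_cong)
    also have "\<dots> = zero C x z" using f by simp
    finally show ?thesis .
  qed
  moreover have "zero C x z \<in> hom C x z" by (simp add: hom_def)
  ultimately show "\<exists>!f. f \<in> hom C x z" by blast
qed (rule z)

end

section \<open>Triangulated categories\<close>

locale shift_preadd = preadd C for C :: "('v::zermelo, 'b) shift_cat_scheme" +
  assumes functor_shift: "is_functor C C (Shift C)"
    and additive_shift: "is_additive C C (Shift C)"
    and bij_shift: "bij_betw (shift C) (mor C) (mor C)"

locale pretri = shift_preadd C for C :: "'v::zermelo tri_cat" +
  assumes ex_zero_object: "\<exists>z. zero_object C z"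
    and ex_biproduct: "\<forall>x\<in>ob C. \<forall>y\<in>ob C. \<exists>b i j p q. biproduct C x y b i j p q"
    and is_relation3_Tri: "is_relation3 (Tri C) (Mor C)"
    and dist_triangle: "\<forall>f g h. dist C f g h \<longrightarrow> triangle C f g h"
    and dist_iso_ax: "\<forall>f g h f' g' h'.
      dist C f g h \<and> triangle C f' g' h' \<and> triangle_iso C f g h f' g' h' \<longrightarrow> dist C f' g' h'"
    and dist_ident_ax: "\<forall>x z. x \<in> ob C \<and> zero_object C z \<longrightarrow>
      dist C x (zero C x z) (zero C z (shift C x))"
    and ex_dist: "\<forall>f\<in>mor C. \<exists>g h. dist C f g h"
    and rotate_ax:
      "\<forall>f g h. triangle C f g h \<longrightarrow> (dist C f g h \<longleftrightarrow> dist C g h (neg C (shift C f)))"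
    and complete_ax: "\<forall>f g h f' g' h' a b. dist C f g h \<and> dist C f' g' h' \<and>
        a \<in> hom C (src C f) (src C f') \<and> b \<in> hom C (tgt C f) (tgt C f') \<and>
        cmp C b f = cmp C f' a \<longrightarrow>
        (\<exists>c. triangle_mor C f g h f' g' h' a b c)"

definition octahedral :: "'v::zermelo tri_cat \<Rightarrow> bool" where
  "octahedral T \<longleftrightarrow>
     (\<forall>f f1 f2 g g1 g2 k1 k2. src T g = tgt T f \<and>
        dist T f f1 f2 \<and> dist T g g1 g2 \<and> dist T (cmp T g f) k1 k2 \<longrightarrow>
        (\<exists>u v. dist T u v (cmp T (shift T f1) g2) \<and>
           triangle_mor T f f1 f2 (cmp T g f) k1 k2 (src T f) g u \<and>
           triangle_mor T (cmp T g f) k1 k2 g g1 g2 f (tgt T g) v))"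

lemma triangulated_iff: "triangulated T \<longleftrightarrow> pretri T \<and> octahedral T"
  unfolding triangulated_def pretri_def pretri_axioms_def shift_preadd_def shift_preadd_axioms_def
    preadd_def octahedral_def additive_cat_def
  by (simp only: conj_ac)

context shift_preadd
begin

lemma is_function_Shift: "is_function (Shift C) (Mor C) (Mor C)"
  using functor_shift unfolding is_functor_def by blast

lemma shift_mor [simp]: "f \<in> mor C \<Longrightarrow> shift C f \<in> mor C"
  unfolding mor_def shift_def by (rule is_function_app(2)[OF is_function_Shift])

lemma src_shift [simp]: "f \<in> mor C \<Longrightarrow> src C (shift C f) = shift C (src C f)"
  and tgt_shift [simp]: "f \<in> mor C \<Longrightarrow> tgt C (shift C f) = shift C (tgt C f)"
proof -
  have "\<forall>f\<in>mor C. app (Shift C) (src C f) = src C (app (Shift C) f) \<and>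
    app (Shift C) (tgt C f) = tgt C (app (Shift C) f)"
    using functor_shift unfolding is_functor_def by (elim conjE)
  then show "f \<in> mor C \<Longrightarrow> src C (shift C f) = shift C (src C f)"
    "f \<in> mor C \<Longrightarrow> tgt C (shift C f) = shift C (tgt C f)"
    by (simp_all add: shift_def)
qed

lemma shift_ob [simp]: "x \<in> ob C \<Longrightarrow> shift C x \<in> ob C"
  unfolding ob_def by simp

lemma shift_cmp [simp]:
  assumes "f \<in> mor C" "g \<in> mor C" "src C g = tgt C f"
  shows "shift C (g \<cdot> f) = shift C g \<cdot> shift C f"
proof -
  have "\<forall>f\<in>mor C. \<forall>g\<in>mor C. src C g = tgt C f \<longrightarrow>
    app (Shift C) (cmp C g f) = cmp C (app (Shift C) g) (app (Shift C) f)"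
    using functor_shift unfolding is_functor_def by (elim conjE)
  then show ?thesis using assms by (simp add: shift_def)
qed

lemma shift_add [simp]:
  assumes "f \<in> mor C" "g \<in> mor C" "src C f = src C g" "tgt C f = tgt C g"
  shows "shift C (f \<oplus> g) = shift C f \<oplus> shift C g"
  using additive_shift assms unfolding is_additive_def by (simp add: shift_def)

lemma shift_inj: "shift C f = shift C g \<Longrightarrow> f \<in> mor C \<Longrightarrow> g \<in> mor C \<Longrightarrow> f = g"
  using bij_shift unfolding bij_betw_def inj_on_def by blast

text \<open>The shift is an automorphism and not merely an equivalence, so it has a strict inverse
  on morphisms, and triangles can be rotated backwards without auxiliary isomorphisms.\<close>

definition unshift :: "'v \<Rightarrow> 'v" where
  "unshift = the_inv_into (mor C) (shift C)"

lemma unshift_mor [simp]: "f \<in> mor C \<Longrightarrow> unshift f \<in> mor C"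
  unfolding unshift_def using bij_betw_the_inv_into[OF bij_shift] by (rule bij_betwE[rule_format])

lemma shift_unshift [simp]: "f \<in> mor C \<Longrightarrow> shift C (unshift f) = f"
  unfolding unshift_def using bij_shift by (simp add: f_the_inv_into_f_bij_betw)

lemma unshift_shift [simp]: "f \<in> mor C \<Longrightarrow> unshift (shift C f) = f"
  by (rule shift_inj) simp_all

lemma src_unshift [simp]: "f \<in> mor C \<Longrightarrow> src C (unshift f) = unshift (src C f)"
  by (rule shift_inj) (simp_all flip: src_shift)

lemma tgt_unshift [simp]: "f \<in> mor C \<Longrightarrow> tgt C (unshift f) = unshift (tgt C f)"
  by (rule shift_inj) (simp_all flip: tgt_shift)

lemma unshift_ob [simp]: "x \<in> ob C \<Longrightarrow> unshift x \<in> ob C"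
  unfolding ob_def by simp

lemma shift_zero [simp]:
  assumes [simp]: "x \<in> ob C" "y \<in> ob C"
  shows "shift C (zero C x y) = zero C (shift C x) (shift C y)"
proof -
  have "shift C (zero C x y \<oplus> zero C x y) = shift C (zero C x y) \<oplus> shift C (zero C x y)"
    by (rule shift_add) simp_all
  then have "shift C (zero C x y) \<oplus> shift C (zero C x y) = shift C (zero C x y)" by simp
  from zero_of_idem[OF _ this] show ?thesis by simp
qed

lemma shift_neg [simp]:
  assumes [simp]: "f \<in> mor C"
  shows "shift C (neg C f) = neg C (shift C f)"
proof (rule neg_eqI[symmetric])
  have "shift C f \<oplus> shift C (neg C f) = shift C (f \<oplus> neg C f)" by (rule shift_add[symmetric]) simp_all
  then show "shift C f \<oplus> shift C (neg C f) = zero C (src C (shift C f)) (tgt C (shift C f))"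
    by (simp add: add_neg)
qed simp_all

lemma unshift_zero [simp]:
  "x \<in> ob C \<Longrightarrow> y \<in> ob C \<Longrightarrow> unshift (zero C x y) = zero C (unshift x) (unshift y)"
  by (rule shift_inj) simp_all

lemma iso_shift:
  assumes "iso C a"
  shows "iso C (shift C a)"
proof -
  obtain b where b: "b \<in> mor C" "src C b = tgt C a" "tgt C b = src C a"
    "b \<cdot> a = src C a" "a \<cdot> b = tgt C a" using assms by (rule isoE)
  have a: "a \<in> mor C" using assms by simp
  have "shift C (b \<cdot> a) = shift C (src C a)" "shift C (a \<cdot> b) = shift C (tgt C a)"
    using b by simp_all
  then show ?thesis using a b(1-3) by - (rule isoI[of _ "shift C b"], simp_all)
qed

lemma iso_unshift:
  assumes "iso C a"
  shows "iso C (unshift a)"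
proof -
  obtain b where b: "b \<in> mor C" "src C b = tgt C a" "tgt C b = src C a"
    "b \<cdot> a = src C a" "a \<cdot> b = tgt C a" using assms by (rule isoE)
  have a: "a \<in> mor C" using assms by simp
  have "unshift b \<cdot> unshift a = unshift (src C a)"
    by (rule shift_inj) (use a b in simp_all)
  moreover have "unshift a \<cdot> unshift b = unshift (tgt C a)"
    by (rule shift_inj) (use a b in simp_all)
  ultimately show ?thesis using a b(1-3) by - (rule isoI[of _ "unshift b"], simp_all)
qed

lemma triangleI:
  "f \<in> mor C \<Longrightarrow> g \<in> mor C \<Longrightarrow> h \<in> mor C \<Longrightarrow> src C g = tgt C f \<Longrightarrow> src C h = tgt C g \<Longrightarrow>
    tgt C h = shift C (src C f) \<Longrightarrow> triangle C f g h"
  by (simp add: triangle_def)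

lemma triangle_morD:
  assumes "triangle_mor C f g h f' g' h' a b c"
  shows "a \<in> mor C" "src C a = src C f" "tgt C a = src C f'"
    "b \<in> mor C" "src C b = src C g" "tgt C b = src C g'"
    "c \<in> mor C" "src C c = src C h" "tgt C c = src C h'"
    "b \<cdot> f = f' \<cdot> a" "c \<cdot> g = g' \<cdot> b" "shift C a \<cdot> h = h' \<cdot> c"
  using assms unfolding triangle_mor_def hom_def by blast+

lemma triangle_morI:
  "a \<in> mor C \<Longrightarrow> src C a = src C f \<Longrightarrow> tgt C a = src C f' \<Longrightarrow>
    b \<in> mor C \<Longrightarrow> src C b = src C g \<Longrightarrow> tgt C b = src C g' \<Longrightarrow>
    c \<in> mor C \<Longrightarrow> src C c = src C h \<Longrightarrow> tgt C c = src C h' \<Longrightarrow>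
    b \<cdot> f = f' \<cdot> a \<Longrightarrow> c \<cdot> g = g' \<cdot> b \<Longrightarrow> shift C a \<cdot> h = h' \<cdot> c \<Longrightarrow>
    triangle_mor C f g h f' g' h' a b c"
  unfolding triangle_mor_def hom_def by blast

lemma triangleD:
  assumes "triangle C f g h"
  shows "f \<in> mor C" "g \<in> mor C" "h \<in> mor C" "src C g = tgt C f" "src C h = tgt C g"
    "tgt C h = shift C (src C f)"
  using assms unfolding triangle_def by blast+

lemma triangle_mor_cmp:
  assumes t: "triangle C f g h" "triangle C f' g' h'" "triangle C f'' g'' h''"
    and m: "triangle_mor C f g h f' g' h' a b c" "triangle_mor C f' g' h' f'' g'' h'' a' b' c'"
  shows "triangle_mor C f g h f'' g'' h'' (a' \<cdot> a) (b' \<cdot> b) (c' \<cdot> c)"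
proof -
  note t1 [simp] = triangleD[OF t(1)] and t2 [simp] = triangleD[OF t(2)]
    and t3 [simp] = triangleD[OF t(3)]
  note m1 [simp] = triangle_morD(1-9)[OF m(1)] and m2 [simp] = triangle_morD(1-9)[OF m(2)]
  show ?thesis
  proof (rule triangle_morI)
    have "(b' \<cdot> b) \<cdot> f = b' \<cdot> (f' \<cdot> a)" by (simp add: triangle_morD(10)[OF m(1)])
    also have "\<dots> = f'' \<cdot> (a' \<cdot> a)"
      by (rule cmp_eq_cmp[OF triangle_morD(10)[OF m(2)]]) simp_all
    finally show "(b' \<cdot> b) \<cdot> f = f'' \<cdot> (a' \<cdot> a)" .
    have "(c' \<cdot> c) \<cdot> g = c' \<cdot> (g' \<cdot> b)" by (simp add: triangle_morD(11)[OF m(1)])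
    also have "\<dots> = g'' \<cdot> (b' \<cdot> b)"
      by (rule cmp_eq_cmp[OF triangle_morD(11)[OF m(2)]]) simp_all
    finally show "(c' \<cdot> c) \<cdot> g = g'' \<cdot> (b' \<cdot> b)" .
    have "shift C (a' \<cdot> a) \<cdot> h = shift C a' \<cdot> (h' \<cdot> c)"
      by (simp add: triangle_morD(12)[OF m(1)])
    also have "\<dots> = h'' \<cdot> (c' \<cdot> c)"
      by (rule cmp_eq_cmp[OF triangle_morD(12)[OF m(2)]]) simp_all
    finally show "shift C (a' \<cdot> a) \<cdot> h = h'' \<cdot> (c' \<cdot> c)" .
  qed simp_all
qed

text \<open>The identity b' b is inserted in front of f a', and the square turns b f a' into f' a a'
  = f'. This serves each of the three squares of an isomorphism of triangles.\<close>

lemma square_inverse: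
  assumes eq: "b \<cdot> f = f' \<cdot> a"
    and [simp]: "f \<in> mor C" "f' \<in> mor C" "a \<in> mor C" "b \<in> mor C" "a' \<in> mor C" "b' \<in> mor C"
    "src C a = src C f" "tgt C a = src C f'" "src C b = tgt C f" "tgt C b = tgt C f'"
    "src C a' = src C f'" "tgt C a' = src C f" "src C b' = tgt C f'" "tgt C b' = tgt C f"
    and inv: "a \<cdot> a' = src C f'" "b' \<cdot> b = tgt C f"
  shows "b' \<cdot> f' = f \<cdot> a'"
proof -
  have "f \<cdot> a' = (b' \<cdot> b) \<cdot> (f \<cdot> a')" unfolding inv by simp
  also have "\<dots> = b' \<cdot> (b \<cdot> (f \<cdot> a'))" by (rule cmp_assoc) simp_all
  also have "b \<cdot> (f \<cdot> a') = f' \<cdot> (a \<cdot> a')" by (rule cmp_eq_cmp[OF eq]) simp_all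
  also have "\<dots> = f'" by (simp add: inv)
  finally show ?thesis ..
qed

lemma triangle_mor_inverse:
  assumes t: "triangle C f g h" "triangle C f' g' h'"
    and m: "triangle_mor C f g h f' g' h' a b c"
    and a [simp]: "a' \<in> mor C" "src C a' = tgt C a" "tgt C a' = src C a" "a' \<cdot> a = src C a" "a \<cdot> a' = tgt C a"
    and b [simp]: "b' \<in> mor C" "src C b' = tgt C b" "tgt C b' = src C b" "b' \<cdot> b = src C b" "b \<cdot> b' = tgt C b"
    and c [simp]: "c' \<in> mor C" "src C c' = tgt C c" "tgt C c' = src C c" "c' \<cdot> c = src C c" "c \<cdot> c' = tgt C c"
  shows "triangle_mor C f' g' h' f g h a' b' c'"
proof -
  note [simp] = triangleD[OF t(1)] triangleD[OF t(2)] triangle_morD(1-9)[OF m]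
  have aa: "shift C a' \<cdot> shift C a = shift C (src C a)"
    using a by (simp flip: shift_cmp del: shift_cmp)
  show ?thesis
  proof (rule triangle_morI)
    show "b' \<cdot> f' = f \<cdot> a'"
      by (rule square_inverse[OF triangle_morD(10)[OF m]]) simp_all
    show "c' \<cdot> g' = g \<cdot> b'"
      by (rule square_inverse[OF triangle_morD(11)[OF m]]) simp_all
    show "shift C a' \<cdot> h' = h \<cdot> c'"
      by (rule square_inverse[OF triangle_morD(12)[OF m]]) (use aa in simp_all)
  qed simp_all
qed

lemma triangle_iso_sym:
  assumes t: "triangle C f g h" "triangle C f' g' h'" and "triangle_iso C f g h f' g' h'"
  shows "triangle_iso C f' g' h' f g h"
proof -
  obtain a b c where abc: "iso C a" "iso C b" "iso C c" "triangle_mor C f g h f' g' h' a b c"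
    using assms(3) unfolding triangle_iso_def by blast
  obtain a' where a: "iso C a'" "a' \<in> mor C" "src C a' = tgt C a" "tgt C a' = src C a"
    "a' \<cdot> a = src C a" "a \<cdot> a' = tgt C a" using abc(1) by (rule iso_inverseE)
  obtain b' where b: "iso C b'" "b' \<in> mor C" "src C b' = tgt C b" "tgt C b' = src C b"
    "b' \<cdot> b = src C b" "b \<cdot> b' = tgt C b" using abc(2) by (rule iso_inverseE)
  obtain c' where c: "iso C c'" "c' \<in> mor C" "src C c' = tgt C c" "tgt C c' = src C c"
    "c' \<cdot> c = src C c" "c \<cdot> c' = tgt C c" using abc(3) by (rule iso_inverseE)
  show ?thesis unfolding triangle_iso_def
    using a(1) b(1) c(1) triangle_mor_inverse[OF t abc(4) a(2-6) b(2-6) c(2-6)] by blast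
qed

lemma triangle_iso_trans:
  assumes t: "triangle C f g h" "triangle C f' g' h'" "triangle C f'' g'' h''"
    and i: "triangle_iso C f g h f' g' h'" "triangle_iso C f' g' h' f'' g'' h''"
  shows "triangle_iso C f g h f'' g'' h''"
proof -
  obtain a b c where 1: "iso C a" "iso C b" "iso C c" "triangle_mor C f g h f' g' h' a b c"
    using i(1) unfolding triangle_iso_def by blast
  obtain a' b' c' where 2: "iso C a'" "iso C b'" "iso C c'"
    "triangle_mor C f' g' h' f'' g'' h'' a' b' c'"
    using i(2) unfolding triangle_iso_def by blast
  have "iso C (a' \<cdot> a)" "iso C (b' \<cdot> b)" "iso C (c' \<cdot> c)"
    using 1(1-3) 2(1-3) triangle_morD[OF 1(4)] triangle_morD[OF 2(4)] by (simp_all add: iso_cmp)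
  then show ?thesis
    unfolding triangle_iso_def using triangle_mor_cmp[OF t 1(4) 2(4)] by blast
qed

end

section \<open>Exactness of triangles and the five lemma\<close>

context pretri
begin

lemma distD:
  assumes "dist C f g h"
  shows "f \<in> mor C" "g \<in> mor C" "h \<in> mor C" "src C g = tgt C f" "src C h = tgt C g"
    "tgt C h = shift C (src C f)"
  using dist_triangle[rule_format, OF assms] unfolding triangle_def by blast+

lemma rotate: "dist C f g h \<Longrightarrow> dist C g h (neg C (shift C f))"
  using rotate_ax dist_triangle by blast

lemma rotate_back:
  assumes "dist C f g h"
  shows "dist C (unshift (neg C h)) f g"
proof -
  note [simp] = distD[OF assms]
  \<comment> \<open>Rotating this triangle forward negates and shifts its first morphism; the sign
    is put in so that the two negations cancel and h returns.\<close>
  have "triangle C (unshift (neg C h)) f g" by (rule triangleI) simp_all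
  then show ?thesis using rotate_ax assms by simp
qed

lemma dist_iso:
  "dist C f g h \<Longrightarrow> triangle C f' g' h' \<Longrightarrow> triangle_iso C f g h f' g' h' \<Longrightarrow> dist C f' g' h'"
  using dist_iso_ax by blast

lemma dist_ident:
  "x \<in> ob C \<Longrightarrow> zero_object C z \<Longrightarrow> dist C x (zero C x z) (zero C z (shift C x))"
  using dist_ident_ax by blast

lemma complete:
  assumes "dist C f g h" "dist C f' g' h'" "a \<in> mor C" "src C a = src C f" "tgt C a = src C f'"
    "b \<in> mor C" "src C b = tgt C f" "tgt C b = tgt C f'" "b \<cdot> f = f' \<cdot> a"
  obtains c where "c \<in> mor C" "src C c = tgt C g" "tgt C c = tgt C g'"
    "c \<cdot> g = g' \<cdot> b" "shift C a \<cdot> h = h' \<cdot> c"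
proof -
  have "a \<in> hom C (src C f) (src C f')" "b \<in> hom C (tgt C f) (tgt C f')"
    using assms by (simp_all add: hom_def)
  then obtain c where m: "triangle_mor C f g h f' g' h' a b c"
    using complete_ax assms by blast
  show ?thesis
    by (rule that[of c]) (use triangle_morD[OF m] distD[OF assms(1)] distD[OF assms(2)] in simp_all)
qed

text \<open>A triangle starting with k is rotated backwards; u is then a fibre of k.\<close>

lemma ex_dist_right:
  assumes "k \<in> mor C"
  obtains u h where "dist C u k h"
  using ex_dist assms rotate_back by blast

text \<open>TR3, applied to the identity of the source and to f, maps the triangle x \<rightarrow> x
  \<rightarrow> 0 \<rightarrow> \<Sigma>x into the given one, so that g f factors through a zero
  object.\<close>

lemma dist_cmp_zero:
  assumes "dist C f g h"
  shows "g \<cdot> f = zero C (src C f) (tgt C g)"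
proof -
  obtain z where z: "zero_object C z" using ex_zero_object by blast
  note [simp] = distD[OF assms] zero_ob[OF z]
  have "dist C (src C f) (zero C (src C f) z) (zero C z (shift C (src C f)))"
    using z by (rule dist_ident[rotated]) simp
  from this assms obtain c where "c \<in> mor C" "src C c = z" "tgt C c = tgt C g"
    "c \<cdot> zero C (src C f) z = g \<cdot> f"
    by (rule complete[where a = "src C f" and b = f]) simp_all
  then show ?thesis by simp
qed

text \<open>The two exactness properties come from comparing with the rotations of the triangle
  \<open>w \<rightarrow> w \<rightarrow> 0 \<rightarrow> \<Sigma>w\<close>.\<close>

lemma weak_kernel:
  assumes d: "dist C f g h" and k [simp]: "k \<in> mor C" "tgt C k = tgt C f"
    and gk: "g \<cdot> k = zero C (src C k) (tgt C g)"
  obtains m where "m \<in> mor C" "src C m = src C k" "tgt C m = src C f" "f \<cdot> m = k"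
proof -
  obtain z where z: "zero_object C z" using ex_zero_object by blast
  note [simp] = distD[OF d] zero_ob[OF z]
  define w where "w = src C k"
  have w [simp]: "w \<in> ob C" "src C k = w" by (simp_all add: w_def)
  have "dist C (zero C w z) (zero C z (shift C w)) (neg C (shift C w))"
    using z by (intro rotate dist_ident) simp_all
  from this rotate[OF d] obtain c where c: "c \<in> mor C" "src C c = shift C w" "tgt C c = tgt C h"
    "shift C k \<cdot> neg C (shift C w) = neg C (shift C f) \<cdot> c"
    by (rule complete[where a = k and b = "zero C z (tgt C g)"]) (simp_all add: gk)
  have fm: "neg C (shift C f) \<cdot> c = neg C (shift C (f \<cdot> unshift c))"
    using c(1-3) by simp
  \<comment> \<open>Both rotated triangles end in a negated morphism, so the signs on the two sides
    cancel and the shift can be undone.\<close>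
  have "shift C k \<cdot> neg C (shift C w) = neg C (shift C k)"
    by (rule neg_ob_cancel) simp_all
  then have "neg C (shift C k) = neg C (shift C (f \<cdot> unshift c))"
    using c(4) fm by simp
  then have "shift C k = shift C (f \<cdot> unshift c)"
    by (rule neg_inject[rotated 2]) (use c(1-3) in simp_all)
  then have fc: "f \<cdot> unshift c = k"
    by (rule shift_inj[OF sym]) (use c(1-3) in simp_all)
  show ?thesis by (rule that[of "unshift c"]) (use c(1-3) in \<open>simp_all add: fc\<close>)
qed

lemma weak_cokernel:
  assumes d: "dist C f g h" and n [simp]: "n \<in> mor C" "src C n = tgt C g"
    and ng: "n \<cdot> g = zero C (src C g) (tgt C n)"
  obtains m where "m \<in> mor C" "src C m = tgt C h" "tgt C m = tgt C n" "m \<cdot> h = n"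
proof -
  obtain z where z: "zero_object C z" using ex_zero_object by blast
  note [simp] = distD[OF d] zero_ob[OF z]
  define w where "w = tgt C n"
  have w [simp]: "w \<in> ob C" "tgt C n = w" by (simp_all add: w_def)
  have "dist C (unshift (neg C (zero C z (shift C w)))) w (zero C w z)"
    using z by (intro rotate_back dist_ident) simp_all
  then have "dist C (zero C (unshift z) w) w (zero C w z)" by simp
  from rotate[OF d] this obtain c where c: "c \<in> mor C" "src C c = tgt C h" "tgt C c = w"
    "c \<cdot> h = w \<cdot> n"
    by (rule complete[where a = "zero C (src C g) (unshift z)" and b = n]) (use ng in simp_all)
  show ?thesis by (rule that[of c]) (use c in simp_all)
qed

text \<open>\<open>e - 1\<close> factors through \<open>h\<close> and is annihilated by \<open>h\<close>, so its square is zero.\<close>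

lemma iso_endo:
  assumes d: "dist C f g h" and e [simp]: "e \<in> mor C" "src C e = tgt C g" "tgt C e = tgt C g"
    and eg: "e \<cdot> g = g" and he: "h \<cdot> e = h"
  shows "iso C e"
proof -
  note [simp] = distD[OF d]
  define z where "z = tgt C g"
  have z [simp]: "z \<in> ob C" "tgt C g = z" by (simp_all add: z_def)
  define n where "n = e \<oplus> neg C z"
  have n [simp]: "n \<in> mor C" "src C n = z" "tgt C n = z" by (simp_all add: n_def)
  have "n \<cdot> g = (e \<cdot> g) \<oplus> (neg C z \<cdot> g)" unfolding n_def by (rule cmp_add) simp_all
  also have "\<dots> = zero C (src C g) z" by (simp add: eg add_neg)
  finally have ng: "n \<cdot> g = zero C (src C g) (tgt C n)" by simp
  from d n(1) obtain m where m: "m \<in> mor C" "src C m = tgt C h" "tgt C m = tgt C n" "m \<cdot> h = n"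
    by (rule weak_cokernel) (use ng in simp_all)
  have "h \<cdot> n = (h \<cdot> e) \<oplus> (h \<cdot> neg C z)" unfolding n_def by (rule add_cmp) simp_all
  also have "\<dots> = zero C z (tgt C h)" by (simp add: he add_neg)
  finally have hn: "h \<cdot> n = zero C z (tgt C h)" .
  have "(m \<cdot> h) \<cdot> n = zero C z z" using m(1-3) by (simp add: hn)
  then have nn: "n \<cdot> n = zero C z z" using m(4) by simp
  have "n \<oplus> z = e \<oplus> (neg C z \<oplus> z)" unfolding n_def by (rule add_assoc) simp_all
  also have "neg C z \<oplus> z = zero C z z"
    using add_neg[of z] add_commute[of "neg C z" z] by simp
  finally have en: "e = n \<oplus> z" by simp
  \<comment> \<open>Since n n = 0, the inverse of e = 1 + n is 1 - n, where the identity 1 is the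
    object z.\<close>
  have "e \<cdot> (z \<oplus> neg C n) = e \<cdot> z \<oplus> e \<cdot> neg C n" by (rule add_cmp) simp_all
  also have "e \<cdot> neg C n = neg C (e \<cdot> n)" by (rule cmp_neg) simp_all
  also have "e \<cdot> n = n \<cdot> n \<oplus> z \<cdot> n" unfolding en by (rule cmp_add) simp_all
  also have "e \<cdot> z = n \<oplus> z" using en by simp
  also have "n \<oplus> z = z \<oplus> n" by (rule add_commute) simp_all
  finally have 1: "e \<cdot> (z \<oplus> neg C n) = z" by (simp add: nn add_assoc add_neg)
  have "(z \<oplus> neg C n) \<cdot> e = z \<cdot> e \<oplus> neg C n \<cdot> e" by (rule cmp_add) simp_all
  also have "neg C n \<cdot> e = neg C (n \<cdot> e)" by (rule neg_cmp) simp_all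
  also have "n \<cdot> e = n \<cdot> n \<oplus> n \<cdot> z" unfolding en by (rule add_cmp) simp_all
  also have "z \<cdot> e = n \<oplus> z" using en by simp
  also have "n \<oplus> z = z \<oplus> n" by (rule add_commute) simp_all
  finally have 2: "(z \<oplus> neg C n) \<cdot> e = z" by (simp add: nn add_assoc add_neg)
  show ?thesis by (rule isoI[of _ "z \<oplus> neg C n"]) (simp_all add: 1 2)
qed

text \<open>The five lemma without Hom sequences. TR3 completes the inverses of a and b to some c'
  in the other direction. This c' need not invert c, but c' c and c c' belong to endomorphisms of
  triangles that are the identity on the other two vertices, and such endomorphisms are
  invertible.\<close>

lemma iso_triangle_mor:
  assumes d: "dist C f g h" "dist C f' g' h'"
    and m: "triangle_mor C f g h f' g' h' a b c" and "iso C a" "iso C b"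
  shows "iso C c"
proof -
  note [simp] = distD[OF d(1)] distD[OF d(2)] triangle_morD(1-9)[OF m]
  have t: "triangle C f g h" "triangle C f' g' h'" using d dist_triangle by blast+
  obtain a' where a [simp]: "a' \<in> mor C" "src C a' = tgt C a" "tgt C a' = src C a"
    "a' \<cdot> a = src C a" "a \<cdot> a' = tgt C a" using \<open>iso C a\<close> by (rule isoE)
  obtain b' where b [simp]: "b' \<in> mor C" "src C b' = tgt C b" "tgt C b' = src C b"
    "b' \<cdot> b = src C b" "b \<cdot> b' = tgt C b" using \<open>iso C b\<close> by (rule isoE)
  have sq: "b' \<cdot> f' = f \<cdot> a'"
    by (rule square_inverse[OF triangle_morD(10)[OF m]]) simp_all
  from d(2) d(1) obtain c' where c' [simp]: "c' \<in> mor C" "src C c' = tgt C g'" "tgt C c' = tgt C g"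
    and c2: "c' \<cdot> g' = g \<cdot> b'" "shift C a' \<cdot> h' = h \<cdot> c'"
    by (rule complete[where a = a' and b = b']) (use sq in simp_all)
  have m': "triangle_mor C f' g' h' f g h a' b' c'"
    by (rule triangle_morI) (use c2 sq in simp_all)
  have 1: "triangle_mor C f g h f g h (a' \<cdot> a) (b' \<cdot> b) (c' \<cdot> c)"
    by (rule triangle_mor_cmp[OF t(1,2,1) m m'])
  have 2: "triangle_mor C f' g' h' f' g' h' (a \<cdot> a') (b \<cdot> b') (c \<cdot> c')"
    by (rule triangle_mor_cmp[OF t(2,1,2) m' m])
  have "iso C (c' \<cdot> c)"
    by (rule iso_endo[OF d(1)]) (use triangle_morD(11,12)[OF 1] in simp_all)
  moreover have "iso C (c \<cdot> c')"
    by (rule iso_endo[OF d(2)]) (use triangle_morD(11,12)[OF 2] in simp_all)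
  ultimately show ?thesis by (rule iso_of_iso_composites[rotated 4]) simp_all
qed

lemma triangle_iso_complete:
  assumes d: "dist C f g h" "dist C f' g' h'" and "iso C a" "iso C b"
    and "src C a = src C f" "tgt C a = src C f'" "src C b = tgt C f" "tgt C b = tgt C f'"
    and "b \<cdot> f = f' \<cdot> a"
  obtains c where "iso C c" "triangle_mor C f g h f' g' h' a b c"
proof -
  have "a \<in> hom C (src C f) (src C f')" "b \<in> hom C (tgt C f) (tgt C f')"
    using assms by (simp_all add: hom_def)
  then obtain c where "triangle_mor C f g h f' g' h' a b c"
    using complete_ax assms by blast
  then show ?thesis using that iso_triangle_mor assms by blast
qed

text \<open>Three rotations shift the triangle and negate all three morphisms. The isomorphism given
  by -1 on the middle vertex and the identity on the outer ones removes the signs of the first two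
  and leaves that of the third.\<close>

lemma dist_shift_iff:
  assumes t: "triangle C f g h"
  shows "dist C f g h \<longleftrightarrow> dist C (shift C f) (shift C g) (neg C (shift C h))"
proof -
  note [simp] = triangleD[OF t]
  have 1: "dist C f g h \<longleftrightarrow> dist C g h (neg C (shift C f))"
    using rotate_ax t by blast
  have "triangle C g h (neg C (shift C f))" by (rule triangleI) simp_all
  then have 2: "dist C g h (neg C (shift C f)) \<longleftrightarrow> dist C h (neg C (shift C f)) (neg C (shift C g))"
    using rotate_ax by blast
  have "triangle C h (neg C (shift C f)) (neg C (shift C g))" by (rule triangleI) simp_all
  then have 3: "dist C h (neg C (shift C f)) (neg C (shift C g)) \<longleftrightarrow>
      dist C (neg C (shift C f)) (neg C (shift C g)) (neg C (shift C h))"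
    using rotate_ax by blast
  let ?x = "shift C (src C f)" and ?y = "shift C (tgt C f)" and ?z = "shift C (tgt C g)"
  have t1: "triangle C (neg C (shift C f)) (neg C (shift C g)) (neg C (shift C h))"
    by (rule triangleI) simp_all
  have t2: "triangle C (shift C f) (shift C g) (neg C (shift C h))"
    by (rule triangleI) simp_all
  have i: "iso C ?x" "iso C (neg C ?y)" "iso C ?z"
    by (auto intro!: iso_ob iso_neg)
  have "triangle_mor C (neg C (shift C f)) (neg C (shift C g)) (neg C (shift C h))
      (shift C f) (shift C g) (neg C (shift C h)) ?x (neg C ?y) ?z"
    by (rule triangle_morI) simp_all
  then have ti: "triangle_iso C (neg C (shift C f)) (neg C (shift C g)) (neg C (shift C h))
      (shift C f) (shift C g) (neg C (shift C h))"
    unfolding triangle_iso_def using i by blast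
  have 4: "dist C (neg C (shift C f)) (neg C (shift C g)) (neg C (shift C h)) \<longleftrightarrow>
      dist C (shift C f) (shift C g) (neg C (shift C h))"
    using dist_iso[OF _ t2 ti] dist_iso[OF _ t1 triangle_iso_sym[OF t1 t2 ti]] by blast
  show ?thesis using 1 2 3 4 by blast
qed

end

section \<open>Morphisms with cone in a triangulated subcategory\<close>

locale verdier =
  fixes T D :: "'v::zermelo tri_cat"
  assumes subcategory: "triangulated_subcategory T D"
begin

sublocale pretri T
  using subcategory unfolding triangulated_subcategory_def triangulated_iff by blast

abbreviation compT (infixr "\<cdot>" 70) where "g \<cdot> f \<equiv> cmp T g f"
abbreviation sumT (infixl "\<oplus>" 65) where "f \<oplus> g \<equiv> add T f g"
abbreviation W where "W \<equiv> cone_in T D"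

lemma full_subcategory: "full_subcategory T D"
  using subcategory unfolding triangulated_subcategory_def by blast

text \<open>Sources in D are computed by the restricted relation \<open>Src D\<close>. A full
  subcategory contains the source of each of its morphisms, so the restriction still returns the
  source in T.\<close>

lemma ob_sub_iff: "x \<in> ob D \<longleftrightarrow> x \<in> ob T \<and> x \<in> mor D"
proof -
  have sub: "mor D \<subseteq> mor T" and full: "\<forall>f\<in>mor T. f \<in> mor D \<longleftrightarrow> src T f \<in> mor D \<and> tgt T f \<in> mor D"
    and Src: "Src D = mkset (elts (Src T) \<inter> pairs (mor D) (mor D))"
    using full_subcategory unfolding full_subcategory_def by blast+
  have elts: "elts (Src D) = elts (Src T) \<inter> pairs (mor D) (mor D)"
    unfolding Src by (rule elts_mkset, rule small_subset[OF small_elts[of "Src T"]]) blast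
  have "src D x = src T x" if x: "x \<in> mor D" for x
    unfolding src_def[of D]
  proof (rule app_eqI)
    have "x \<in> elts (Mor T)" "src T x \<in> mor D" using x sub full by (auto simp: mor_def)
    then show "opair x (src T x) \<in> elts (Src D)"
      using x is_function_app(1)[OF is_function_Src, of x] by (simp add: elts src_def)
    fix z assume "opair x z \<in> elts (Src D)"
    then have "opair x z \<in> elts (Src T)" by (simp add: elts)
    then show "z = src T x"
      unfolding is_function_elts[OF is_function_Src] by (auto simp: opair_iff src_def)
  qed
  then show ?thesis using sub unfolding ob_def by auto
qed

lemma sub_ob [simp]: "x \<in> ob D \<Longrightarrow> x \<in> ob T"
  by (simp add: ob_sub_iff)

lemma sub_shift: "x \<in> ob T \<Longrightarrow> shift T x \<in> ob D \<longleftrightarrow> x \<in> ob D"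
  using subcategory unfolding triangulated_subcategory_def by blast

lemma sub_unshift: "x \<in> ob T \<Longrightarrow> unshift x \<in> ob D \<longleftrightarrow> x \<in> ob D"
  using sub_shift[of "unshift x"] by simp

lemma sub_cone:
  assumes "dist T f g h" "src T f \<in> ob D" "tgt T f \<in> ob D"
  shows "tgt T g \<in> ob D"
proof -
  have "\<forall>f g h. dist T f g h \<and> src T f \<in> ob D \<and> tgt T f \<in> ob D \<longrightarrow> tgt T g \<in> ob D"
    using subcategory unfolding triangulated_subcategory_def by (elim conjE)
  then show ?thesis using assms by blast
qed

text \<open>Closure under cones is applied to the rotated triangle. Together with the backward
  rotation in the next lemma, two vertices in D always force the third.\<close>

lemma sub_fibre:
  assumes d: "dist T f g h" and "tgt T f \<in> ob D" "tgt T g \<in> ob D"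
  shows "src T f \<in> ob D"
proof -
  note [simp] = distD[OF d]
  have "tgt T h \<in> ob D" by (rule sub_cone[OF rotate[OF d]]) (use assms in simp_all)
  then show ?thesis by (simp add: sub_shift)
qed

lemma sub_middle:
  assumes d: "dist T f g h" and "src T f \<in> ob D" "tgt T g \<in> ob D"
  shows "tgt T f \<in> ob D"
proof -
  note [simp] = distD[OF d]
  show ?thesis by (rule sub_cone[OF rotate_back[OF d]]) (use assms in \<open>simp_all add: sub_unshift\<close>)
qed

lemma octahedron:
  assumes "src T g = tgt T f" "dist T f f1 f2" "dist T g g1 g2" "dist T (g \<cdot> f) k1 k2"
  obtains u v where "dist T u v (cmp T (shift T f1) g2)"
    "triangle_mor T f f1 f2 (g \<cdot> f) k1 k2 (src T f) g u"
    "triangle_mor T (g \<cdot> f) k1 k2 g g1 g2 f (tgt T g) v"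
proof -
  have "octahedral T"
    using subcategory unfolding triangulated_subcategory_def triangulated_iff by blast
  then show ?thesis using assms that unfolding octahedral_def by blast
qed

lemma W_I: "dist T s g h \<Longrightarrow> tgt T g \<in> ob D \<Longrightarrow> s \<in> W"
  using distD(1) unfolding cone_in_def by blast

lemma W_E:
  assumes "s \<in> W"
  obtains g h where "dist T s g h" "tgt T g \<in> ob D"
  using assms unfolding cone_in_def by blast

lemma W_mor [simp]: "s \<in> W \<Longrightarrow> s \<in> mor T"
  by (simp add: cone_in_def)

lemma W_ob [simp]:
  assumes "x \<in> ob T"
  shows "x \<in> W"
proof -
  obtain z where "z \<in> ob D" "zero_object T z"
    using subcategory unfolding triangulated_subcategory_def by blast
  then show ?thesis using W_I[OF dist_ident[OF assms]] assms by simp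
qed

text \<open>The octahedral axiom places the cone of r s in a triangle between the cone of s and the
  cone of r.\<close>

lemma W_cmp [simp]:
  assumes "s \<in> W" "r \<in> W" "src T r = tgt T s"
  shows "r \<cdot> s \<in> W"
proof -
  obtain s1 s2 where s: "dist T s s1 s2" "tgt T s1 \<in> ob D" using assms(1) by (rule W_E)
  obtain r1 r2 where r: "dist T r r1 r2" "tgt T r1 \<in> ob D" using assms(2) by (rule W_E)
  have "r \<cdot> s \<in> mor T" using assms by simp
  then obtain k1 k2 where k: "dist T (r \<cdot> s) k1 k2" using ex_dist by blast
  obtain u v where uv: "dist T u v (cmp T (shift T s1) r2)"
    and u: "triangle_mor T s s1 s2 (r \<cdot> s) k1 k2 (src T s) r u"
    and v: "triangle_mor T (r \<cdot> s) k1 k2 r r1 r2 s (tgt T r) v"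
    using octahedron[OF assms(3) s(1) r(1) k] .
  note [simp] = distD[OF s(1)] distD[OF r(1)] distD[OF k]
  have "tgt T u \<in> ob D"
    by (rule sub_middle[OF uv])
      (use triangle_morD(7-9)[OF u] triangle_morD(7-9)[OF v] s(2) r(2) in simp_all)
  then show ?thesis using triangle_morD(7-9)[OF u] W_I[OF k] by simp
qed

text \<open>The same triangle of cones, now read for its first vertex, the cone of s.\<close>

lemma W_cancel:
  assumes "r \<cdot> s \<in> W" "r \<in> W" "s \<in> mor T" "src T r = tgt T s"
  shows "s \<in> W"
proof -
  obtain s1 s2 where s: "dist T s s1 s2" using assms(3) ex_dist by blast
  obtain r1 r2 where r: "dist T r r1 r2" "tgt T r1 \<in> ob D" using assms(2) by (rule W_E)
  obtain k1 k2 where k: "dist T (r \<cdot> s) k1 k2" "tgt T k1 \<in> ob D" using assms(1) by (rule W_E)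
  obtain u v where uv: "dist T u v (cmp T (shift T s1) r2)"
    and u: "triangle_mor T s s1 s2 (r \<cdot> s) k1 k2 (src T s) r u"
    and v: "triangle_mor T (r \<cdot> s) k1 k2 r r1 r2 s (tgt T r) v"
    using octahedron[OF assms(4) s r(1) k(1)] .
  note [simp] = distD[OF s(1)] distD[OF r(1)] distD[OF k(1)]
  have "src T u \<in> ob D"
    by (rule sub_fibre[OF uv])
      (use triangle_morD(7-9)[OF u] triangle_morD(7-9)[OF v] k(2) r(2) in simp_all)
  then show ?thesis using triangle_morD(7-9)[OF u] W_I[OF s] by simp
qed

text \<open>The Ore condition. With g the map from the target of r to its cone, take for u a fibre
  of g f. The cone of u is that of r, and g f u = 0 lets f u factor through r.\<close>

lemma W_ore:
  assumes f: "f \<in> mor T" and r: "r \<in> W" "tgt T r = tgt T f"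
  obtains u w where "u \<in> W" "w \<in> mor T" "src T u = src T w" "tgt T u = src T f" "tgt T w = src T r"
    "f \<cdot> u = r \<cdot> w"
proof -
  obtain g h where d: "dist T r g h" and g: "tgt T g \<in> ob D" using r(1) by (rule W_E)
  note [simp] = distD[OF d]
  have gf: "g \<cdot> f \<in> mor T" using f r by simp
  then obtain u k where u: "dist T u (g \<cdot> f) k" by (rule ex_dist_right)
  have uD: "u \<in> mor T" "tgt T u = src T f" using distD[OF u] f r by simp_all
  have fu: "f \<cdot> u \<in> mor T" "tgt T (f \<cdot> u) = tgt T r" "src T (f \<cdot> u) = src T u"
    using f r uD by simp_all
  have "g \<cdot> (f \<cdot> u) = (g \<cdot> f) \<cdot> u" using f r uD by simp
  also have "\<dots> = zero T (src T u) (tgt T g)" using dist_cmp_zero[OF u] f r by simp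
  finally have gfu: "g \<cdot> (f \<cdot> u) = zero T (src T (f \<cdot> u)) (tgt T g)" using fu by simp
  obtain m where "m \<in> mor T" "src T m = src T (f \<cdot> u)" "tgt T m = src T r" "r \<cdot> m = f \<cdot> u"
    using d fu(1,2) gfu by (rule weak_kernel)
  moreover have "u \<in> W" by (rule W_I[OF u]) (use g f r in simp)
  ultimately show ?thesis using that[of u m] uD fu by simp
qed

text \<open>As s f = 0, f factors as j k through a fibre j of s, whose source is the cone of s
  shifted back and so lies in D. A fibre u of k then has its cone in D and is annihilated by k,
  hence by f.\<close>

lemma W_annihilate:
  assumes s: "s \<in> W" and f: "f \<in> mor T" "src T s = tgt T f"
    and sf: "s \<cdot> f = zero T (src T f) (tgt T s)"
  obtains u where "u \<in> W" "tgt T u = src T f" "f \<cdot> u = zero T (src T u) (tgt T f)"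
proof -
  obtain g h where d: "dist T s g h" and g: "tgt T g \<in> ob D" using s by (rule W_E)
  note [simp] = distD[OF d]
  define j where "j = unshift (neg T h)"
  have j: "dist T j s g" unfolding j_def using d by (rule rotate_back)
  have js [simp]: "j \<in> mor T" "src T j = unshift (tgt T g)" "tgt T j = src T s"
    by (simp_all add: j_def)
  obtain k where k: "k \<in> mor T" "src T k = src T f" "tgt T k = src T j" "j \<cdot> k = f"
    by (rule weak_kernel[OF j, of f]) (use f sf in simp_all)
  obtain u h' where u: "dist T u k h'" using k(1) by (rule ex_dist_right)
  have uD: "u \<in> mor T" "src T k = tgt T u" using distD[OF u] by simp_all
  have "u \<in> W" by (rule W_I[OF u]) (use k g js in \<open>simp add: sub_unshift\<close>)
  moreover have "(j \<cdot> k) \<cdot> u = j \<cdot> (k \<cdot> u)" by (rule cmp_assoc) (use k uD in simp_all)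
  then have "f \<cdot> u = zero T (src T u) (tgt T f)"
    using dist_cmp_zero[OF u] k uD f by simp
  ultimately show ?thesis using that uD k(2) by simp
qed

text \<open>Additivity reduces this to annihilating f - g.\<close>

lemma W_equalize:
  assumes s: "s \<in> W" and f: "f \<in> mor T" "src T s = tgt T f"
    and g: "g \<in> mor T" "src T g = src T f" "tgt T g = tgt T f" and eq: "s \<cdot> f = s \<cdot> g"
  obtains u where "u \<in> W" "tgt T u = src T f" "f \<cdot> u = g \<cdot> u"
proof -
  have "s \<cdot> (f \<oplus> neg T g) = s \<cdot> f \<oplus> s \<cdot> neg T g" by (rule add_cmp) (use s f g in simp_all)
  also have "\<dots> = zero T (src T f) (tgt T s)" using s f g eq by (simp add: add_neg)
  finally have s0: "s \<cdot> (f \<oplus> neg T g) = zero T (src T f) (tgt T s)" .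
  obtain u where u: "u \<in> W" "tgt T u = src T f"
    "(f \<oplus> neg T g) \<cdot> u = zero T (src T u) (tgt T f)"
    by (rule W_annihilate[OF s, of "f \<oplus> neg T g"]) (use f g s0 in simp_all)
  have "(f \<oplus> neg T g) \<cdot> u = f \<cdot> u \<oplus> neg T g \<cdot> u" by (rule cmp_add) (use f g u in simp_all)
  also have "neg T g \<cdot> u = neg T (g \<cdot> u)" by (rule neg_cmp) (use f g u in simp_all)
  finally have "f \<cdot> u = g \<cdot> u" using u f g by - (rule eq_of_add_neg, simp_all)
  then show ?thesis using that u by blast
qed

lemma W_shift:
  assumes s: "s \<in> mor T"
  shows "shift T s \<in> W \<longleftrightarrow> s \<in> W"
proof
  assume "s \<in> W"
  then obtain g h where d: "dist T s g h" and g: "tgt T g \<in> ob D" by (rule W_E)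
  note [simp] = distD[OF d]
  have "dist T (shift T s) (shift T g) (neg T (shift T h))"
    using d dist_shift_iff dist_triangle by blast
  then show "shift T s \<in> W" by (rule W_I) (use g in \<open>simp add: sub_shift\<close>)
next
  assume "shift T s \<in> W"
  then obtain g h where d: "dist T (shift T s) g h" and g: "tgt T g \<in> ob D" by (rule W_E)
  note [simp] = distD[OF d] s
  have sg: "src T g = shift T (tgt T s)" "tgt T h = shift T (shift T (src T s))"
    using distD(4,6)[OF d] s by simp_all
  \<comment> \<open>The sign is chosen so that shifting this triangle returns h as its last
    morphism.\<close>
  have t: "triangle T s (unshift g) (neg T (unshift h))"
    by (rule triangleI) (simp_all add: sg)
  have "dist T s (unshift g) (neg T (unshift h))" using dist_shift_iff[OF t] d by simp
  then show "s \<in> W" by (rule W_I) (use g in \<open>simp add: sub_unshift\<close>)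
qed

lemma W_shift' [simp]: "s \<in> W \<Longrightarrow> shift T s \<in> W"
  using W_shift by simp

text \<open>Factor the commutative square through its diagonal and apply the octahedral axiom on
  both sides: the two connecting morphisms between cones have cones isomorphic, up to shift,
  to those of \<open>s\<close> and \<open>r\<close>.\<close>

lemma W_complete:
  assumes p: "dist T p p1 p2" and f: "dist T f f1 f2" and s: "s \<in> W" and r: "r \<in> W"
    and ty: "src T s = src T p" "tgt T s = src T f" "src T r = tgt T p" "tgt T r = tgt T f"
    and sq: "r \<cdot> p = f \<cdot> s"
  obtains c where "c \<in> W" "triangle_mor T p p1 p2 f f1 f2 s r c"
proof -
  note [simp] = distD[OF p] distD[OF f] ty
  obtain s1 s2 where s': "dist T s s1 s2" "tgt T s1 \<in> ob D" using s by (rule W_E)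
  obtain r1 r2 where r': "dist T r r1 r2" "tgt T r1 \<in> ob D" using r by (rule W_E)
  note [simp] = distD[OF s'(1)] distD[OF r'(1)]
  have "r \<cdot> p \<in> mor T" by simp
  then obtain k1 k2 where k: "dist T (r \<cdot> p) k1 k2" using ex_dist by blast
  have k': "dist T (f \<cdot> s) k1 k2" using k sq by simp
  have tk: "triangle T (r \<cdot> p) k1 k2" using k dist_triangle by blast
  obtain u u' where u: "dist T u u' (cmp T (shift T p1) r2)"
    "triangle_mor T p p1 p2 (r \<cdot> p) k1 k2 (src T p) r u"
    "triangle_mor T (r \<cdot> p) k1 k2 r r1 r2 p (tgt T r) u'"
    using octahedron[OF ty(3) p r'(1) k] .
  have sf: "src T f = tgt T s" by simp
  obtain v' v where v: "dist T v' v (cmp T (shift T s1) f2)"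
    "triangle_mor T s s1 s2 (f \<cdot> s) k1 k2 (src T s) f v'"
    "triangle_mor T (f \<cdot> s) k1 k2 f f1 f2 s (tgt T f) v"
    using octahedron[OF sf s'(1) f k'] .
  note [simp] = triangle_morD(7-9)[OF u(2)] triangle_morD(7-9)[OF u(3)]
    triangle_morD(7-9)[OF v(2)] triangle_morD(7-9)[OF v(3)]
  have k1: "src T k2 = tgt T k1" using distD[OF k] by simp
  have "u \<in> W" by (rule W_I[OF u(1)]) (use r' in simp)
  have "cmp T (shift T s1) f2 \<in> mor T" using distD[OF v(1)] by simp
  \<comment> \<open>After rotation the third vertex of the triangle starting with v is the shifted
    cone of s.\<close>
  have "v \<in> W" by (rule W_I[OF rotate[OF v(1)]]) (use s'(2) in \<open>simp add: sub_shift\<close>)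
  have "triangle_mor T p p1 p2 f f1 f2 (s \<cdot> src T p) (tgt T f \<cdot> r) (v \<cdot> u)"
    by (rule triangle_mor_cmp[OF _ tk _ u(2) v(3)[folded sq]])
      (use p f dist_triangle in blast)+
  moreover have "s \<cdot> src T p = s" "tgt T f \<cdot> r = r" by simp_all
  ultimately have "triangle_mor T p p1 p2 f f1 f2 s r (v \<cdot> u)" by simp
  moreover have "v \<cdot> u \<in> W" using \<open>u \<in> W\<close> \<open>v \<in> W\<close> k1 by simp
  ultimately show ?thesis using that by blast
qed

end

section \<open>The Verdier quotient\<close>

context verdier
begin

abbreviation K where "K s f \<equiv> roof_class T D s f"

lemma roof_iff: "roof T D s f \<longleftrightarrow> s \<in> W \<and> f \<in> mor T \<and> src T f = src T s"
  by (simp add: roof_def)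

text \<open>The definition asks only s u to lie in W; since W allows cancellation, both legs u and v
  then lie in it. In this form symmetry is immediate and the Ore condition can be applied to the
  legs.\<close>

lemma roof_equiv_iff:
  "roof_equiv T D s f s' f' \<longleftrightarrow> roof T D s f \<and> roof T D s' f' \<and>
     (\<exists>u\<in>W. \<exists>v\<in>W. src T u = src T v \<and> tgt T u = src T s \<and> tgt T v = src T s' \<and>
        s \<cdot> u = s' \<cdot> v \<and> f \<cdot> u = f' \<cdot> v)"
proof
  assume e: "roof_equiv T D s f s' f'"
  then obtain w u v where uv: "w \<in> ob T" "u \<in> hom T w (src T s)" "v \<in> hom T w (src T s')"
    "s \<cdot> u \<in> W" "s \<cdot> u = s' \<cdot> v" "f \<cdot> u = f' \<cdot> v"
    unfolding roof_equiv_def by blast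
  have r: "roof T D s f" "roof T D s' f'" using e unfolding roof_equiv_def by blast+
  have "u \<in> W" by (rule W_cancel[OF uv(4)]) (use r uv(2) in \<open>simp_all add: roof_iff hom_iff\<close>)
  moreover have "v \<in> W"
    by (rule W_cancel[of s']) (use r uv(3-5) in \<open>simp_all add: roof_iff hom_iff\<close>)
  moreover have "src T u = src T v" "tgt T u = src T s" "tgt T v = src T s'"
    using uv(2,3) by (simp_all add: hom_iff)
  ultimately show "roof T D s f \<and> roof T D s' f' \<and>
     (\<exists>u\<in>W. \<exists>v\<in>W. src T u = src T v \<and> tgt T u = src T s \<and> tgt T v = src T s' \<and>
        s \<cdot> u = s' \<cdot> v \<and> f \<cdot> u = f' \<cdot> v)"
    using r uv(5,6) by blast
next
  assume "roof T D s f \<and> roof T D s' f' \<and>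
     (\<exists>u\<in>W. \<exists>v\<in>W. src T u = src T v \<and> tgt T u = src T s \<and> tgt T v = src T s' \<and>
        s \<cdot> u = s' \<cdot> v \<and> f \<cdot> u = f' \<cdot> v)"
  then obtain u v where r: "roof T D s f" "roof T D s' f'" and uv: "u \<in> W" "v \<in> W"
    "src T u = src T v" "tgt T u = src T s" "tgt T v = src T s'" "s \<cdot> u = s' \<cdot> v" "f \<cdot> u = f' \<cdot> v"
    by blast
  have ty: "s \<in> W" "f \<in> mor T" "src T f = src T s" "s' \<in> W" "f' \<in> mor T" "src T f' = src T s'"
    using r by (simp_all add: roof_iff)
  have "tgt T s = tgt T (s \<cdot> u)" "tgt T f = tgt T (f \<cdot> u)" using ty uv(1-5) by simp_all
  then have t: "tgt T s = tgt T s'" "tgt T f = tgt T f'" unfolding uv(6,7) using ty uv(1-5) by simp_all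
  have "s \<cdot> u \<in> W" "src T u \<in> ob T" "u \<in> hom T (src T u) (src T s)" "v \<in> hom T (src T u) (src T s')"
    using ty uv(1-5) by (simp_all add: hom_iff)
  then show "roof_equiv T D s f s' f'"
    unfolding roof_equiv_def using r t uv(6,7) by blast
qed

lemma roof_equivI:
  assumes "roof T D s f" "roof T D s' f'" "u \<in> W" "v \<in> W" "src T u = src T v"
    "tgt T u = src T s" "tgt T v = src T s'" "s \<cdot> u = s' \<cdot> v" "f \<cdot> u = f' \<cdot> v"
  shows "roof_equiv T D s f s' f'"
  unfolding roof_equiv_iff using assms by blast

lemma roof_equiv_refl: "roof T D s f \<Longrightarrow> roof_equiv T D s f s f"
  by (rule roof_equivI[of _ _ _ _ "src T s" "src T s"]) (simp_all add: roof_iff)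

lemma roof_equiv_sym: "roof_equiv T D s f s' f' \<Longrightarrow> roof_equiv T D s' f' s f"
  unfolding roof_equiv_iff by metis

lemma roof_equiv_trans:
  assumes "roof_equiv T D s f s' f'" "roof_equiv T D s' f' s'' f''"
  shows "roof_equiv T D s f s'' f''"
proof -
  have r: "roof T D s f" "roof T D s' f'" "roof T D s'' f''"
    using assms unfolding roof_equiv_iff by blast+
  obtain u v where uv: "u \<in> W" "v \<in> W" "src T u = src T v" "tgt T u = src T s" "tgt T v = src T s'"
    "s \<cdot> u = s' \<cdot> v" "f \<cdot> u = f' \<cdot> v" using assms(1) unfolding roof_equiv_iff by blast
  obtain x y where xy: "x \<in> W" "y \<in> W" "src T x = src T y" "tgt T x = src T s'" "tgt T y = src T s''"
    "s' \<cdot> x = s'' \<cdot> y" "f' \<cdot> x = f'' \<cdot> y" using assms(2) unfolding roof_equiv_iff by blast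
  note [simp] = r[unfolded roof_iff] uv(1-5) xy(1-5)
  \<comment> \<open>Both v and x end in the source of the middle roof, so the Ore condition provides
    a common refinement over it.\<close>
  obtain a b where ab [simp]: "a \<in> W" "b \<in> mor T" "src T a = src T b" "tgt T a = src T v"
    "tgt T b = src T x" and vx: "v \<cdot> a = x \<cdot> b"
    by (rule W_ore[of v x]) simp_all
  have "b \<in> W" by (rule W_cancel[of x]) (simp_all flip: vx)
  have *: "g \<cdot> (u \<cdot> a) = g'' \<cdot> (y \<cdot> b)"
    if [simp]: "g \<in> mor T" "g' \<in> mor T" "g'' \<in> mor T" "src T g = src T s" "src T g' = src T s'"
      "src T g'' = src T s''" and e: "g \<cdot> u = g' \<cdot> v" "g' \<cdot> x = g'' \<cdot> y" for g g' g''
  proof -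
    have "g \<cdot> (u \<cdot> a) = g' \<cdot> (v \<cdot> a)" by (rule cmp_eq_cmp[OF e(1)]) simp_all
    also have "\<dots> = g' \<cdot> (x \<cdot> b)" by (simp add: vx)
    also have "\<dots> = g'' \<cdot> (y \<cdot> b)" by (rule cmp_eq_cmp[OF e(2)]) simp_all
    finally show ?thesis .
  qed
  have "s \<cdot> (u \<cdot> a) = s'' \<cdot> (y \<cdot> b)" by (rule *[OF _ _ _ _ _ _ uv(6) xy(6)]) simp_all
  moreover have "f \<cdot> (u \<cdot> a) = f'' \<cdot> (y \<cdot> b)" by (rule *[OF _ _ _ _ _ _ uv(7) xy(7)]) simp_all
  ultimately show ?thesis
    using \<open>b \<in> W\<close> by - (rule roof_equivI[OF r(1,3), of "u \<cdot> a" "y \<cdot> b"], simp_all)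
qed

lemma elts_K: "elts (K s f) = {opair s' f' | s' f'. roof_equiv T D s f s' f'}"
  and atom_K: "\<not> atom (K s f)"
proof -
  have "{opair s' f' | s' f'. roof_equiv T D s f s' f'} \<subseteq> pairs (elts (Mor T)) (elts (Mor T))"
    unfolding roof_equiv_def roof_iff by (auto simp flip: mor_def)
  then have "small {opair s' f' | s' f'. roof_equiv T D s f s' f'}"
    using small_subset[OF small_pairs[OF small_elts small_elts]] by blast
  from mkset_works[OF this] show "elts (K s f) = {opair s' f' | s' f'. roof_equiv T D s f s' f'}"
    "\<not> atom (K s f)"
    unfolding roof_class_def by blast+
qed

lemma K_eq_iff:
  assumes "roof T D s f" "roof T D s' f'"
  shows "K s f = K s' f' \<longleftrightarrow> roof_equiv T D s f s' f'"
proof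
  assume "K s f = K s' f'"
  moreover have "opair s' f' \<in> elts (K s' f')"
    unfolding elts_K using roof_equiv_refl[OF assms(2)] by blast
  ultimately have "opair s' f' \<in> elts (K s f)" by simp
  then show "roof_equiv T D s f s' f'" unfolding elts_K by (auto simp: opair_iff)
next
  assume "roof_equiv T D s f s' f'"
  then have "roof_equiv T D s f a b \<longleftrightarrow> roof_equiv T D s' f' a b" for a b
    using roof_equiv_sym roof_equiv_trans by blast
  then show "K s f = K s' f'" unfolding roof_class_def by simp
qed

lemma K_eqI:
  assumes "s \<in> W" "s' \<in> W" "f \<in> mor T" "f' \<in> mor T" "src T f = src T s" "src T f' = src T s'"
    "u \<in> W" "v \<in> W" "src T u = src T v" "tgt T u = src T s" "tgt T v = src T s'"
    "s \<cdot> u = s' \<cdot> v" "f \<cdot> u = f' \<cdot> v"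
  shows "K s f = K s' f'"
proof -
  have "roof_equiv T D s f s' f'" unfolding roof_equiv_iff roof_iff using assms by blast
  then show ?thesis using K_eq_iff unfolding roof_equiv_iff by blast
qed

lemma K_eqE:
  assumes "K s f = K s' f'"
    and "s \<in> W" "s' \<in> W" "f \<in> mor T" "f' \<in> mor T" "src T f = src T s" "src T f' = src T s'"
  obtains u v where "u \<in> W" "v \<in> W" "src T u = src T v" "tgt T u = src T s" "tgt T v = src T s'"
    "s \<cdot> u = s' \<cdot> v" "f \<cdot> u = f' \<cdot> v" "tgt T s' = tgt T s" "tgt T f' = tgt T f"
proof -
  have e: "roof_equiv T D s f s' f'" using K_eq_iff assms by (simp add: roof_iff)
  then have t: "tgt T s = tgt T s' \<and> tgt T f = tgt T f'" unfolding roof_equiv_def by blast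
  from e obtain u v where "u \<in> W" "v \<in> W" "src T u = src T v" "tgt T u = src T s"
    "tgt T v = src T s'" "s \<cdot> u = s' \<cdot> v" "f \<cdot> u = f' \<cdot> v"
    unfolding roof_equiv_iff by blast
  then show ?thesis using that t by simp
qed

lemma K_refine:
  assumes [simp]: "s \<in> W" "f \<in> mor T" "src T f = src T s" "u \<in> W" "tgt T u = src T s"
  shows "K (s \<cdot> u) (f \<cdot> u) = K s f"
  by (rule K_eqI[of _ _ _ _ "src T u" u]) simp_all

text \<open>The quotient functor as a HOL function on morphisms. The denominator is the identity of
  the source, which is the source itself.\<close>

definition F :: "'v \<Rightarrow> 'v" where "F f = K (src T f) f"

lemma F_ob: "x \<in> ob T \<Longrightarrow> F x = K x x"
  by (simp add: F_def)

text \<open>Equivalent roofs have the same ends by definition, so the quotient keeps the objects of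
  T apart. Whether fractions are composable or parallel can therefore be decided in T.\<close>

lemma F_inj: "F x = F y \<Longrightarrow> x \<in> ob T \<Longrightarrow> y \<in> ob T \<Longrightarrow> x = y"
  unfolding F_def by (erule K_eqE) simp_all

abbreviation Q where "Q \<equiv> verdier_quotient T D"

lemmas Q_defs = verdier_quotient_def quotient_shift_cat_def shift_cat.extend_def shift_cat.defs
  tri_cat.defs Let_def

lemma mor_Q: "mor Q = {K s f | s f. s \<in> W \<and> f \<in> mor T \<and> src T f = src T s}"
  and atom_Mor_Q: "\<not> atom (Mor Q)"
proof -
  let ?A = "{K s f | s f. s \<in> W \<and> f \<in> mor T \<and> src T f = src T s}"
  have "?A \<subseteq> {y. \<not> atom y \<and> elts y \<subseteq> pairs (elts (Mor T)) (elts (Mor T))}"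
    using atom_K by (auto simp: elts_K roof_equiv_def roof_iff simp flip: mor_def)
  then have "small ?A"
    by (rule small_subset[OF small_power[OF small_pairs[OF small_elts small_elts]]])
  from mkset_works[OF this] show "mor Q = ?A" "\<not> atom (Mor Q)"
    by (simp_all add: mor_def Q_defs roof_iff)
qed

lemma K_mor [simp]: "s \<in> W \<Longrightarrow> f \<in> mor T \<Longrightarrow> src T f = src T s \<Longrightarrow> K s f \<in> mor Q"
  unfolding mor_Q by blast

lemma mor_QE:
  assumes "a \<in> mor Q"
  obtains s f where "s \<in> W" "f \<in> mor T" "src T f = src T s" "a = K s f"
  using assms unfolding mor_Q by blast

lemma K_elts_Mor [simp]: "s \<in> W \<Longrightarrow> f \<in> mor T \<Longrightarrow> src T f = src T s \<Longrightarrow> K s f \<in> elts (Mor Q)"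
  using K_mor unfolding mor_def[of Q] .

lemma sub_pairs_Q:
  assumes "A \<subseteq> pairs (elts (Mor Q)) (elts (Mor Q))"
  shows "elts (mkset A) = A" "\<not> atom (mkset A)"
  using mkset_works[OF small_subset[OF small_pairs[OF small_elts small_elts] assms]] by blast+

lemma sub_triples_Q:
  assumes "A \<subseteq> triples (elts (Mor Q))"
  shows "elts (mkset A) = A" "\<not> atom (mkset A)"
  using mkset_works[OF small_subset[OF small_triples[OF small_elts] assms]] by blast+

text \<open>An assignment on roofs that respects equivalence descends to a function on classes,
  represented by its graph. Source, target and shift of the quotient all arise in this way.\<close>

lemma graph_Q:
  assumes X: "X = mkset {opair (K s f) (\<phi> s f) | s f. s \<in> W \<and> f \<in> mor T \<and> src T f = src T s}"
    and mor: "\<And>s f. s \<in> W \<Longrightarrow> f \<in> mor T \<Longrightarrow> src T f = src T s \<Longrightarrow> \<phi> s f \<in> elts (Mor Q)"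
    and cong: "\<And>s f s' f'. K s f = K s' f' \<Longrightarrow> s \<in> W \<Longrightarrow> s' \<in> W \<Longrightarrow> f \<in> mor T \<Longrightarrow> f' \<in> mor T \<Longrightarrow>
      src T f = src T s \<Longrightarrow> src T f' = src T s' \<Longrightarrow> \<phi> s' f' = \<phi> s f"
  shows "elts X = {opair (K s f) (\<phi> s f) | s f. s \<in> W \<and> f \<in> mor T \<and> src T f = src T s}"
    and "is_function X (Mor Q) (Mor Q)"
    and "\<And>s f. s \<in> W \<Longrightarrow> f \<in> mor T \<Longrightarrow> src T f = src T s \<Longrightarrow> app X (K s f) = \<phi> s f"
proof -
  let ?A = "{opair (K s f) (\<phi> s f) | s f. s \<in> W \<and> f \<in> mor T \<and> src T f = src T s}"
  have sub: "?A \<subseteq> pairs (elts (Mor Q)) (elts (Mor Q))" using mor by auto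
  have A: "elts X = ?A" "\<not> atom X" using sub_pairs_Q[OF sub] unfolding X by simp_all
  show "elts X = ?A" by (rule A)
  have u: "z = \<phi> s f"
    if "opair (K s f) z \<in> elts X" and *: "s \<in> W" "f \<in> mor T" "src T f = src T s" for s f z
  proof -
    from that(1) obtain s' f' where "K s f = K s' f'" "z = \<phi> s' f'"
      "s' \<in> W" "f' \<in> mor T" "src T f' = src T s'" unfolding A by (auto simp: opair_iff)
    then show ?thesis using cong * by blast
  qed
  have i: "opair (K s f) (\<phi> s f) \<in> elts X"
    if "s \<in> W" "f \<in> mor T" "src T f = src T s" for s f using that unfolding A by blast
  show "app X (K s f) = \<phi> s f" if "s \<in> W" "f \<in> mor T" "src T f = src T s" for s f
    by (rule app_eqI[OF i[OF that] u[OF _ that]])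
  show "is_function X (Mor Q) (Mor Q)"
    unfolding is_function_def
  proof (intro conjI ballI)
    show "elts X \<subseteq> pairs (elts (Mor Q)) (elts (Mor Q))" unfolding A by (rule sub)
    fix x assume "x \<in> elts (Mor Q)"
    then obtain s f where "s \<in> W" "f \<in> mor T" "src T f = src T s" "x = K s f"
      unfolding mor_def[symmetric] by (rule mor_QE)
    then show "\<exists>!y. opair x y \<in> elts X" using i u by blast
  qed (rule A)
qed

lemma elts_Src_Q: "elts (Src Q) = {opair (K s f) (F (tgt T s)) | s f. s \<in> W \<and> f \<in> mor T \<and> src T f = src T s}"
  and function_Src_Q: "is_function (Src Q) (Mor Q) (Mor Q)"
  and src_Q [simp]: "s \<in> W \<Longrightarrow> f \<in> mor T \<Longrightarrow> src T f = src T s \<Longrightarrow> src Q (K s f) = F (tgt T s)"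
proof -
  have X: "Src Q = mkset {opair (K s f) (F (tgt T s)) | s f. s \<in> W \<and> f \<in> mor T \<and> src T f = src T s}"
    unfolding Q_defs by (simp add: roof_iff, rule arg_cong[of _ _ mkset]) (force simp: F_ob)
  have mor: "F (tgt T s) \<in> elts (Mor Q)" if "s \<in> W" for s using that by (simp add: F_ob)
  have cong: "F (tgt T s') = F (tgt T s)" if "K s f = K s' f'" "s \<in> W" "s' \<in> W" "f \<in> mor T"
    "f' \<in> mor T" "src T f = src T s" "src T f' = src T s'" for s f s' f'
    using that by (rule K_eqE) simp
  note g = graph_Q[OF X mor cong]
  show "elts (Src Q) = {opair (K s f) (F (tgt T s)) | s f. s \<in> W \<and> f \<in> mor T \<and> src T f = src T s}"
    "is_function (Src Q) (Mor Q) (Mor Q)" by (rule g(1,2); assumption)+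
  show "s \<in> W \<Longrightarrow> f \<in> mor T \<Longrightarrow> src T f = src T s \<Longrightarrow> src Q (K s f) = F (tgt T s)"
    unfolding src_def[of Q] by (rule g(3))
qed

lemma elts_Tgt_Q: "elts (Tgt Q) = {opair (K s f) (F (tgt T f)) | s f. s \<in> W \<and> f \<in> mor T \<and> src T f = src T s}"
  and function_Tgt_Q: "is_function (Tgt Q) (Mor Q) (Mor Q)"
  and tgt_Q [simp]: "s \<in> W \<Longrightarrow> f \<in> mor T \<Longrightarrow> src T f = src T s \<Longrightarrow> tgt Q (K s f) = F (tgt T f)"
proof -
  have X: "Tgt Q = mkset {opair (K s f) (F (tgt T f)) | s f. s \<in> W \<and> f \<in> mor T \<and> src T f = src T s}"
    unfolding Q_defs by (simp add: roof_iff, rule arg_cong[of _ _ mkset]) (force simp: F_ob)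
  have mor: "F (tgt T f) \<in> elts (Mor Q)" if "f \<in> mor T" for f using that by (simp add: F_ob)
  have cong: "F (tgt T f') = F (tgt T f)" if "K s f = K s' f'" "s \<in> W" "s' \<in> W" "f \<in> mor T"
    "f' \<in> mor T" "src T f = src T s" "src T f' = src T s'" for s f s' f'
    using that by (rule K_eqE) simp
  note g = graph_Q[OF X mor cong]
  show "elts (Tgt Q) = {opair (K s f) (F (tgt T f)) | s f. s \<in> W \<and> f \<in> mor T \<and> src T f = src T s}"
    "is_function (Tgt Q) (Mor Q) (Mor Q)" by (rule g(1,2); assumption)+
  show "s \<in> W \<Longrightarrow> f \<in> mor T \<Longrightarrow> src T f = src T s \<Longrightarrow> tgt Q (K s f) = F (tgt T f)"
    unfolding tgt_def[of Q] by (rule g(3))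
qed

end

section \<open>Composition of fractions and the category axioms\<close>

context verdier
begin

abbreviation compQ (infixr "\<star>" 70) where "b \<star> a \<equiv> cmp Q b a"
abbreviation sumQ (infixl "\<uplus>" 65) where "a \<uplus> b \<equiv> add Q a b"

text \<open>The roofs \<open>(s, f)\<close> and \<open>(r, g)\<close> are composable, and \<open>(u, w)\<close> completes
  \<open>(f, r)\<close> to a square computing the composite.\<close>

definition fills :: "'v \<Rightarrow> 'v \<Rightarrow> 'v \<Rightarrow> 'v \<Rightarrow> 'v \<Rightarrow> 'v \<Rightarrow> bool" where
  "fills s f r g u w \<longleftrightarrow> s \<in> W \<and> f \<in> mor T \<and> src T f = src T s \<and>
     r \<in> W \<and> g \<in> mor T \<and> src T g = src T r \<and> tgt T r = tgt T f \<and>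
     u \<in> W \<and> w \<in> mor T \<and> src T u = src T w \<and> tgt T u = src T s \<and> tgt T w = src T r \<and>
     f \<cdot> u = r \<cdot> w"

lemma fillsD:
  assumes "fills s f r g u w"
  shows "s \<in> W" "f \<in> mor T" "src T f = src T s" "r \<in> W" "g \<in> mor T" "src T g = src T r"
    "tgt T r = tgt T f" "u \<in> W" "w \<in> mor T" "src T u = src T w" "tgt T u = src T s"
    "tgt T w = src T r" "f \<cdot> u = r \<cdot> w"
  using assms unfolding fills_def by blast+

lemma fillsI:
  "s \<in> W \<Longrightarrow> f \<in> mor T \<Longrightarrow> src T f = src T s \<Longrightarrow> r \<in> W \<Longrightarrow> g \<in> mor T \<Longrightarrow> src T g = src T r \<Longrightarrow>
    tgt T r = tgt T f \<Longrightarrow> u \<in> W \<Longrightarrow> w \<in> mor T \<Longrightarrow> src T u = src T w \<Longrightarrow> tgt T u = src T s \<Longrightarrow>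
    tgt T w = src T r \<Longrightarrow> f \<cdot> u = r \<cdot> w \<Longrightarrow> fills s f r g u w"
  unfolding fills_def by blast

lemma ex_fills:
  assumes "s \<in> W" "f \<in> mor T" "src T f = src T s" "r \<in> W" "g \<in> mor T" "src T g = src T r"
    "tgt T r = tgt T f"
  obtains u w where "fills s f r g u w"
proof -
  obtain u w where "u \<in> W" "w \<in> mor T" "src T u = src T w" "tgt T u = src T f" "tgt T w = src T r"
    "f \<cdot> u = r \<cdot> w" using assms(2,4,7) by (rule W_ore)
  then show ?thesis using assms by - (rule that, rule fillsI, simp_all)
qed

text \<open>The Ore condition on u and u' makes the denominators agree. The numerators then agree
  only after composition with r, and a further morphism of W equalises them.\<close>

lemma fills_unique:
  assumes c: "fills s f r g u w" and c': "fills s f r g u' w'"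
  shows "K (s \<cdot> u) (g \<cdot> w) = K (s \<cdot> u') (g \<cdot> w')"
proof -
  note [simp] = fillsD(1-12)[OF c] fillsD(8-12)[OF c']
  obtain a b where a [simp]: "a \<in> W" "b \<in> mor T" "src T a = src T b" "tgt T a = src T w"
    "tgt T b = src T w'" and uab: "u \<cdot> a = u' \<cdot> b" by (rule W_ore[of u u']) simp_all
  have "u \<cdot> a \<in> W" by simp
  then have [simp]: "b \<in> W" unfolding uab by (rule W_cancel) simp_all
  have "r \<cdot> (w \<cdot> a) = f \<cdot> (u \<cdot> a)" by (rule cmp_eq_cmp[OF fillsD(13)[OF c, symmetric]]) simp_all
  also have "\<dots> = f \<cdot> (u' \<cdot> b)" by (simp add: uab)
  also have "\<dots> = r \<cdot> (w' \<cdot> b)" by (rule cmp_eq_cmp[OF fillsD(13)[OF c']]) simp_all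
  finally have rw: "r \<cdot> (w \<cdot> a) = r \<cdot> (w' \<cdot> b)" .
  obtain d where d [simp]: "d \<in> W" "tgt T d = src T b" and wd: "(w \<cdot> a) \<cdot> d = (w' \<cdot> b) \<cdot> d"
    by (rule W_equalize[OF _ _ _ _ _ _ rw]) simp_all
  show ?thesis
  proof (rule K_eqI[where u = "a \<cdot> d" and v = "b \<cdot> d"])
    have "u \<cdot> (a \<cdot> d) = u' \<cdot> (b \<cdot> d)" by (rule cmp_eq_cmp[OF uab]) simp_all
    then show "(s \<cdot> u) \<cdot> (a \<cdot> d) = (s \<cdot> u') \<cdot> (b \<cdot> d)" by simp
    have "w \<cdot> (a \<cdot> d) = w' \<cdot> (b \<cdot> d)" using wd by simp
    then show "(g \<cdot> w) \<cdot> (a \<cdot> d) = (g \<cdot> w') \<cdot> (b \<cdot> d)" by simp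
  qed simp_all
qed

text \<open>The representatives are expanded before the square is filled. One pair (x, y) completes
  f a against r c, and since f a = f' b and r c = r' d it completes the primed roofs as well;
  uniqueness of the composite is then used on either side.\<close>

lemma fills_cong:
  assumes c: "fills s f r g u w" and c': "fills s' f' r' g' u' w'"
    and "K s f = K s' f'" "K r g = K r' g'"
  shows "K (s \<cdot> u) (g \<cdot> w) = K (s' \<cdot> u') (g' \<cdot> w')"
proof -
  note [simp] = fillsD(1-12)[OF c] fillsD(1-12)[OF c']
  obtain a b where ab: "a \<in> W" "b \<in> W" "src T a = src T b" "tgt T a = src T s" "tgt T b = src T s'"
    "s \<cdot> a = s' \<cdot> b" "f \<cdot> a = f' \<cdot> b" "tgt T s' = tgt T s" "tgt T f' = tgt T f"
    by (rule K_eqE[OF assms(3)]) simp_all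
  obtain c d where cd: "c \<in> W" "d \<in> W" "src T c = src T d" "tgt T c = src T r" "tgt T d = src T r'"
    "r \<cdot> c = r' \<cdot> d" "g \<cdot> c = g' \<cdot> d" "tgt T r' = tgt T r" "tgt T g' = tgt T g"
    by (rule K_eqE[OF assms(4)]) simp_all
  note [simp] = ab(1-5) cd(1-5)
  obtain x y where xy [simp]: "x \<in> W" "y \<in> mor T" "src T x = src T y" "tgt T x = src T b"
    "tgt T y = src T d" and eq: "(f \<cdot> a) \<cdot> x = (r \<cdot> c) \<cdot> y"
    by (rule W_ore[of "f \<cdot> a" "r \<cdot> c"]) simp_all
  have 1: "fills s f r g (a \<cdot> x) (c \<cdot> y)" by (rule fillsI) (use eq in simp_all)
  have "(f' \<cdot> b) \<cdot> x = (r' \<cdot> d) \<cdot> y" using eq unfolding ab(7) cd(6) .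
  then have 2: "fills s' f' r' g' (b \<cdot> x) (d \<cdot> y)" by - (rule fillsI, simp_all)
  have "K (s \<cdot> u) (g \<cdot> w) = K (s \<cdot> (a \<cdot> x)) (g \<cdot> (c \<cdot> y))" by (rule fills_unique[OF c 1])
  also have "s \<cdot> (a \<cdot> x) = s' \<cdot> (b \<cdot> x)" by (rule cmp_eq_cmp[OF ab(6)]) simp_all
  also have "g \<cdot> (c \<cdot> y) = g' \<cdot> (d \<cdot> y)" by (rule cmp_eq_cmp[OF cd(7)]) simp_all
  also have "K (s' \<cdot> (b \<cdot> x)) (g' \<cdot> (d \<cdot> y)) = K (s' \<cdot> u') (g' \<cdot> w')" by (rule fills_unique[OF 2 c'])
  finally show ?thesis .
qed

lemma fills_composite:
  assumes c: "fills s f r g u w"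
  shows "s \<cdot> u \<in> W" "g \<cdot> w \<in> mor T" "src T (g \<cdot> w) = src T (s \<cdot> u)"
    "src T (s \<cdot> u) = src T w" "tgt T (s \<cdot> u) = tgt T s" "tgt T (g \<cdot> w) = tgt T g"
  using fillsD(1-12)[OF c] by simp_all

lemma elts_Cmp_Q:
  "elts (Cmp Q) = {triple (K r g) (K s f) (K (s \<cdot> u) (g \<cdot> w)) | s f r g u w. fills s f r g u w}"
  and relation3_Cmp_Q: "is_relation3 (Cmp Q) (Mor Q)"
proof -
  let ?A = "{triple (K r g) (K s f) (K (s \<cdot> u) (g \<cdot> w)) | s f r g u w. fills s f r g u w}"
  have sub: "?A \<subseteq> triples (elts (Mor Q))"
  proof
    fix z assume "z \<in> ?A"
    then obtain s f r g u w where z: "z = triple (K r g) (K s f) (K (s \<cdot> u) (g \<cdot> w))"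
      and c: "fills s f r g u w" by blast
    show "z \<in> triples (elts (Mor Q))"
      unfolding z in_triples using fillsD[OF c] fills_composite[OF c] by simp
  qed
  have "Cmp Q = mkset ?A"
    unfolding Q_defs small_cat.simps roof_iff fills_def conj_assoc ..
  then show "elts (Cmp Q) = ?A" "is_relation3 (Cmp Q) (Mor Q)"
    using sub_triples_Q[OF sub] sub unfolding is_relation3_def by simp_all
qed

lemma triple_Cmp_Q_iff:
  "triple b a c \<in> elts (Cmp Q) \<longleftrightarrow>
     (\<exists>s f r g u w. fills s f r g u w \<and> a = K s f \<and> b = K r g \<and> c = K (s \<cdot> u) (g \<cdot> w))"
  unfolding elts_Cmp_Q by (simp add: triple_iff) metis

lemma cmp_Q:
  assumes c: "fills s f r g u w"
  shows "K r g \<star> K s f = K (s \<cdot> u) (g \<cdot> w)"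
  unfolding cmp_def[of Q]
proof (rule app_eqI, fold triple_def)
  show "triple (K r g) (K s f) (K (s \<cdot> u) (g \<cdot> w)) \<in> elts (Cmp Q)"
    unfolding triple_Cmp_Q_iff using c by blast
  fix z assume "triple (K r g) (K s f) z \<in> elts (Cmp Q)"
  then show "z = K (s \<cdot> u) (g \<cdot> w)"
    unfolding triple_Cmp_Q_iff using fills_cong[OF c] by metis
qed

lemma category_Q: "category Q"
  unfolding category_def
proof (intro conjI)
  show "\<not> atom (Mor Q)" "is_function (Src Q) (Mor Q) (Mor Q)" "is_function (Tgt Q) (Mor Q) (Mor Q)"
    "is_relation3 (Cmp Q) (Mor Q)"
    by (rule atom_Mor_Q function_Src_Q function_Tgt_Q relation3_Cmp_Q)+
  show "\<forall>f\<in>mor Q. src Q (src Q f) = src Q f \<and> tgt Q (src Q f) = src Q f \<and>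
                src Q (tgt Q f) = tgt Q f \<and> tgt Q (tgt Q f) = tgt Q f"
    by (auto elim!: mor_QE simp: F_ob)
  show "\<forall>f\<in>mor Q. \<forall>g\<in>mor Q. (\<exists>h. triple g f h \<in> elts (Cmp Q)) \<longleftrightarrow> src Q g = tgt Q f"
  proof (intro ballI iffI)
    fix a b assume "\<exists>c. triple b a c \<in> elts (Cmp Q)"
    then obtain s f r g u w where c: "fills s f r g u w" and ab: "a = K s f" "b = K r g"
      unfolding triple_Cmp_Q_iff by blast
    show "src Q b = tgt Q a" unfolding ab using fillsD(1-12)[OF c] by simp
  next
    fix a b assume "a \<in> mor Q" "b \<in> mor Q" and eq: "src Q b = tgt Q a"
    obtain s f where s: "s \<in> W" "f \<in> mor T" "src T f = src T s" "a = K s f"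
      using \<open>a \<in> mor Q\<close> by (rule mor_QE)
    obtain r g where r: "r \<in> W" "g \<in> mor T" "src T g = src T r" "b = K r g"
      using \<open>b \<in> mor Q\<close> by (rule mor_QE)
    have "tgt T r = tgt T f" by (rule F_inj) (use s r eq in simp_all)
    with s(1-3) r(1-3) obtain u w where "fills s f r g u w" by (rule ex_fills)
    then show "\<exists>c. triple b a c \<in> elts (Cmp Q)" unfolding triple_Cmp_Q_iff s(4) r(4) by blast
  qed
  show "\<forall>f g h h'. triple g f h \<in> elts (Cmp Q) \<and> triple g f h' \<in> elts (Cmp Q) \<longrightarrow> h = h'"
    unfolding triple_Cmp_Q_iff using fills_cong by metis
  show "\<forall>f\<in>mor Q. \<forall>g\<in>mor Q. src Q g = tgt Q f \<longrightarrow>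
        src Q (cmp Q g f) = src Q f \<and> tgt Q (cmp Q g f) = tgt Q g"
  proof (intro ballI impI)
    fix a b assume "a \<in> mor Q" "b \<in> mor Q" and eq: "src Q b = tgt Q a"
    obtain s f where s: "s \<in> W" "f \<in> mor T" "src T f = src T s" "a = K s f"
      using \<open>a \<in> mor Q\<close> by (rule mor_QE)
    obtain r g where r: "r \<in> W" "g \<in> mor T" "src T g = src T r" "b = K r g"
      using \<open>b \<in> mor Q\<close> by (rule mor_QE)
    have "tgt T r = tgt T f" by (rule F_inj) (use s r eq in simp_all)
    with s(1-3) r(1-3) obtain u w where c: "fills s f r g u w" by (rule ex_fills)
    show "src Q (b \<star> a) = src Q a \<and> tgt Q (b \<star> a) = tgt Q b"
      unfolding s(4) r(4) cmp_Q[OF c] using fillsD(1-12)[OF c] by simp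
  qed
  show "\<forall>f\<in>mor Q. cmp Q f (src Q f) = f \<and> cmp Q (tgt Q f) f = f"
  proof
    fix a assume "a \<in> mor Q"
    then obtain s f where s [simp]: "s \<in> W" "f \<in> mor T" "src T f = src T s" and a: "a = K s f"
      by (rule mor_QE)
    have 1: "fills (tgt T s) (tgt T s) s f s (src T s)" by (rule fillsI) simp_all
    have 2: "fills s f (tgt T f) (tgt T f) (src T s) f" by (rule fillsI) simp_all
    show "a \<star> src Q a = a \<and> tgt Q a \<star> a = a"
      using cmp_Q[OF 1] cmp_Q[OF 2] by (simp add: a F_ob)
  qed
  show "\<forall>f\<in>mor Q. \<forall>g\<in>mor Q. \<forall>h\<in>mor Q. src Q g = tgt Q f \<and> src Q h = tgt Q g \<longrightarrow>
        cmp Q h (cmp Q g f) = cmp Q (cmp Q h g) f"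
  proof (intro ballI impI, elim conjE)
    fix a b c assume abc: "a \<in> mor Q" "b \<in> mor Q" "c \<in> mor Q"
      and eq: "src Q b = tgt Q a" "src Q c = tgt Q b"
    obtain s f where s: "s \<in> W" "f \<in> mor T" "src T f = src T s" "a = K s f"
      using abc(1) by (rule mor_QE)
    obtain r g where r: "r \<in> W" "g \<in> mor T" "src T g = src T r" "b = K r g"
      using abc(2) by (rule mor_QE)
    obtain t h where t: "t \<in> W" "h \<in> mor T" "src T h = src T t" "c = K t h"
      using abc(3) by (rule mor_QE)
    have rf: "tgt T r = tgt T f" by (rule F_inj) (use s r eq in simp_all)
    have tg: "tgt T t = tgt T g" by (rule F_inj) (use r t eq in simp_all)
    \<comment> \<open>The square for the two left factors is filled first, and the next filling is
      taken against r p. Both bracketings are then represented by the same denominator s u and the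
      same numerator h q w.\<close>
    obtain p q where 1: "fills r g t h p q"
      using r(1-3) t(1-3) tg by (rule ex_fills)
    note [simp] = s(1-3) r(1-3) t(1-3) rf tg fillsD(8-12)[OF 1]
    obtain u w where 2: "fills s f (r \<cdot> p) (h \<cdot> q) u w" 
      by (rule ex_fills[of s f "r \<cdot> p" "h \<cdot> q"]) simp_all
    note [simp] = fillsD(8-12)[OF 2]
    have 3: "fills s f r g u (p \<cdot> w)"
      by (rule fillsI) (use fillsD(13)[OF 2] in simp_all)
    have "g \<cdot> (p \<cdot> w) = t \<cdot> (q \<cdot> w)" by (rule cmp_eq_cmp[OF fillsD(13)[OF 1]]) simp_all
    then have 4: "fills (s \<cdot> u) (g \<cdot> (p \<cdot> w)) t h (src T w) (q \<cdot> w)"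
      by - (rule fillsI, simp_all)
    show "c \<star> (b \<star> a) = (c \<star> b) \<star> a"
      unfolding s(4) r(4) t(4) cmp_Q[OF 1] cmp_Q[OF 2] cmp_Q[OF 3] cmp_Q[OF 4] by simp
  qed
qed

sublocale Q: categ Q
  by unfold_locales (rule category_Q)

section \<open>Common denominators and the sum of fractions\<close>

lemma refine_denominator:
  assumes s [simp]: "s \<in> W" and b: "b \<in> mor Q" "src Q b = F (tgt T s)"
  obtains u h where "u \<in> W" "tgt T u = src T s" "h \<in> mor T" "src T h = src T u" "b = K (s \<cdot> u) h"
proof -
  obtain r g where r [simp]: "r \<in> W" "g \<in> mor T" "src T g = src T r" and bg: "b = K r g"
    using b(1) by (rule mor_QE)
  have [simp]: "tgt T r = tgt T s" by (rule F_inj) (use b bg in simp_all)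
  obtain u w where u [simp]: "u \<in> W" "w \<in> mor T" "src T u = src T w" "tgt T u = src T s"
    "tgt T w = src T r" and eq: "s \<cdot> u = r \<cdot> w" by (rule W_ore[of s r]) simp_all
  \<comment> \<open>As s u = r w, cancellation puts w into W, so the fraction with denominator r may
    be expanded by w.\<close>
  have "s \<cdot> u \<in> W" by simp
  then have w: "w \<in> W" unfolding eq by (rule W_cancel) simp_all
  have "K r g = K (r \<cdot> w) (g \<cdot> w)" using w by (simp add: K_refine)
  then show ?thesis using that[of u "g \<cdot> w"] bg eq by simp
qed

lemma common_denominator:
  assumes "a \<in> mor Q" "b \<in> mor Q" "src Q a = src Q b"
  obtains s f g where "s \<in> W" "f \<in> mor T" "src T f = src T s" "g \<in> mor T" "src T g = src T s"
    "a = K s f" "b = K s g"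
proof -
  obtain s f where s: "s \<in> W" "f \<in> mor T" "src T f = src T s" and a: "a = K s f"
    using assms(1) by (rule mor_QE)
  have "src Q b = F (tgt T s)" using assms(3) a s by simp
  with s(1) assms(2) obtain u h where u: "u \<in> W" "tgt T u = src T s" "h \<in> mor T"
    "src T h = src T u" "b = K (s \<cdot> u) h" by (rule refine_denominator)
  moreover have "a = K (s \<cdot> u) (f \<cdot> u)" using a s u by (simp add: K_refine)
  ultimately show ?thesis using s by - (rule that[of "s \<cdot> u" "f \<cdot> u" h], simp_all)
qed

lemma common_denominator3:
  assumes "a \<in> mor Q" "b \<in> mor Q" "c \<in> mor Q" "src Q a = src Q c" "src Q b = src Q c"
  obtains s f g h where "s \<in> W" "f \<in> mor T" "src T f = src T s" "g \<in> mor T" "src T g = src T s"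
    "h \<in> mor T" "src T h = src T s" "a = K s f" "b = K s g" "c = K s h"
proof -
  have "src Q a = src Q b" using assms by simp
  with assms(1,2) obtain s f g where s: "s \<in> W" "f \<in> mor T" "src T f = src T s"
    "g \<in> mor T" "src T g = src T s" and ab: "a = K s f" "b = K s g" by (rule common_denominator)
  have "src Q c = F (tgt T s)" using assms(4) ab s by simp
  with s(1) assms(3) obtain u h where u: "u \<in> W" "tgt T u = src T s" "h \<in> mor T"
    "src T h = src T u" "c = K (s \<cdot> u) h" by (rule refine_denominator)
  moreover have "a = K (s \<cdot> u) (f \<cdot> u)" "b = K (s \<cdot> u) (g \<cdot> u)"
    using ab s u by (simp_all add: K_refine)
  ultimately show ?thesis
    using s by - (rule that[of "s \<cdot> u" "f \<cdot> u" "g \<cdot> u" h], simp_all)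
qed

text \<open>The two equalities of fractions come with unrelated expansions. The Ore condition merges
  their legs into the source of s; the legs into the source of s' then agree only after composition
  with s', hence the additional z.\<close>

lemma add_cong:
  assumes ty [simp]: "s \<in> W" "f \<in> mor T" "src T f = src T s" "g \<in> mor T" "src T g = src T s"
      "tgt T f = tgt T g"
      "s' \<in> W" "f' \<in> mor T" "src T f' = src T s'" "g' \<in> mor T" "src T g' = src T s'"
      "tgt T f' = tgt T g'"
    and "K s f = K s' f'" "K s g = K s' g'"
  shows "K s (f \<oplus> g) = K s' (f' \<oplus> g')"
proof -
  obtain a b where ab: "a \<in> W" "b \<in> W" "src T a = src T b" "tgt T a = src T s" "tgt T b = src T s'"
    "s \<cdot> a = s' \<cdot> b" "f \<cdot> a = f' \<cdot> b"
    by (rule K_eqE[OF assms(13)]) simp_all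
  obtain c d where cd: "c \<in> W" "d \<in> W" "src T c = src T d" "tgt T c = src T s" "tgt T d = src T s'"
    "s \<cdot> c = s' \<cdot> d" "g \<cdot> c = g' \<cdot> d"
    by (rule K_eqE[OF assms(14)]) simp_all
  note [simp] = ab(1-5) cd(1-5)
  obtain x y where xy [simp]: "x \<in> W" "y \<in> mor T" "src T x = src T y" "tgt T x = src T b"
    "tgt T y = src T d" and ax: "a \<cdot> x = c \<cdot> y"
    by (rule W_ore[of a c]) simp_all
  have "a \<cdot> x \<in> W" by simp
  then have [simp]: "y \<in> W" unfolding ax by (rule W_cancel) simp_all
  have "s' \<cdot> (b \<cdot> x) = s \<cdot> (a \<cdot> x)" by (rule cmp_eq_cmp[OF ab(6)[symmetric]]) simp_all
  also have "\<dots> = s \<cdot> (c \<cdot> y)" by (simp add: ax)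
  also have "\<dots> = s' \<cdot> (d \<cdot> y)" by (rule cmp_eq_cmp[OF cd(6)]) simp_all
  finally have eq: "s' \<cdot> (b \<cdot> x) = s' \<cdot> (d \<cdot> y)" .
  obtain z where z [simp]: "z \<in> W" "tgt T z = src T y" and bz: "(b \<cdot> x) \<cdot> z = (d \<cdot> y) \<cdot> z"
    by (rule W_equalize[OF _ _ _ _ _ _ eq]) simp_all
  have bd: "b \<cdot> (x \<cdot> z) = d \<cdot> (y \<cdot> z)" using bz by simp
  have ac: "a \<cdot> (x \<cdot> z) = c \<cdot> (y \<cdot> z)" by (rule cmp_eq_cmp[OF ax]) simp_all
  let ?e = "a \<cdot> (x \<cdot> z)" and ?e' = "b \<cdot> (x \<cdot> z)"
  have fe: "f \<cdot> ?e = f' \<cdot> ?e'" by (rule cmp_eq_cmp[OF ab(7)]) simp_all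
  have "g \<cdot> (c \<cdot> (y \<cdot> z)) = g' \<cdot> (d \<cdot> (y \<cdot> z))" by (rule cmp_eq_cmp[OF cd(7)]) simp_all
  then have ge: "g \<cdot> ?e = g' \<cdot> ?e'" unfolding ac bd .
  show ?thesis
  proof (rule K_eqI[where u = ?e and v = ?e'])
    show "s \<cdot> ?e = s' \<cdot> ?e'" by (rule cmp_eq_cmp[OF ab(6)]) simp_all
    have "(f \<oplus> g) \<cdot> ?e = f \<cdot> ?e \<oplus> g \<cdot> ?e" by (rule cmp_add) simp_all
    also have "\<dots> = f' \<cdot> ?e' \<oplus> g' \<cdot> ?e'" unfolding fe ge ..
    also have "\<dots> = (f' \<oplus> g') \<cdot> ?e'" by (rule cmp_add[symmetric]) simp_all
    finally show "(f \<oplus> g) \<cdot> ?e = (f' \<oplus> g') \<cdot> ?e'" .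
  qed simp_all
qed

end

section \<open>Additive structure and shift of the quotient\<close>

context verdier
begin

lemma elts_Add_Q:
  "elts (Add Q) = {triple (K s f) (K s g) (K s (f \<oplus> g)) | s f g. s \<in> W \<and> f \<in> mor T \<and>
     src T f = src T s \<and> g \<in> mor T \<and> src T g = src T s \<and> tgt T f = tgt T g}"
  and relation3_Add_Q: "is_relation3 (Add Q) (Mor Q)"
proof -
  let ?A = "{triple (K s f) (K s g) (K s (f \<oplus> g)) | s f g. s \<in> W \<and> f \<in> mor T \<and>
     src T f = src T s \<and> g \<in> mor T \<and> src T g = src T s \<and> tgt T f = tgt T g}"
  have sub: "?A \<subseteq> triples (elts (Mor Q))"
  proof
    fix z assume "z \<in> ?A"
    then obtain s f g where z: "z = triple (K s f) (K s g) (K s (f \<oplus> g))"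
      and c: "s \<in> W" "f \<in> mor T" "src T f = src T s" "g \<in> mor T" "src T g = src T s"
        "tgt T f = tgt T g" by blast
    show "z \<in> triples (elts (Mor Q))" unfolding z in_triples using c by simp
  qed
  have "Add Q = mkset ?A"
    unfolding Q_defs shift_cat.simps roof_iff
    by (rule arg_cong[of _ _ mkset], rule Collect_cong, intro iff_exI) blast
  then show "elts (Add Q) = ?A" "is_relation3 (Add Q) (Mor Q)"
    using sub_triples_Q[OF sub] sub unfolding is_relation3_def by simp_all
qed

lemma triple_Add_Q_iff:
  "triple a b c \<in> elts (Add Q) \<longleftrightarrow> (\<exists>s f g. s \<in> W \<and> f \<in> mor T \<and> src T f = src T s \<and> g \<in> mor T \<and>
     src T g = src T s \<and> tgt T f = tgt T g \<and> a = K s f \<and> b = K s g \<and> c = K s (f \<oplus> g))"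
  unfolding elts_Add_Q mem_Collect_eq triple_iff by blast

lemma triple_Add_Q_unique:
  assumes "triple a b c \<in> elts (Add Q)" "triple a b c' \<in> elts (Add Q)"
  shows "c = c'"
proof -
  obtain s f g where 1: "s \<in> W" "f \<in> mor T" "src T f = src T s" "g \<in> mor T" "src T g = src T s"
    "tgt T f = tgt T g" "a = K s f" "b = K s g" "c = K s (f \<oplus> g)"
    using assms(1) unfolding triple_Add_Q_iff by blast
  obtain s' f' g' where 2: "s' \<in> W" "f' \<in> mor T" "src T f' = src T s'" "g' \<in> mor T" "src T g' = src T s'"
    "tgt T f' = tgt T g'" "a = K s' f'" "b = K s' g'" "c' = K s' (f' \<oplus> g')"
    using assms(2) unfolding triple_Add_Q_iff by blast
  show ?thesis unfolding 1(9) 2(9)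
    by (rule add_cong[OF 1(1-6) 2(1-6)]) (simp_all flip: 1(7,8) 2(7,8))
qed

lemma add_Q:
  assumes "s \<in> W" "f \<in> mor T" "src T f = src T s" "g \<in> mor T" "src T g = src T s" "tgt T f = tgt T g"
  shows "K s f \<uplus> K s g = K s (f \<oplus> g)"
  unfolding add_def[of Q]
proof (rule app_eqI, fold triple_def)
  show i: "triple (K s f) (K s g) (K s (f \<oplus> g)) \<in> elts (Add Q)"
    unfolding triple_Add_Q_iff using assms by blast
  fix z assume "triple (K s f) (K s g) z \<in> elts (Add Q)"
  then show "z = K s (f \<oplus> g)" using i by (rule triple_Add_Q_unique)
qed

lemma ob_QE:
  assumes "x \<in> ob Q"
  obtains x' where "x' \<in> ob T" "x = F x'"
proof -
  have x: "x \<in> mor Q" "src Q x = x" using assms unfolding ob_def by blast+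
  then obtain s f where s: "s \<in> W" "f \<in> mor T" "src T f = src T s" "x = K s f" by - (rule mor_QE)
  then have "x = F (tgt T s)" using x(2) by simp
  then show ?thesis using that[of "tgt T s"] s by simp
qed

lemma src_F [simp]: "f \<in> mor T \<Longrightarrow> src Q (F f) = F (src T f)"
  and tgt_F [simp]: "f \<in> mor T \<Longrightarrow> tgt Q (F f) = F (tgt T f)"
  and F_mor [simp]: "f \<in> mor T \<Longrightarrow> F f \<in> mor Q"
  by (simp_all add: F_def[of f])

lemma F_ob_mor [simp]: "x \<in> ob T \<Longrightarrow> F x \<in> ob Q"
  unfolding ob_def[of Q] by simp

lemma F_elts_Mor [simp]: "f \<in> mor T \<Longrightarrow> F f \<in> elts (Mor Q)"
  using F_mor unfolding mor_def[of Q] .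

lemma F_cmp:
  assumes [simp]: "f \<in> mor T" "g \<in> mor T" "src T g = tgt T f"
  shows "F (g \<cdot> f) = F g \<star> F f"
proof -
  have "fills (src T f) f (src T g) g (src T f) f" by (rule fillsI) simp_all
  from cmp_Q[OF this] show ?thesis by (simp add: F_def)
qed

lemma F_add:
  assumes [simp]: "f \<in> mor T" "g \<in> mor T" "src T f = src T g" "tgt T f = tgt T g"
  shows "F (f \<oplus> g) = F f \<uplus> F g"
  by (simp add: F_def add_Q)

lemma K_cmp_F:
  assumes [simp]: "s \<in> W" "f \<in> mor T" "src T f = src T s"
  shows "K s f \<star> F s = F f"
proof -
  have "fills (src T s) s s f (src T s) (src T s)" by (rule fillsI) simp_all
  from cmp_Q[OF this] show ?thesis by (simp add: F_def)
qed

lemma K_decompose: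
  assumes [simp]: "s \<in> W" "f \<in> mor T" "src T f = src T s"
  shows "K s f = F f \<star> K s (src T s)"
proof -
  have "fills s (src T s) (src T s) f (src T s) (src T s)" by (rule fillsI) simp_all
  from cmp_Q[OF this] show ?thesis by (simp add: F_def)
qed

text \<open>The composite is the fraction s/s, an expansion of the identity fraction.\<close>

lemma F_cmp_K:
  assumes [simp]: "s \<in> W"
  shows "F s \<star> K s (src T s) = F (tgt T s)"
  using K_decompose[of s s] K_refine[of "tgt T s" "tgt T s" s] by (simp add: F_ob)

text \<open>The inverse is the fraction with denominator s and identity numerator.\<close>

lemma iso_F_W:
  assumes [simp]: "s \<in> W"
  shows "iso Q (F s)"
  by (rule Q.isoI[of _ "K s (src T s)"]) (simp_all add: F_cmp_K K_cmp_F)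

lemma preadditive_Q: "preadditive Q"
  unfolding preadditive_def
proof (intro conjI)
  show "category Q" "is_relation3 (Add Q) (Mor Q)" by (rule category_Q relation3_Add_Q)+
  show "\<forall>f\<in>mor Q. \<forall>g\<in>mor Q. (\<exists>h. triple f g h \<in> elts (Add Q)) \<longleftrightarrow>
        src Q f = src Q g \<and> tgt Q f = tgt Q g"
  proof (intro ballI iffI)
    fix a b assume "\<exists>c. triple a b c \<in> elts (Add Q)"
    then obtain s f g where "s \<in> W" "f \<in> mor T" "src T f = src T s" "g \<in> mor T" "src T g = src T s"
      "tgt T f = tgt T g" "a = K s f" "b = K s g" unfolding triple_Add_Q_iff by blast
    then show "src Q a = src Q b \<and> tgt Q a = tgt Q b" by simp
  next
    fix a b assume ab: "a \<in> mor Q" "b \<in> mor Q" and eq: "src Q a = src Q b \<and> tgt Q a = tgt Q b"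
    obtain s f g where s: "s \<in> W" "f \<in> mor T" "src T f = src T s" "g \<in> mor T" "src T g = src T s"
      "a = K s f" "b = K s g" using ab eq[THEN conjunct1] by (rule common_denominator)
    have "tgt T f = tgt T g" by (rule F_inj) (use s eq in simp_all)
    then show "\<exists>c. triple a b c \<in> elts (Add Q)" unfolding triple_Add_Q_iff using s by blast
  qed
  show "\<forall>f g h h'. triple f g h \<in> elts (Add Q) \<and> triple f g h' \<in> elts (Add Q) \<longrightarrow> h = h'"
    using triple_Add_Q_unique by blast
  show "\<forall>x\<in>ob Q. \<forall>y\<in>ob Q.
        (\<forall>f\<in>hom Q x y. \<forall>g\<in>hom Q x y. f \<uplus> g \<in> hom Q x y) \<and>
        (\<forall>f\<in>hom Q x y. \<forall>g\<in>hom Q x y. \<forall>h\<in>hom Q x y. f \<uplus> g \<uplus> h = f \<uplus> (g \<uplus> h)) \<and>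
        (\<forall>f\<in>hom Q x y. \<forall>g\<in>hom Q x y. f \<uplus> g = g \<uplus> f) \<and>
        (\<exists>z\<in>hom Q x y. (\<forall>f\<in>hom Q x y. z \<uplus> f = f) \<and>
           (\<forall>f\<in>hom Q x y. \<exists>g\<in>hom Q x y. f \<uplus> g = z))"
  proof (intro ballI)
    fix x y assume "x \<in> ob Q" "y \<in> ob Q"
    then obtain x' y' where x [simp]: "x' \<in> ob T" "y' \<in> ob T" and xy: "x = F x'" "y = F y'"
      by (metis ob_QE)
    have two: "\<exists>s f g. s \<in> W \<and> f \<in> mor T \<and> src T f = src T s \<and> g \<in> mor T \<and> src T g = src T s \<and>
        tgt T s = x' \<and> tgt T f = y' \<and> tgt T g = y' \<and> a = K s f \<and> b = K s g"
      if "a \<in> hom Q x y" "b \<in> hom Q x y" for a b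
    proof -
      have ab: "a \<in> mor Q" "b \<in> mor Q" "src Q a = F x'" "src Q b = F x'" "tgt Q a = F y'" "tgt Q b = F y'"
        using that by (simp_all add: hom_def xy)
      obtain s f g where s: "s \<in> W" "f \<in> mor T" "src T f = src T s" "g \<in> mor T" "src T g = src T s"
        "a = K s f" "b = K s g" by (rule common_denominator[of a b]) (use ab in simp_all)
      have "tgt T s = x'" by (rule F_inj) (use s ab in simp_all)
      moreover have "tgt T f = y'" by (rule F_inj) (use s ab in simp_all)
      moreover have "tgt T g = y'" by (rule F_inj) (use s ab in simp_all)
      ultimately show ?thesis using s by blast
    qed
    have 1: "a \<uplus> b \<in> hom Q x y \<and> a \<uplus> b = b \<uplus> a" if ab: "a \<in> hom Q x y" "b \<in> hom Q x y" for a b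
    proof -
      obtain s f g where [simp]: "s \<in> W" "f \<in> mor T" "src T f = src T s" "g \<in> mor T" "src T g = src T s"
        "tgt T s = x'" "tgt T f = y'" "tgt T g = y'" and ab: "a = K s f" "b = K s g"
        using two[OF ab] by blast
      have "f \<oplus> g = g \<oplus> f" by (rule add_commute) simp_all
      then show ?thesis by (simp add: hom_def ab add_Q xy)
    qed
    have 2: "a \<uplus> b \<uplus> c = a \<uplus> (b \<uplus> c)" if "a \<in> hom Q x y" "b \<in> hom Q x y" "c \<in> hom Q x y" for a b c
    proof -
      have abc: "a \<in> mor Q" "b \<in> mor Q" "c \<in> mor Q" "src Q a = F x'" "src Q b = F x'" "src Q c = F x'"
        "tgt Q a = F y'" "tgt Q b = F y'" "tgt Q c = F y'"
        using that by (simp_all add: hom_def xy)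
      obtain s f g h where s [simp]: "s \<in> W" "f \<in> mor T" "src T f = src T s" "g \<in> mor T" "src T g = src T s"
        "h \<in> mor T" "src T h = src T s" and e: "a = K s f" "b = K s g" "c = K s h"
        by (rule common_denominator3[of a b c]) (use abc in simp_all)
      have "tgt T f = y'" by (rule F_inj) (use e abc in simp_all)
      moreover have "tgt T g = y'" by (rule F_inj) (use e abc in simp_all)
      moreover have "tgt T h = y'" by (rule F_inj) (use e abc in simp_all)
      ultimately have [simp]: "tgt T f = y'" "tgt T g = y'" "tgt T h = y'" by blast+
      have "f \<oplus> g \<oplus> h = f \<oplus> (g \<oplus> h)" by (rule add_assoc) simp_all
      then show ?thesis by (simp add: e add_Q)
    qed
    let ?z = "F (zero T x' y')"
    have 3: "?z \<in> hom Q x y" by (simp add: hom_def xy)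
    have 4: "?z \<uplus> a = a \<and> (\<exists>b\<in>hom Q x y. a \<uplus> b = ?z)" if a: "a \<in> hom Q x y" for a
    proof -
      obtain s f where [simp]: "s \<in> W" "f \<in> mor T" "src T f = src T s"
        "tgt T s = x'" "tgt T f = y'" and a: "a = K s f"
        using two[OF a a] by blast
      \<comment> \<open>The zero fraction is expanded to the denominator of a, where sums are
        computed on numerators.\<close>
      have "K (x' \<cdot> s) (zero T x' y' \<cdot> s) = K x' (zero T x' y')" by (rule K_refine) simp_all
      then have z: "?z = K s (zero T (src T s) y')" by (simp add: F_def)
      have "?z \<uplus> a = a" unfolding z a by (simp add: add_Q)
      moreover have "a \<uplus> K s (neg T f) = ?z" unfolding z a by (simp add: add_Q add_neg)
      moreover have "K s (neg T f) \<in> hom Q x y" by (simp add: hom_def xy)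
      ultimately show ?thesis by blast
    qed
    show "(\<forall>f\<in>hom Q x y. \<forall>g\<in>hom Q x y. f \<uplus> g \<in> hom Q x y) \<and>
        (\<forall>f\<in>hom Q x y. \<forall>g\<in>hom Q x y. \<forall>h\<in>hom Q x y. f \<uplus> g \<uplus> h = f \<uplus> (g \<uplus> h)) \<and>
        (\<forall>f\<in>hom Q x y. \<forall>g\<in>hom Q x y. f \<uplus> g = g \<uplus> f) \<and>
        (\<exists>z\<in>hom Q x y. (\<forall>f\<in>hom Q x y. z \<uplus> f = f) \<and>
           (\<forall>f\<in>hom Q x y. \<exists>g\<in>hom Q x y. f \<uplus> g = z))"
    proof (intro conjI)
      show "\<exists>z\<in>hom Q x y. (\<forall>f\<in>hom Q x y. z \<uplus> f = f) \<and> (\<forall>f\<in>hom Q x y. \<exists>g\<in>hom Q x y. f \<uplus> g = z)"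
        by (rule bexI[OF _ 3]) (use 4 in blast)
    qed (use 1 2 in blast)+
  qed
  show "\<forall>x\<in>ob Q. \<forall>y\<in>ob Q. \<forall>z\<in>ob Q.
        (\<forall>f\<in>hom Q x y. \<forall>g\<in>hom Q y z. \<forall>g'\<in>hom Q y z. (g \<uplus> g') \<star> f = g \<star> f \<uplus> g' \<star> f) \<and>
        (\<forall>f\<in>hom Q x y. \<forall>f'\<in>hom Q x y. \<forall>g\<in>hom Q y z. g \<star> (f \<uplus> f') = g \<star> f \<uplus> g \<star> f')"
  proof (intro ballI conjI)
    fix x y z a b b' assume "a \<in> hom Q x y" "b \<in> hom Q y z" "b' \<in> hom Q y z"
    then have h: "a \<in> mor Q" "b \<in> mor Q" "b' \<in> mor Q" "src Q b = tgt Q a" "src Q b' = tgt Q a"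
      "tgt Q b = tgt Q b'" by (simp_all add: hom_def)
    obtain s f where s [simp]: "s \<in> W" "f \<in> mor T" "src T f = src T s" and a: "a = K s f"
      using h(1) by (rule mor_QE)
    obtain r g g' where r [simp]: "r \<in> W" "g \<in> mor T" "src T g = src T r" "g' \<in> mor T" "src T g' = src T r"
      and b: "b = K r g" "b' = K r g'" by (rule common_denominator[of b b']) (use h in simp_all)
    have rf [simp]: "tgt T r = tgt T f" by (rule F_inj) (use h a b in simp_all)
    have g [simp]: "tgt T g = tgt T g'" by (rule F_inj) (use h a b in simp_all)
    obtain u w where c: "fills s f r g u w" by (rule ex_fills[of s f r g]) simp_all
    note [simp] = fillsD(8-12)[OF c]
    have c': "fills s f r g' u w" "fills s f r (g \<oplus> g') u w"
      by (rule fillsI; use fillsD(13)[OF c] in simp)+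
    have "(g \<oplus> g') \<cdot> w = g \<cdot> w \<oplus> g' \<cdot> w" by (rule cmp_add) simp_all
    then show "(b \<uplus> b') \<star> a = b \<star> a \<uplus> b' \<star> a"
      by (simp add: a b add_Q cmp_Q[OF c] cmp_Q[OF c'(1)] cmp_Q[OF c'(2)])
  next
    fix x y z a a' b assume "a \<in> hom Q x y" "a' \<in> hom Q x y" "b \<in> hom Q y z"
    then have h: "a \<in> mor Q" "a' \<in> mor Q" "b \<in> mor Q" "src Q b = tgt Q a" "src Q a = src Q a'"
      "tgt Q a = tgt Q a'" by (simp_all add: hom_def)
    obtain s f f' where s [simp]: "s \<in> W" "f \<in> mor T" "src T f = src T s" "f' \<in> mor T" "src T f' = src T s"
      and a: "a = K s f" "a' = K s f'" using h(1,2,5) by (rule common_denominator)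
    obtain r g where r [simp]: "r \<in> W" "g \<in> mor T" "src T g = src T r" and b: "b = K r g"
      using h(3) by (rule mor_QE)
    have f [simp]: "tgt T f = tgt T f'" by (rule F_inj) (use h a b in simp_all)
    have rf [simp]: "tgt T r = tgt T f'" by (rule F_inj) (use h a b in simp_all)
    obtain u w where c: "fills s f r g u w" by (rule ex_fills[of s f r g]) simp_all
    obtain u' w' where c': "fills s f' r g u' w'" by (rule ex_fills[of s f' r g]) simp_all
    note [simp] = fillsD(8-12)[OF c] fillsD(8-12)[OF c']
    \<comment> \<open>The fillings for f and f' are refined to a common first leg u x, over which
      their second legs can be added.\<close>
    obtain x y where x [simp]: "x \<in> W" "y \<in> mor T" "src T x = src T y" "tgt T x = src T w"
      "tgt T y = src T w'" and ux: "u \<cdot> x = u' \<cdot> y" by (rule W_ore[of u u']) simp_all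
    have "f \<cdot> (u \<cdot> x) = r \<cdot> (w \<cdot> x)" by (rule cmp_eq_cmp[OF fillsD(13)[OF c]]) simp_all
    then have d: "fills s f r g (u \<cdot> x) (w \<cdot> x)" by - (rule fillsI, simp_all)
    have "f' \<cdot> (u' \<cdot> y) = r \<cdot> (w' \<cdot> y)" by (rule cmp_eq_cmp[OF fillsD(13)[OF c']]) simp_all
    then have e': "f' \<cdot> (u \<cdot> x) = r \<cdot> (w' \<cdot> y)" unfolding ux .
    then have d': "fills s f' r g (u \<cdot> x) (w' \<cdot> y)" by - (rule fillsI, simp_all)
    have "(f \<oplus> f') \<cdot> (u \<cdot> x) = f \<cdot> (u \<cdot> x) \<oplus> f' \<cdot> (u \<cdot> x)" by (rule cmp_add) simp_all
    also have "\<dots> = r \<cdot> (w \<cdot> x) \<oplus> r \<cdot> (w' \<cdot> y)" using fillsD(13)[OF d] e' by simp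
    also have "\<dots> = r \<cdot> (w \<cdot> x \<oplus> w' \<cdot> y)" by (rule add_cmp[symmetric]) simp_all
    finally have d'': "fills s (f \<oplus> f') r g (u \<cdot> x) (w \<cdot> x \<oplus> w' \<cdot> y)"
      by - (rule fillsI, simp_all)
    have "g \<cdot> (w \<cdot> x \<oplus> w' \<cdot> y) = g \<cdot> (w \<cdot> x) \<oplus> g \<cdot> (w' \<cdot> y)" by (rule add_cmp) simp_all
    then show "b \<star> (a \<uplus> a') = b \<star> a \<uplus> b \<star> a'"
      unfolding a b by (simp add: add_Q cmp_Q[OF d] cmp_Q[OF d'] cmp_Q[OF d''])
  qed
qed

sublocale Q: preadd Q
  by unfold_locales (rule preadditive_Q)

lemma F_zero:
  assumes [simp]: "x \<in> ob T" "y \<in> ob T"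
  shows "F (zero T x y) = zero Q (F x) (F y)"
proof -
  have "F (zero T x y) = F (zero T x y \<oplus> zero T x y)" by simp
  also have "\<dots> = F (zero T x y) \<uplus> F (zero T x y)" by (rule F_add) simp_all
  finally have "F (zero T x y) = zero Q (src Q (F (zero T x y))) (tgt Q (F (zero T x y)))"
    by - (rule Q.zero_of_idem, simp_all)
  then show ?thesis by simp
qed

lemma F_neg:
  assumes [simp]: "f \<in> mor T"
  shows "F (neg T f) = neg Q (F f)"
proof (rule Q.neg_eqI[symmetric])
  have "F f \<uplus> F (neg T f) = F (f \<oplus> neg T f)" by (rule F_add[symmetric]) simp_all
  then show "F f \<uplus> F (neg T f) = zero Q (src Q (F f)) (tgt Q (F f))"
    by (simp add: add_neg F_zero)
qed simp_all

lemma zero_object_F: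
  assumes "zero_object T z"
  shows "zero_object Q (F z)"
proof (rule Q.zero_objectI)
  have z: "z \<in> ob T" using assms by simp
  then have "z = zero T z z" using to_zero_object[OF assms, of z] by simp
  then have "F z = F (zero T z z)" by (rule arg_cong)
  then show "F z = zero Q (F z) (F z)" using z by (simp only: F_zero)
qed (use assms in simp)

lemma biproduct_F:
  assumes b: "biproduct T x y b i j p q" and x [simp]: "x \<in> ob T" "y \<in> ob T"
  shows "biproduct Q (F x) (F y) (F b) (F i) (F j) (F p) (F q)"
proof -
  have ty [simp]: "b \<in> ob T" "i \<in> mor T" "src T i = x" "tgt T i = b"
    "j \<in> mor T" "src T j = y" "tgt T j = b" "p \<in> mor T" "src T p = b" "tgt T p = x"
    "q \<in> mor T" "src T q = b" "tgt T q = y"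
    and eq: "p \<cdot> i = x" "q \<cdot> j = y" "p \<cdot> j = zero T y x" "q \<cdot> i = zero T x y"
    "i \<cdot> p \<oplus> j \<cdot> q = b"
    using b unfolding biproduct_def hom_def by blast+
  have "F p \<star> F i = F x" "F q \<star> F j = F y" "F p \<star> F j = zero Q (F y) (F x)"
    "F q \<star> F i = zero Q (F x) (F y)"
    using eq by (simp_all add: F_zero flip: F_cmp)
  moreover have "F i \<star> F p \<uplus> F j \<star> F q = F b"
    using eq(5) by (simp flip: F_cmp F_add)
  ultimately show ?thesis unfolding biproduct_def hom_def by simp
qed

lemma shift_cong:
  assumes "K s f = K s' f'" and [simp]: "s \<in> W" "f \<in> mor T" "src T f = src T s"
    "s' \<in> W" "f' \<in> mor T" "src T f' = src T s'"
  shows "K (shift T s) (shift T f) = K (shift T s') (shift T f')"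
proof -
  obtain u v where uv: "u \<in> W" "v \<in> W" "src T u = src T v" "tgt T u = src T s" "tgt T v = src T s'"
    "s \<cdot> u = s' \<cdot> v" "f \<cdot> u = f' \<cdot> v" by (rule K_eqE[OF assms(1)]) simp_all
  note [simp] = uv(1-5)
  show ?thesis
  proof (rule K_eqI[where u = "shift T u" and v = "shift T v"])
    have "shift T (s \<cdot> u) = shift T (s' \<cdot> v)" "shift T (f \<cdot> u) = shift T (f' \<cdot> v)"
      by (simp_all only: uv)
    then show "shift T s \<cdot> shift T u = shift T s' \<cdot> shift T v"
      "shift T f \<cdot> shift T u = shift T f' \<cdot> shift T v" by simp_all
  qed simp_all
qed

lemma elts_Shift_Q: "elts (Shift Q) =
    {opair (K s f) (K (shift T s) (shift T f)) | s f. s \<in> W \<and> f \<in> mor T \<and> src T f = src T s}"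
  and function_Shift_Q: "is_function (Shift Q) (Mor Q) (Mor Q)"
  and shift_Q [simp]: "s \<in> W \<Longrightarrow> f \<in> mor T \<Longrightarrow> src T f = src T s \<Longrightarrow>
    shift Q (K s f) = K (shift T s) (shift T f)"
proof -
  have X: "Shift Q =
      mkset {opair (K s f) (K (shift T s) (shift T f)) | s f. s \<in> W \<and> f \<in> mor T \<and> src T f = src T s}"
    unfolding Q_defs shift_cat.simps roof_iff ..
  have mor: "K (shift T s) (shift T f) \<in> elts (Mor Q)"
    if "s \<in> W" "f \<in> mor T" "src T f = src T s" for s f using that by simp
  have cong: "K (shift T s') (shift T f') = K (shift T s) (shift T f)"
    if "K s f = K s' f'" "s \<in> W" "s' \<in> W" "f \<in> mor T" "f' \<in> mor T" "src T f = src T s"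
      "src T f' = src T s'" for s f s' f'
    using shift_cong[OF that(1,2,4,6,3,5,7)] by (rule sym)
  note g = graph_Q[OF X mor cong]
  show "elts (Shift Q) =
      {opair (K s f) (K (shift T s) (shift T f)) | s f. s \<in> W \<and> f \<in> mor T \<and> src T f = src T s}"
    "is_function (Shift Q) (Mor Q) (Mor Q)" by (rule g(1,2); assumption)+
  show "s \<in> W \<Longrightarrow> f \<in> mor T \<Longrightarrow> src T f = src T s \<Longrightarrow> shift Q (K s f) = K (shift T s) (shift T f)"
    unfolding shift_def[of Q] by (rule g(3))
qed

lemma shift_F [simp]: "f \<in> mor T \<Longrightarrow> shift Q (F f) = F (shift T f)"
  by (simp add: F_def)

lemma functor_shift_Q: "is_functor Q Q (Shift Q)"
  unfolding is_functor_def
proof (intro conjI)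
  show "category Q" "category Q" "is_function (Shift Q) (Mor Q) (Mor Q)"
    by (rule category_Q function_Shift_Q)+
  show "\<forall>f\<in>mor Q. app (Shift Q) (src Q f) = src Q (app (Shift Q) f) \<and>
    app (Shift Q) (tgt Q f) = tgt Q (app (Shift Q) f)"
    unfolding shift_def[symmetric] by (auto elim!: mor_QE)
  show "\<forall>f\<in>mor Q. \<forall>g\<in>mor Q. src Q g = tgt Q f \<longrightarrow>
    app (Shift Q) (g \<star> f) = app (Shift Q) g \<star> app (Shift Q) f"
    unfolding shift_def[symmetric]
  proof (intro ballI impI)
    fix a b assume "a \<in> mor Q" "b \<in> mor Q" and eq: "src Q b = tgt Q a"
    obtain s f where s: "s \<in> W" "f \<in> mor T" "src T f = src T s" "a = K s f"
      using \<open>a \<in> mor Q\<close> by (rule mor_QE)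
    obtain r g where r: "r \<in> W" "g \<in> mor T" "src T g = src T r" "b = K r g"
      using \<open>b \<in> mor Q\<close> by (rule mor_QE)
    have "tgt T r = tgt T f" by (rule F_inj) (use s r eq in simp_all)
    with s(1-3) r(1-3) obtain u w where c: "fills s f r g u w" by (rule ex_fills)
    note [simp] = fillsD(1-12)[OF c]
    have "shift T (f \<cdot> u) = shift T (r \<cdot> w)" by (simp only: fillsD(13)[OF c])
    then have c': "fills (shift T s) (shift T f) (shift T r) (shift T g) (shift T u) (shift T w)"
      by - (rule fillsI, simp_all)
    show "shift Q (b \<star> a) = shift Q b \<star> shift Q a"
      unfolding s(4) r(4) cmp_Q[OF c] by (simp add: cmp_Q[OF c'])
  qed
qed

lemma additive_shift_Q: "is_additive Q Q (Shift Q)"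
  unfolding is_additive_def shift_def[symmetric]
proof (intro ballI impI, elim conjE)
  fix a b assume ab: "a \<in> mor Q" "b \<in> mor Q" and eq: "src Q a = src Q b" "tgt Q a = tgt Q b"
  obtain s f g where [simp]: "s \<in> W" "f \<in> mor T" "src T f = src T s" "g \<in> mor T" "src T g = src T s"
    and e: "a = K s f" "b = K s g" using ab eq(1) by (rule common_denominator)
  have [simp]: "tgt T f = tgt T g" by (rule F_inj) (use e eq in simp_all)
  show "shift Q (a \<uplus> b) = shift Q a \<uplus> shift Q b" by (simp add: e add_Q)
qed

lemma bij_shift_Q: "bij_betw (shift Q) (mor Q) (mor Q)"
proof (rule bij_betw_imageI)
  show "inj_on (shift Q) (mor Q)"
  proof (rule inj_onI)
    fix a b assume ab: "a \<in> mor Q" "b \<in> mor Q" and eq: "shift Q a = shift Q b"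
    obtain s f where [simp]: "s \<in> W" "f \<in> mor T" "src T f = src T s" and a: "a = K s f"
      using ab(1) by (rule mor_QE)
    obtain r g where [simp]: "r \<in> W" "g \<in> mor T" "src T g = src T r" and b: "b = K r g"
      using ab(2) by (rule mor_QE)
    have "K (shift T s) (shift T f) = K (shift T r) (shift T g)" using eq a b by simp
    then obtain u v where uv: "u \<in> W" "v \<in> W" "src T u = src T v" "tgt T u = src T (shift T s)"
      "tgt T v = src T (shift T r)" "shift T s \<cdot> u = shift T r \<cdot> v" "shift T f \<cdot> u = shift T g \<cdot> v"
      by (rule K_eqE) simp_all
    note [simp] = uv(1-5)
    have W [simp]: "unshift u \<in> W" "unshift v \<in> W" using W_shift[of "unshift u"] W_shift[of "unshift v"] by simp_all
    have "s \<cdot> unshift u = r \<cdot> unshift v" by (rule shift_inj) (simp_all add: uv(6))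
    moreover have "f \<cdot> unshift u = g \<cdot> unshift v" by (rule shift_inj) (simp_all add: uv(7))
    ultimately show "a = b" unfolding a b
      by - (rule K_eqI[where u = "unshift u" and v = "unshift v"], simp_all)
  qed
  show "shift Q ` mor Q = mor Q"
  proof (intro equalityI subsetI)
    fix b assume "b \<in> shift Q ` mor Q"
    then show "b \<in> mor Q" by (auto elim!: mor_QE)
  next
    fix b assume "b \<in> mor Q"
    then obtain s f where [simp]: "s \<in> W" "f \<in> mor T" "src T f = src T s" and b: "b = K s f"
      by (rule mor_QE)
    have [simp]: "unshift s \<in> W" using W_shift[of "unshift s"] by simp
    have "b = shift Q (K (unshift s) (unshift f))" by (simp add: b)
    then show "b \<in> shift Q ` mor Q" by (rule image_eqI) simp
  qed
qed

sublocale Q: shift_preadd Q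
  by unfold_locales (rule functor_shift_Q additive_shift_Q bij_shift_Q)+

end

section \<open>Triangles of the quotient\<close>

context shift_preadd
begin

lemma triangle_iso_refl:
  assumes "triangle C f g h"
  shows "triangle_iso C f g h f g h"
proof -
  note [simp] = triangleD[OF assms]
  have "triangle_mor C f g h f g h (src C f) (src C g) (src C h)"
    by (rule triangle_morI) simp_all
  moreover have "iso C (src C f)" "iso C (src C g)" "iso C (src C h)" by (simp_all add: iso_ob)
  ultimately show ?thesis unfolding triangle_iso_def by blast
qed

lemma triangle_mor_rotate:
  assumes t: "triangle C f g h" "triangle C f' g' h'"
    and m: "triangle_mor C f g h f' g' h' a b c"
  shows "triangle_mor C g h (neg C (shift C f)) g' h' (neg C (shift C f')) b c (shift C a)"
proof -
  note [simp] = triangleD[OF t(1)] triangleD[OF t(2)] triangle_morD(1-9)[OF m]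
  have "shift C (b \<cdot> f) = shift C (f' \<cdot> a)" by (simp only: triangle_morD(10)[OF m])
  then have "shift C b \<cdot> shift C f = shift C f' \<cdot> shift C a" by simp
  then show ?thesis
    using triangle_morD(11,12)[OF m] by - (rule triangle_morI, simp_all)
qed

text \<open>In the last square of the rotated triangles the signs cancel, and injectivity of the
  shift turns what remains into the missing first square.\<close>

lemma triangle_mor_unrotate:
  assumes t: "triangle C f g h" "triangle C f' g' h'"
    and m: "triangle_mor C g h (neg C (shift C f)) g' h' (neg C (shift C f')) b c d"
  shows "triangle_mor C f g h f' g' h' (unshift d) b c"
proof -
  note T [simp] = triangleD[OF t(1)] triangleD[OF t(2)]
  have [simp]: "b \<in> mor C" "src C b = tgt C f" "tgt C b = tgt C f'"
    "c \<in> mor C" "src C c = tgt C g" "tgt C c = tgt C g'"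
    "d \<in> mor C" "src C d = shift C (src C f)" "tgt C d = shift C (src C f')"
    using triangle_morD(1-9)[OF m] by simp_all
  have "shift C b \<cdot> neg C (shift C f) = neg C (shift C f') \<cdot> d" by (rule triangle_morD(12)[OF m])
  then have "neg C (shift C (b \<cdot> f)) = neg C (shift C (f' \<cdot> unshift d))" by simp
  then have "shift C (b \<cdot> f) = shift C (f' \<cdot> unshift d)"
    by (rule neg_inject[rotated 2]) simp_all
  then have "b \<cdot> f = f' \<cdot> unshift d" by (rule shift_inj) simp_all
  then show ?thesis
    using triangle_morD(10,11)[OF m] by - (rule triangle_morI, simp_all)
qed

end

context verdier
begin

text \<open>The triangles of the quotient are defined in terms of \<open>quotient_shift_cat\<close>,
  before the component \<open>Tri\<close> exists. Neither notion looks at that component, so both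
  may be read in the finished quotient.\<close>

lemma triangle_quotient_shift_cat:
  "triangle (quotient_shift_cat T D) = triangle Q"
  "triangle_iso (quotient_shift_cat T D) = triangle_iso Q"
proof -
  have eqs: "mor (quotient_shift_cat T D) = mor Q" "src (quotient_shift_cat T D) = src Q"
    "tgt (quotient_shift_cat T D) = tgt Q" "cmp (quotient_shift_cat T D) = cmp Q"
    "shift (quotient_shift_cat T D) = shift Q"
    by (simp_all add: fun_eq_iff mor_def src_def tgt_def cmp_def shift_def verdier_quotient_def
        Let_def shift_cat.extend_def)
  show "triangle (quotient_shift_cat T D) = triangle Q"
    by (intro ext) (simp only: triangle_def eqs)
  show "triangle_iso (quotient_shift_cat T D) = triangle_iso Q"
    by (intro ext) (simp only: triangle_iso_def triangle_mor_def hom_def iso_def eqs)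
qed

lemma dist_Q_iff:
  "dist Q a b c \<longleftrightarrow> triangle Q a b c \<and>
     (\<exists>f g h. dist T f g h \<and> triangle_iso Q (F f) (F g) (F h) a b c)"
  and relation3_Tri_Q: "is_relation3 (Tri Q) (Mor Q)"
proof -
  let ?A = "{triple a b c | a b c. triangle Q a b c \<and>
     (\<exists>f g h. dist T f g h \<and> triangle_iso Q (F f) (F g) (F h) a b c)}"
  have sub: "?A \<subseteq> triples (elts (Mor Q))"
  proof
    fix z assume "z \<in> ?A"
    then obtain a b c where z: "z = triple a b c" and t: "triangle Q a b c" by blast
    show "z \<in> triples (elts (Mor Q))"
      unfolding z in_triples using Q.triangleD(1-3)[OF t] by (simp add: mor_def)
  qed
  have "Tri Q = mkset ?A"
    unfolding triangle_quotient_shift_cat[symmetric] F_def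
    by (simp add: verdier_quotient_def Let_def shift_cat.extend_def tri_cat.defs)
  then have A: "elts (Tri Q) = ?A" "\<not> atom (Tri Q)" using sub_triples_Q[OF sub] by simp_all
  show "is_relation3 (Tri Q) (Mor Q)" unfolding is_relation3_def A(1) using A(2) sub by blast
  show "dist Q a b c \<longleftrightarrow> triangle Q a b c \<and>
     (\<exists>f g h. dist T f g h \<and> triangle_iso Q (F f) (F g) (F h) a b c)"
    unfolding dist_def[of Q] A(1) mem_Collect_eq triple_iff by blast
qed

lemma triangle_F:
  assumes "dist T f g h"
  shows "triangle Q (F f) (F g) (F h)"
  using distD[OF assms] by - (rule Q.triangleI, simp_all)

lemma dist_F: "dist T f g h \<Longrightarrow> dist Q (F f) (F g) (F h)"
  unfolding dist_Q_iff using triangle_F Q.triangle_iso_refl by blast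

lemma dist_QE:
  assumes "dist Q a b c"
  obtains f g h i j k where "dist T f g h" "iso Q i" "iso Q j" "iso Q k"
    "triangle_mor Q (F f) (F g) (F h) a b c i j k"
  using assms unfolding dist_Q_iff triangle_iso_def by blast

lemma triangle_mor_F:
  assumes t: "dist T f g h" "dist T f' g' h'" and m: "triangle_mor T f g h f' g' h' a b c"
  shows "triangle_mor Q (F f) (F g) (F h) (F f') (F g') (F h') (F a) (F b) (F c)"
proof -
  note [simp] = distD[OF t(1)] distD[OF t(2)] triangle_morD(1-9)[OF m]
  have "F (b \<cdot> f) = F (f' \<cdot> a)" "F (c \<cdot> g) = F (g' \<cdot> b)" "F (shift T a \<cdot> h) = F (h' \<cdot> c)"
    by (simp_all only: triangle_morD(10-12)[OF m])
  then have "F b \<star> F f = F f' \<star> F a" "F c \<star> F g = F g' \<star> F b" "F (shift T a) \<star> F h = F h' \<star> F c"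
    by (simp_all add: F_cmp)
  then show ?thesis by - (rule Q.triangle_morI, simp_all)
qed

text \<open>The equation s u = s v does not imply u = v, so the two witnesses are first equalised by
  a morphism of W.\<close>

lemma K_eq_same:
  assumes "K s f = K s g" and [simp]: "s \<in> W" "f \<in> mor T" "src T f = src T s" "g \<in> mor T" "src T g = src T s"
  obtains u where "u \<in> W" "tgt T u = src T s" "f \<cdot> u = g \<cdot> u" "tgt T f = tgt T g"
proof -
  obtain u v where uv: "u \<in> W" "v \<in> W" "src T u = src T v" "tgt T u = src T s" "tgt T v = src T s"
    "s \<cdot> u = s \<cdot> v" "f \<cdot> u = g \<cdot> v" "tgt T g = tgt T f" by (rule K_eqE[OF assms(1)]) simp_all
  note [simp] = uv(1-5,8)
  obtain d where d [simp]: "d \<in> W" "tgt T d = src T v" and ud: "u \<cdot> d = v \<cdot> d"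
    by (rule W_equalize[OF _ _ _ _ _ _ uv(6)]) simp_all
  have "f \<cdot> (u \<cdot> d) = g \<cdot> (v \<cdot> d)" by (rule cmp_eq_cmp[OF uv(7)]) simp_all
  then have "f \<cdot> (u \<cdot> d) = g \<cdot> (u \<cdot> d)" by (simp only: ud)
  then show ?thesis by - (rule that[of "u \<cdot> d"], simp_all)
qed

text \<open>A square of the quotient with two opposite sides f and f' from T is spread out into two
  commutative squares of T over one new morphism p: the denominators map p to f, the numerators map
  p to f'. Commutativity in the quotient yields the second square only after one more refinement, by
  v.\<close>

lemma square_Q:
  assumes f [simp]: "f \<in> mor T" "f' \<in> mor T"
    and \<alpha>: "\<alpha> \<in> mor Q" "src Q \<alpha> = F (src T f)" "tgt Q \<alpha> = F (src T f')"
    and \<beta>: "\<beta> \<in> mor Q" "src Q \<beta> = F (tgt T f)" "tgt Q \<beta> = F (tgt T f')"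
    and eq: "\<beta> \<star> F f = F f' \<star> \<alpha>"
  obtains s a r b p where "s \<in> W" "a \<in> mor T" "r \<in> W" "b \<in> mor T" "p \<in> mor T"
    "src T s = src T p" "tgt T s = src T f" "src T a = src T p" "tgt T a = src T f'"
    "src T r = tgt T p" "tgt T r = tgt T f" "src T b = tgt T p" "tgt T b = tgt T f'"
    "\<alpha> = K s a" "\<beta> = K r b" "r \<cdot> p = f \<cdot> s" "b \<cdot> p = f' \<cdot> a"
proof -
  obtain s a where s [simp]: "s \<in> W" "a \<in> mor T" "src T a = src T s" and \<alpha>s: "\<alpha> = K s a"
    using \<alpha>(1) by (rule mor_QE)
  obtain r b where r [simp]: "r \<in> W" "b \<in> mor T" "src T b = src T r" and \<beta>r: "\<beta> = K r b"
    using \<beta>(1) by (rule mor_QE)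
  have [simp]: "tgt T s = src T f" by (rule F_inj) (use \<alpha> \<alpha>s in simp_all)
  have [simp]: "tgt T a = src T f'" by (rule F_inj) (use \<alpha> \<alpha>s in simp_all)
  have [simp]: "tgt T r = tgt T f" by (rule F_inj) (use \<beta> \<beta>r in simp_all)
  have [simp]: "tgt T b = tgt T f'" by (rule F_inj) (use \<beta> \<beta>r in simp_all)
  obtain u p where u [simp]: "u \<in> W" "p \<in> mor T" "src T u = src T p" "tgt T u = src T s"
    "tgt T p = src T r" and fsu: "(f \<cdot> s) \<cdot> u = r \<cdot> p"
    by (rule W_ore[of "f \<cdot> s" r]) simp_all
  have fsu': "(f \<cdot> s) \<cdot> u = f \<cdot> (s \<cdot> u)" by (rule cmp_assoc) simp_all
  have fau: "(f' \<cdot> a) \<cdot> u = f' \<cdot> (a \<cdot> u)" by (rule cmp_assoc) simp_all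
  have 1: "fills (src T f) f r b (s \<cdot> u) p" by (rule fillsI) (use fsu fsu' in simp_all)
  have 2: "fills s a (src T f') f' (src T s) a" by (rule fillsI) simp_all
  have "K (s \<cdot> u) (b \<cdot> p) = \<beta> \<star> F f" using cmp_Q[OF 1] by (simp add: \<beta>r F_def)
  also have "\<dots> = F f' \<star> \<alpha>" by (rule eq)
  also have "\<dots> = K s (f' \<cdot> a)" using cmp_Q[OF 2] by (simp add: \<alpha>s F_def)
  also have "\<dots> = K (s \<cdot> u) ((f' \<cdot> a) \<cdot> u)" by (rule K_refine[symmetric]) simp_all
  finally have "K (s \<cdot> u) (b \<cdot> p) = K (s \<cdot> u) (f' \<cdot> (a \<cdot> u))" unfolding fau .
  then obtain v where v: "v \<in> W" "tgt T v = src T (s \<cdot> u)"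
    and v2: "(b \<cdot> p) \<cdot> v = (f' \<cdot> (a \<cdot> u)) \<cdot> v" by (rule K_eq_same) simp_all
  define s' a' where "s' = s \<cdot> u" and "a' = a \<cdot> u"
  have s' [simp]: "s' \<in> W" "a' \<in> mor T" "src T s' = src T p" "src T a' = src T p"
    "tgt T s' = src T f" "tgt T a' = src T f'"
    by (simp_all add: s'_def a'_def)
  have v' [simp]: "v \<in> W" "tgt T v = src T p" using v by simp_all
  have \<alpha>s': "\<alpha> = K s' a'" unfolding \<alpha>s s'_def a'_def by (rule K_refine[symmetric]) simp_all
  have rp: "r \<cdot> p = f \<cdot> s'" unfolding s'_def using fsu fsu' by simp
  have v2': "(b \<cdot> p) \<cdot> v = (f' \<cdot> a') \<cdot> v" using v2 unfolding a'_def .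
  show ?thesis
  proof (rule that[of "s' \<cdot> v" "a' \<cdot> v" r b "p \<cdot> v"])
    show "\<alpha> = K (s' \<cdot> v) (a' \<cdot> v)" unfolding \<alpha>s' by (rule K_refine[symmetric]) simp_all
    show "r \<cdot> (p \<cdot> v) = f \<cdot> (s' \<cdot> v)" by (rule cmp_eq_cmp[OF rp]) simp_all
    have "b \<cdot> (p \<cdot> v) = (b \<cdot> p) \<cdot> v" by (rule cmp_assoc[symmetric]) simp_all
    also note v2'
    also have "(f' \<cdot> a') \<cdot> v = f' \<cdot> (a' \<cdot> v)" by (rule cmp_assoc) simp_all
    finally show "b \<cdot> (p \<cdot> v) = f' \<cdot> (a' \<cdot> v)" .
  qed (simp_all add: \<beta>r)
qed

text \<open>The denominators extend to a morphism of triangles with all legs in W, from a triangle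
  on p to that on f, and this becomes invertible in the quotient. The numerators extend by TR3 in T.
  The composite of the inverse with the latter is the desired morphism.\<close>

lemma complete_F:
  assumes t: "dist T f g h" "dist T f' g' h'"
    and \<alpha>: "\<alpha> \<in> mor Q" "src Q \<alpha> = F (src T f)" "tgt Q \<alpha> = F (src T f')"
    and \<beta>: "\<beta> \<in> mor Q" "src Q \<beta> = F (tgt T f)" "tgt Q \<beta> = F (tgt T f')"
    and eq: "\<beta> \<star> F f = F f' \<star> \<alpha>"
  shows "\<exists>\<gamma>. triangle_mor Q (F f) (F g) (F h) (F f') (F g') (F h') \<alpha> \<beta> \<gamma>"
proof -
  obtain s a r b p where s: "s \<in> W" "a \<in> mor T" "r \<in> W" "b \<in> mor T" "p \<in> mor T"
    "src T s = src T p" "tgt T s = src T f" "src T a = src T p" "tgt T a = src T f'"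
    "src T r = tgt T p" "tgt T r = tgt T f" "src T b = tgt T p" "tgt T b = tgt T f'"
    and ab: "\<alpha> = K s a" "\<beta> = K r b" and sq: "r \<cdot> p = f \<cdot> s" "b \<cdot> p = f' \<cdot> a"
    using distD(1)[OF t(1)] distD(1)[OF t(2)] \<alpha> \<beta> eq by (rule square_Q)
  obtain p1 p2 where p: "dist T p p1 p2" using ex_dist s(5) by blast
  obtain c where c: "c \<in> W" and mc: "triangle_mor T p p1 p2 f g h s r c"
    using p t(1) s(1,3) s(6,7,10,11) sq(1) by (rule W_complete)
  have "a \<in> hom T (src T p) (src T f')" "b \<in> hom T (tgt T p) (tgt T f')"
    using s by (simp_all add: hom_def)
  then obtain d where md: "triangle_mor T p p1 p2 f' g' h' a b d"
    using complete_ax p t(2) sq(2) by blast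
  have inv: "K x (src T x) \<in> mor Q" "src Q (K x (src T x)) = tgt Q (F x)"
      "tgt Q (K x (src T x)) = src Q (F x)" "K x (src T x) \<star> F x = src Q (F x)"
      "F x \<star> K x (src T x) = tgt Q (F x)" if "x \<in> W" for x
    using that by (simp_all add: K_cmp_F F_cmp_K)
  have mc': "triangle_mor Q (F f) (F g) (F h) (F p) (F p1) (F p2)
      (K s (src T s)) (K r (src T r)) (K c (src T c))"
    by (rule Q.triangle_mor_inverse[OF triangle_F[OF p] triangle_F[OF t(1)] triangle_mor_F[OF p t(1) mc]
        inv[OF s(1)] inv[OF s(3)] inv[OF c]])
  have "triangle_mor Q (F f) (F g) (F h) (F f') (F g') (F h')
      (F a \<star> K s (src T s)) (F b \<star> K r (src T r)) (F d \<star> K c (src T c))"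
    by (rule Q.triangle_mor_cmp[OF triangle_F[OF t(1)] triangle_F[OF p] triangle_F[OF t(2)]
          mc' triangle_mor_F[OF p t(2) md]])
  moreover have "F a \<star> K s (src T s) = \<alpha>"
    unfolding ab by (rule K_decompose[symmetric]) (use s in simp_all)
  moreover have "F b \<star> K r (src T r) = \<beta>"
    unfolding ab by (rule K_decompose[symmetric]) (use s in simp_all)
  ultimately show ?thesis by auto
qed

lemma complete_Q:
  assumes d: "dist Q a b c" "dist Q a' b' c'"
    and \<alpha>: "\<alpha> \<in> hom Q (src Q a) (src Q a')" and \<beta>: "\<beta> \<in> hom Q (tgt Q a) (tgt Q a')"
    and eq: "\<beta> \<star> a = a' \<star> \<alpha>"
  shows "\<exists>\<gamma>. triangle_mor Q a b c a' b' c' \<alpha> \<beta> \<gamma>"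
proof -
  have t: "triangle Q a b c" "triangle Q a' b' c'" using d dist_Q_iff by blast+
  obtain f g h i j k where f: "dist T f g h" and iso: "iso Q i" "iso Q j" "iso Q k"
    and m: "triangle_mor Q (F f) (F g) (F h) a b c i j k" using d(1) by (rule dist_QE)
  obtain f' g' h' i' j' k' where f': "dist T f' g' h'" and iso': "iso Q i'" "iso Q j'" "iso Q k'"
    and m': "triangle_mor Q (F f') (F g') (F h') a' b' c' i' j' k'" using d(2) by (rule dist_QE)
  obtain i1 where i: "i1 \<in> mor Q" "src Q i1 = tgt Q i" "tgt Q i1 = src Q i"
    "i1 \<star> i = src Q i" "i \<star> i1 = tgt Q i" using iso(1) by (rule Q.isoE)
  obtain j1 where j: "j1 \<in> mor Q" "src Q j1 = tgt Q j" "tgt Q j1 = src Q j"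
    "j1 \<star> j = src Q j" "j \<star> j1 = tgt Q j" using iso(2) by (rule Q.isoE)
  obtain k1 where k: "k1 \<in> mor Q" "src Q k1 = tgt Q k" "tgt Q k1 = src Q k"
    "k1 \<star> k = src Q k" "k \<star> k1 = tgt Q k" using iso(3) by (rule Q.isoE)
  obtain i2 where i2: "i2 \<in> mor Q" "src Q i2 = tgt Q i'" "tgt Q i2 = src Q i'"
    "i2 \<star> i' = src Q i'" "i' \<star> i2 = tgt Q i'" using iso'(1) by (rule Q.isoE)
  obtain j2 where j2: "j2 \<in> mor Q" "src Q j2 = tgt Q j'" "tgt Q j2 = src Q j'"
    "j2 \<star> j' = src Q j'" "j' \<star> j2 = tgt Q j'" using iso'(2) by (rule Q.isoE)
  note tF = triangle_F[OF f] triangle_F[OF f']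
  note [simp] = Q.triangleD[OF t(1)] Q.triangleD[OF t(2)] distD[OF f] distD[OF f']
    Q.triangle_morD(1-9)[OF m] Q.triangle_morD(1-9)[OF m'] i j k(1-3) i2 j2
  have [simp]: "\<alpha> \<in> mor Q" "src Q \<alpha> = src Q a" "tgt Q \<alpha> = src Q a'"
    "\<beta> \<in> mor Q" "src Q \<beta> = tgt Q a" "tgt Q \<beta> = tgt Q a'"
    using \<alpha> \<beta> by (simp_all add: hom_def)
  \<comment> \<open>Conjugation of \<alpha> and \<beta> with the isomorphisms to triangles from T
    produces a square to which \<open>complete_F\<close> applies.\<close>
  have "j2 \<star> a' = F f' \<star> i2"
    by (rule Q.square_inverse[OF Q.triangle_morD(10)[OF m']]) simp_all
  then have j2a: "j2 \<star> (a' \<star> (\<alpha> \<star> i)) = F f' \<star> (i2 \<star> (\<alpha> \<star> i))"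
    by (rule Q.cmp_eq_cmp) simp_all
  have "(j2 \<star> (\<beta> \<star> j)) \<star> F f = j2 \<star> (\<beta> \<star> (j \<star> F f))" by simp
  also have "j \<star> F f = a \<star> i" by (rule Q.triangle_morD(10)[OF m])
  also have "\<beta> \<star> (a \<star> i) = a' \<star> (\<alpha> \<star> i)" by (rule Q.cmp_eq_cmp[OF eq]) simp_all
  also note j2a
  finally have sq: "(j2 \<star> (\<beta> \<star> j)) \<star> F f = F f' \<star> (i2 \<star> (\<alpha> \<star> i))" .
  have "\<exists>\<gamma>. triangle_mor Q (F f) (F g) (F h) (F f') (F g') (F h')
      (i2 \<star> (\<alpha> \<star> i)) (j2 \<star> (\<beta> \<star> j)) \<gamma>"
    by (rule complete_F[OF f f' _ _ _ _ _ _ sq]) simp_all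
  then obtain \<gamma> where \<gamma>: "triangle_mor Q (F f) (F g) (F h) (F f') (F g') (F h')
      (i2 \<star> (\<alpha> \<star> i)) (j2 \<star> (\<beta> \<star> j)) \<gamma>" by blast
  have "triangle_mor Q a b c (F f) (F g) (F h) i1 j1 k1"
    by (rule Q.triangle_mor_inverse[OF tF(1) t(1) m i j k])
  from Q.triangle_mor_cmp[OF t(1) tF(1,2) this \<gamma>]
  have "triangle_mor Q a b c (F f') (F g') (F h')
      ((i2 \<star> (\<alpha> \<star> i)) \<star> i1) ((j2 \<star> (\<beta> \<star> j)) \<star> j1) (\<gamma> \<star> k1)" .
  from Q.triangle_mor_cmp[OF t(1) tF(2) t(2) this m']
  have *: "triangle_mor Q a b c a' b' c' (i' \<star> ((i2 \<star> (\<alpha> \<star> i)) \<star> i1)) (j' \<star> ((j2 \<star> (\<beta> \<star> j)) \<star> j1))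
      (k' \<star> (\<gamma> \<star> k1))" .
  have "i' \<star> ((i2 \<star> (\<alpha> \<star> i)) \<star> i1) = i' \<star> (i2 \<star> \<alpha>)" by simp
  also have "\<dots> = (i' \<star> i2) \<star> \<alpha>" by (rule Q.cmp_assoc[symmetric]) simp_all
  finally have 1: "i' \<star> ((i2 \<star> (\<alpha> \<star> i)) \<star> i1) = \<alpha>" by simp
  have "j' \<star> ((j2 \<star> (\<beta> \<star> j)) \<star> j1) = j' \<star> (j2 \<star> \<beta>)" by simp
  also have "\<dots> = (j' \<star> j2) \<star> \<beta>" by (rule Q.cmp_assoc[symmetric]) simp_all
  finally have 2: "j' \<star> ((j2 \<star> (\<beta> \<star> j)) \<star> j1) = \<beta>" by simp
  show ?thesis using * unfolding 1 2 by blast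
qed

text \<open>The zero object z is arbitrary and need not be the image of a zero object of T. It is
  compared with such an image F w by zero morphisms, which are mutually inverse because the
  identities of zero objects vanish.\<close>

lemma dist_ident_Q:
  assumes x: "x \<in> ob Q" and z: "zero_object Q z"
  shows "dist Q x (zero Q x z) (zero Q z (shift Q x))"
proof -
  obtain x' where x' [simp]: "x' \<in> ob T" and xx: "x = F x'" using x by (rule ob_QE)
  obtain w where w: "zero_object T w" using ex_zero_object by blast
  note [simp] = zero_ob[OF w] Q.zero_ob[OF z] obD(1)[OF x']
  have d: "dist T x' (zero T x' w) (zero T w (shift T x'))" by (rule dist_ident[OF x' w])
  have t: "triangle Q x (zero Q x z) (zero Q z (shift Q x))"
    by (rule Q.triangleI) (simp_all add: xx)
  have ww: "zero Q (F w) (F w) = F w"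
    using Q.to_zero_object[OF zero_object_F[OF w], of "F w"] by simp
  have zz: "zero Q z z = z" using Q.to_zero_object[OF z, of z] by simp
  have c: "iso Q (zero Q (F w) z)"
    by (rule Q.isoI[of _ "zero Q z (F w)"]) (simp_all add: ww zz)
  have m: "triangle_mor Q (F x') (F (zero T x' w)) (F (zero T w (shift T x')))
      x (zero Q x z) (zero Q z (shift Q x)) (F x') (F x') (zero Q (F w) z)"
    by (rule Q.triangle_morI) (simp_all add: xx F_zero)
  have "iso Q (F x')" by (rule Q.iso_ob) simp
  then show ?thesis unfolding dist_Q_iff triangle_iso_def using t d c m by blast
qed

text \<open>For a = f/s the image of a triangle on f is transported along the isomorphism F s of the
  first vertex: the first morphism becomes a, and the last is composed with the shift of F
  s.\<close>

lemma ex_dist_Q: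
  assumes "a \<in> mor Q"
  shows "\<exists>b c. dist Q a b c"
proof -
  obtain s f where s [simp]: "s \<in> W" "f \<in> mor T" "src T f = src T s" and a: "a = K s f"
    using assms by (rule mor_QE)
  obtain g h where d: "dist T f g h" using ex_dist s(2) by blast
  note [simp] = distD[OF d]
  have t: "triangle Q a (F g) (shift Q (F s) \<star> F h)"
    by (rule Q.triangleI) (simp_all add: a)
  have m: "triangle_mor Q (F f) (F g) (F h) a (F g) (shift Q (F s) \<star> F h)
      (F s) (F (tgt T f)) (F (tgt T g))"
    by (rule Q.triangle_morI) (simp_all add: a K_cmp_F)
  have "iso Q (F s)" "iso Q (F (tgt T f))" "iso Q (F (tgt T g))"
    by (simp_all add: iso_F_W)
  then show ?thesis using t d m unfolding dist_Q_iff triangle_iso_def by blast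
qed

lemma rotate_Q:
  assumes t: "triangle Q a b c"
  shows "dist Q a b c \<longleftrightarrow> dist Q b c (neg Q (shift Q a))"
proof -
  note [simp] = Q.triangleD[OF t]
  have t': "triangle Q b c (neg Q (shift Q a))" by (rule Q.triangleI) simp_all
  show ?thesis
  proof
    assume "dist Q a b c"
    then obtain f g h i j k where f: "dist T f g h" and iso: "iso Q i" "iso Q j" "iso Q k"
      and m: "triangle_mor Q (F f) (F g) (F h) a b c i j k" by (rule dist_QE)
    note [simp] = distD[OF f]
    have "triangle_mor Q (F g) (F h) (F (neg T (shift T f))) b c (neg Q (shift Q a)) j k (shift Q i)"
      using Q.triangle_mor_rotate[OF triangle_F[OF f] t m] by (simp add: F_neg)
    then show "dist Q b c (neg Q (shift Q a))"
      unfolding dist_Q_iff triangle_iso_def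
      using t' rotate[OF f] iso(2,3) Q.iso_shift[OF iso(1)] by blast
  next
    assume "dist Q b c (neg Q (shift Q a))"
    then obtain f g h j k l where f: "dist T f g h" and iso: "iso Q j" "iso Q k" "iso Q l"
      and m: "triangle_mor Q (F f) (F g) (F h) b c (neg Q (shift Q a)) j k l" by (rule dist_QE)
    \<comment> \<open>The backward rotation is made in T: e is the morphism whose shift is
      -h.\<close>
    define e where "e = unshift (neg T h)"
    have d: "dist T e f g" unfolding e_def by (rule rotate_back[OF f])
    have e: "e \<in> mor T" using distD(1)[OF d] .
    have "neg T (shift T e) = h" unfolding e_def using distD(3)[OF f] by simp
    then have "F h = F (neg T (shift T e))" by simp
    also have "\<dots> = neg Q (shift Q (F e))" using e by (simp add: F_neg)
    finally have "F h = neg Q (shift Q (F e))" .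
    with m have "triangle_mor Q (F f) (F g) (neg Q (shift Q (F e))) b c (neg Q (shift Q a)) j k l"
      by simp
    then have "triangle_mor Q (F e) (F f) (F g) a b c (Q.unshift l) j k"
      by (rule Q.triangle_mor_unrotate[OF triangle_F[OF d] t])
    then show "dist Q a b c"
      unfolding dist_Q_iff triangle_iso_def
      using t d iso(1,2) Q.iso_unshift[OF iso(3)] by blast
  qed
qed

sublocale Q: pretri Q
proof unfold_locales
  obtain z where "zero_object T z" using ex_zero_object by blast
  then show "\<exists>z. zero_object Q z" using zero_object_F by blast
  show "\<forall>x\<in>ob Q. \<forall>y\<in>ob Q. \<exists>b i j p q. biproduct Q x y b i j p q"
  proof (intro ballI)
    fix x y assume "x \<in> ob Q" "y \<in> ob Q"
    then obtain x' y' where x: "x' \<in> ob T" "y' \<in> ob T" and xy: "x = F x'" "y = F y'"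
      by (metis ob_QE)
    obtain b i j p q where "biproduct T x' y' b i j p q" using ex_biproduct x by blast
    from biproduct_F[OF this x] show "\<exists>b i j p q. biproduct Q x y b i j p q" unfolding xy by blast
  qed
  show "is_relation3 (Tri Q) (Mor Q)" by (rule relation3_Tri_Q)
  show "\<forall>f g h. dist Q f g h \<longrightarrow> triangle Q f g h" using dist_Q_iff by blast
  show "\<forall>f g h f' g' h'. dist Q f g h \<and> triangle Q f' g' h' \<and> triangle_iso Q f g h f' g' h' \<longrightarrow>
      dist Q f' g' h'"
  proof (intro allI impI, elim conjE)
    fix a b c a' b' c' assume d: "dist Q a b c" and t': "triangle Q a' b' c'"
      and i: "triangle_iso Q a b c a' b' c'"
    obtain f g h where t: "triangle Q a b c" and f: "dist T f g h" "triangle_iso Q (F f) (F g) (F h) a b c"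
      using d dist_Q_iff by blast
    have "triangle_iso Q (F f) (F g) (F h) a' b' c'"
      by (rule Q.triangle_iso_trans[OF triangle_F[OF f(1)] t t' f(2) i])
    then show "dist Q a' b' c'" using t' f(1) dist_Q_iff by blast
  qed
  show "\<forall>x z. x \<in> ob Q \<and> zero_object Q z \<longrightarrow> dist Q x (zero Q x z) (zero Q z (shift Q x))"
    using dist_ident_Q by blast
  show "\<forall>f\<in>mor Q. \<exists>g h. dist Q f g h" using ex_dist_Q by blast
  show "\<forall>f g h. triangle Q f g h \<longrightarrow> (dist Q f g h \<longleftrightarrow> dist Q g h (neg Q (shift Q f)))"
    using rotate_Q by blast
  show "\<forall>f g h f' g' h' a b. dist Q f g h \<and> dist Q f' g' h' \<and>
        a \<in> hom Q (src Q f) (src Q f') \<and> b \<in> hom Q (tgt Q f) (tgt Q f') \<and> b \<star> f = f' \<star> a \<longrightarrow>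
        (\<exists>c. triangle_mor Q f g h f' g' h' a b c)"
    using complete_Q by blast
qed

end

lemma (in categ) cmp_inverse_cancel:
  assumes [simp]: "f \<in> mor C" "g \<in> mor C" "a \<in> mor C" "a' \<in> mor C" "src C g = tgt C f"
    "tgt C a' = src C f" "src C a' = tgt C a" "a' \<cdot> a = src C f"
  shows "(g \<cdot> (f \<cdot> a')) \<cdot> a = g \<cdot> f"
proof -
  have [simp]: "src C a = src C f" using src_tgt_cmp(1)[of a a'] by simp
  have "(g \<cdot> (f \<cdot> a')) \<cdot> a = g \<cdot> (f \<cdot> (a' \<cdot> a))" by (simp del: assms(8))
  then show ?thesis by simp
qed

section \<open>The octahedral axiom in the quotient; functors out of the quotient\<close>

context verdier
begin

text \<open>The five lemma in the quotient, stated for the image of a triangle of T because the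
  three cones of an octahedron are compared with such images.\<close>

lemma iso_dist_F:
  assumes d: "dist T f g h" and e: "dist Q a b c" and i: "iso Q i" "iso Q j"
    and ty: "src Q i = F (src T f)" "tgt Q i = src Q a" "src Q j = F (tgt T f)" "tgt Q j = tgt Q a"
    and sq: "j \<star> F f = a \<star> i"
  obtains k where "iso Q k" "triangle_mor Q (F f) (F g) (F h) a b c i j k"
  using distD[OF d]
  by - (rule Q.triangle_iso_complete[OF dist_F[OF d] e i _ _ _ _ sq], use ty in simp_all)

lemma triangle_mor_F_inverse:
  assumes t: "dist T f g h" "dist Q a b c" and m: "triangle_mor Q (F f) (F g) (F h) a b c i j k"
    and i: "i1 \<in> mor Q" "src Q i1 = tgt Q i" "tgt Q i1 = src Q i" "i1 \<star> i = src Q i" "i \<star> i1 = tgt Q i"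
    and j: "j1 \<in> mor Q" "src Q j1 = tgt Q j" "tgt Q j1 = src Q j" "j1 \<star> j = src Q j" "j \<star> j1 = tgt Q j"
    and k: "k1 \<in> mor Q" "src Q k1 = tgt Q k" "tgt Q k1 = src Q k" "k1 \<star> k = src Q k" "k \<star> k1 = tgt Q k"
  shows "triangle_mor Q a b c (F f) (F g) (F h) i1 j1 k1"
  using Q.triangle_mor_inverse[OF triangle_F[OF t(1)] _ m i j k] t(2) Q.dist_triangle by blast

lemma inverse_F_W:
  assumes "s \<in> W"
  shows "K s (src T s) \<in> mor Q" "src Q (K s (src T s)) = tgt Q (F s)"
    "tgt Q (K s (src T s)) = src Q (F s)" "K s (src T s) \<star> F s = src Q (F s)"
    "F s \<star> K s (src T s) = tgt Q (F s)"
  using assms by (simp_all add: K_cmp_F F_cmp_K)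

lemma inverse_F_ob:
  assumes "x \<in> ob T"
  shows "F x \<in> mor Q" "src Q (F x) = tgt Q (F x)" "tgt Q (F x) = src Q (F x)"
    "F x \<star> F x = src Q (F x)" "F x \<star> F x = tgt Q (F x)"
  using assms by simp_all

text \<open>Up to isomorphism a composable pair of the quotient comes from a composable pair of
  \<open>T\<close>, and so does its octahedron.\<close>

lemma octahedral_Q: "octahedral Q"
  unfolding octahedral_def
proof (intro allI impI, elim conjE)
  fix \<phi> \<phi>1 \<phi>2 \<psi> \<psi>1 \<psi>2 \<kappa>1 \<kappa>2
  assume comp: "src Q \<psi> = tgt Q \<phi>" and d\<phi>: "dist Q \<phi> \<phi>1 \<phi>2" and d\<psi>: "dist Q \<psi> \<psi>1 \<psi>2"
    and d\<kappa>: "dist Q (\<psi> \<star> \<phi>) \<kappa>1 \<kappa>2"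
  obtain s0 f where s0: "s0 \<in> W" "f \<in> mor T" "src T f = src T s0" and \<phi>0: "\<phi> = K s0 f"
    using Q.distD(1)[OF d\<phi>] by (rule mor_QE)
  obtain r g where r: "r \<in> W" "g \<in> mor T" "src T g = src T r" and \<psi>: "\<psi> = K r g"
    using Q.distD(1)[OF d\<psi>] by (rule mor_QE)
  have rf: "tgt T r = tgt T f" by (rule F_inj) (use s0 r comp \<phi>0 \<psi> in simp_all)
  obtain u w where c: "fills s0 f r g u w" using s0 r rf by (rule ex_fills)
  \<comment> \<open>After expansion \<phi> = (r w)/s and \<psi> = g/r. Up to the isomorphisms F s
    and F r the pair is (F w, F g), and w and g are composable in T.\<close>
  define s where "s = s0 \<cdot> u"
  have ty [simp]: "s \<in> W" "r \<in> W" "w \<in> mor T" "g \<in> mor T" "src T w = src T s" "tgt T w = src T r"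
    "src T g = src T r"
    using fillsD(1-12)[OF c] unfolding s_def by simp_all
  have \<phi>: "\<phi> = K s (r \<cdot> w)"
    unfolding \<phi>0 s_def fillsD(13)[OF c, symmetric]
    by (rule K_refine[symmetric]) (use fillsD(1-12)[OF c] in simp_all)
  have rw [simp]: "r \<cdot> w \<in> mor T" "src T (r \<cdot> w) = src T s" "tgt T (r \<cdot> w) = tgt T r" by simp_all
  have gw [simp]: "g \<cdot> w \<in> mor T" "src T (g \<cdot> w) = src T s" "tgt T (g \<cdot> w) = tgt T g" by simp_all
  have Q\<phi> [simp]: "src Q \<phi> = F (tgt T s)" "tgt Q \<phi> = F (tgt T r)" "\<phi> \<in> mor Q"
    unfolding \<phi> by (simp_all del: cmp_assoc)
  have Q\<psi> [simp]: "src Q \<psi> = F (tgt T r)" "tgt Q \<psi> = F (tgt T g)" "\<psi> \<in> mor Q"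
    unfolding \<psi> by simp_all
  have \<phi>s: "\<phi> \<star> F s = F r \<star> F w"
    unfolding \<phi> by (simp add: K_cmp_F flip: F_cmp)
  have \<psi>r: "\<psi> \<star> F r = F g"
    unfolding \<psi> by (simp add: K_cmp_F)
  have "(\<psi> \<star> \<phi>) \<star> F s = \<psi> \<star> (\<phi> \<star> F s)" by (rule Q.cmp_assoc) simp_all
  also have "\<dots> = \<psi> \<star> (F r \<star> F w)" by (simp only: \<phi>s)
  also have "\<dots> = (\<psi> \<star> F r) \<star> F w" by (rule Q.cmp_assoc[symmetric]) simp_all
  also have "\<dots> = F (g \<cdot> w)" unfolding \<psi>r by (rule F_cmp[symmetric]) simp_all
  finally have \<psi>\<phi>s: "(\<psi> \<star> \<phi>) \<star> F s = F (g \<cdot> w)" .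
  obtain w1 w2 where dw: "dist T w w1 w2" using ex_dist ty(3) by blast
  obtain g1 g2 where dg: "dist T g g1 g2" using ex_dist ty(4) by blast
  obtain k1 k2 where dk: "dist T (g \<cdot> w) k1 k2" using ex_dist gw(1) by blast
  have "src T g = tgt T w" by simp
  then obtain U V where UV: "dist T U V (cmp T (shift T w1) g2)"
    and mU: "triangle_mor T w w1 w2 (g \<cdot> w) k1 k2 (src T w) g U"
    and mV: "triangle_mor T (g \<cdot> w) k1 k2 g g1 g2 w (tgt T g) V"
    using dw dg dk by (rule octahedron)
  \<comment> \<open>The cones of \<phi>, \<psi> and their composite are arbitrary, so only the five
    lemma relates them to the cones of w, g and g w: by A, B and C respectively.\<close>
  obtain A where A: "iso Q A" and mA: "triangle_mor Q (F w) (F w1) (F w2) \<phi> \<phi>1 \<phi>2 (F s) (F r) A"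
    by (rule iso_dist_F[OF dw d\<phi> iso_F_W[OF ty(1)] iso_F_W[OF ty(2)] _ _ _ _ \<phi>s[symmetric]]) simp_all
  have idg: "iso Q (F (tgt T g))" by (rule Q.iso_ob) simp
  obtain B where B: "iso Q B"
    and mB: "triangle_mor Q (F g) (F g1) (F g2) \<psi> \<psi>1 \<psi>2 (F r) (F (tgt T g)) B"
    by (rule iso_dist_F[OF dg d\<psi> iso_F_W[OF ty(2)] idg]) (simp_all add: \<psi>r)
  obtain C where C: "iso Q C"
    and mC: "triangle_mor Q (F (g \<cdot> w)) (F k1) (F k2) (\<psi> \<star> \<phi>) \<kappa>1 \<kappa>2 (F s) (F (tgt T g)) C"
    by (rule iso_dist_F[OF dk d\<kappa> iso_F_W[OF ty(1)] idg]) (simp_all add: \<psi>\<phi>s del: Q.cmp_assoc)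
  obtain A' where A': "A' \<in> mor Q" "src Q A' = tgt Q A" "tgt Q A' = src Q A"
    "A' \<star> A = src Q A" "A \<star> A' = tgt Q A" using A by (rule Q.isoE)
  obtain C' where C': "C' \<in> mor Q" "src Q C' = tgt Q C" "tgt Q C' = src Q C"
    "C' \<star> C = src Q C" "C \<star> C' = tgt Q C" using C by (rule Q.isoE)
  have t\<phi>: "triangle Q \<phi> \<phi>1 \<phi>2" and t\<psi>: "triangle Q \<psi> \<psi>1 \<psi>2" and t\<kappa>: "triangle Q (\<psi> \<star> \<phi>) \<kappa>1 \<kappa>2"
    using d\<phi> d\<psi> d\<kappa> Q.dist_triangle by blast+
  note tw = triangle_F[OF dw] and tg = triangle_F[OF dg] and tk = triangle_F[OF dk]
  have obg: "tgt T g \<in> ob T" by simp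
  have mA': "triangle_mor Q \<phi> \<phi>1 \<phi>2 (F w) (F w1) (F w2) (K s (src T s)) (K r (src T r)) A'"
    by (rule triangle_mor_F_inverse[OF dw d\<phi> mA inverse_F_W[OF ty(1)] inverse_F_W[OF ty(2)] A'])
  have mC': "triangle_mor Q (\<psi> \<star> \<phi>) \<kappa>1 \<kappa>2 (F (g \<cdot> w)) (F k1) (F k2) (K s (src T s)) (F (tgt T g)) C'"
    by (rule triangle_mor_F_inverse[OF dk d\<kappa> mC inverse_F_W[OF ty(1)] inverse_F_ob[OF obg] C'])
  have Fs: "F s \<star> K s (src T s) = F (tgt T s)" by (rule F_cmp_K) simp
  have 1: "triangle_mor Q \<phi> \<phi>1 \<phi>2 (\<psi> \<star> \<phi>) \<kappa>1 \<kappa>2 (src Q \<phi>) \<psi> (C \<star> (F U \<star> A'))"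
  proof -
    have "triangle_mor Q \<phi> \<phi>1 \<phi>2 (\<psi> \<star> \<phi>) \<kappa>1 \<kappa>2 (F s \<star> (F (src T w) \<star> K s (src T s)))
        (F (tgt T g) \<star> (F g \<star> K r (src T r))) (C \<star> (F U \<star> A'))"
      by (rule Q.triangle_mor_cmp[OF t\<phi> tk t\<kappa>
            Q.triangle_mor_cmp[OF t\<phi> tw tk mA' triangle_mor_F[OF dw dk mU]] mC])
    moreover have "F (src T w) \<star> K s (src T s) = K s (src T s)" by (rule Q.tgt_cmp) simp_all
    moreover have "F g \<star> K r (src T r) = \<psi>"
      unfolding \<psi> by (rule K_decompose[symmetric]) simp_all
    moreover have "F (tgt T g) \<star> \<psi> = \<psi>" by (rule Q.tgt_cmp) simp_all
    ultimately show ?thesis using Fs by simp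
  qed
  have 2: "triangle_mor Q (\<psi> \<star> \<phi>) \<kappa>1 \<kappa>2 \<psi> \<psi>1 \<psi>2 \<phi> (tgt Q \<psi>) (B \<star> (F V \<star> C'))"
  proof -
    have "triangle_mor Q (\<psi> \<star> \<phi>) \<kappa>1 \<kappa>2 \<psi> \<psi>1 \<psi>2 (F r \<star> (F w \<star> K s (src T s)))
        (F (tgt T g) \<star> (F (tgt T g) \<star> F (tgt T g))) (B \<star> (F V \<star> C'))"
      by (rule Q.triangle_mor_cmp[OF t\<kappa> tg t\<psi>
            Q.triangle_mor_cmp[OF t\<kappa> tk tg mC' triangle_mor_F[OF dk dg mV]] mB])
    moreover have "F r \<star> (F w \<star> K s (src T s)) = (F r \<star> F w) \<star> K s (src T s)"
      by (rule Q.cmp_assoc[symmetric]) simp_all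
    moreover have "F r \<star> F w = F (r \<cdot> w)" by (rule F_cmp[symmetric]) simp_all
    moreover have "F (r \<cdot> w) \<star> K s (src T s) = \<phi>"
      unfolding \<phi> by (rule K_decompose[symmetric]) simp_all
    ultimately show ?thesis by simp
  qed
  have tUV: "triangle Q (F U) (F V) (F (shift T w1 \<cdot> g2))" by (rule triangle_F[OF UV])
  have w1 [simp]: "w1 \<in> mor T" "src T w1 = src T r" using distD[OF dw] by simp_all
  have g1 [simp]: "g1 \<in> mor T" "g2 \<in> mor T" "src T g2 = tgt T g1" "tgt T g2 = shift T (src T r)"
    using distD[OF dg] by simp_all
  have \<phi>1 [simp]: "\<phi>1 \<in> mor Q" "src Q \<phi>1 = F (tgt T r)" using Q.distD[OF d\<phi>] by simp_all
  have \<psi>1 [simp]: "\<psi>1 \<in> mor Q" "\<psi>2 \<in> mor Q" "src Q \<psi>2 = tgt Q \<psi>1" "tgt Q \<psi>2 = F (shift T (tgt T r))"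
    using Q.distD[OF d\<psi>] by simp_all
  have [simp]: "U \<in> mor T" "src T U = tgt T w1" "tgt T U = tgt T k1"
    using triangle_morD(7-9)[OF mU] distD(5)[OF dw] distD(5)[OF dk] by simp_all
  have [simp]: "V \<in> mor T" "src T V = tgt T k1" "tgt T V = tgt T g1"
    using triangle_morD(7-9)[OF mV] distD(5)[OF dg] distD(5)[OF dk] by simp_all
  have [simp]: "k1 \<in> mor T" using distD[OF dk] by simp
  have Aty [simp]: "A \<in> mor Q" "src Q A = F (tgt T w1)" "tgt Q A = tgt Q \<phi>1"
    using Q.triangle_morD(7-9)[OF mA] distD(3,5)[OF dw] Q.distD(5)[OF d\<phi>] by simp_all
  have Bty [simp]: "B \<in> mor Q" "src Q B = F (tgt T g1)" "tgt Q B = tgt Q \<psi>1"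
    using Q.triangle_morD(7-9)[OF mB] by simp_all
  have Cty [simp]: "C \<in> mor Q" "src Q C = F (tgt T k1)"
    using Q.triangle_morD(7-9)[OF mC] distD(3,5)[OF dk] by simp_all
  note [simp] = A'(1-3) C'(1-3)
  \<comment> \<open>The triangle of cones in T is conjugated by A, C and B. For the third square the
    middle square of A replaces the shift of w1 by that of \<phi>1, and the last square of B
    replaces g2 by \<psi>2; the two meet in the shift of F r.\<close>
  have 3: "triangle_mor Q (F U) (F V) (F (shift T w1 \<cdot> g2))
      (C \<star> (F U \<star> A')) (B \<star> (F V \<star> C')) (shift Q \<phi>1 \<star> \<psi>2) A C B"
  proof (rule Q.triangle_morI)
    show "C \<star> F U = (C \<star> (F U \<star> A')) \<star> A"
      by (rule Q.cmp_inverse_cancel[symmetric]) (use A'(4) in simp_all)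
    show "B \<star> F V = (B \<star> (F V \<star> C')) \<star> C"
      by (rule Q.cmp_inverse_cancel[symmetric]) (use C'(4) in simp_all)
    have "A \<star> F w1 = \<phi>1 \<star> F r" by (rule Q.triangle_morD(11)[OF mA])
    then have "shift Q (A \<star> F w1) = shift Q (\<phi>1 \<star> F r)" by (simp only:)
    then have sA: "shift Q A \<star> F (shift T w1) = shift Q \<phi>1 \<star> F (shift T r)" by simp
    have sB: "F (shift T r) \<star> F g2 = \<psi>2 \<star> B"
      using Q.triangle_morD(12)[OF mB] by simp
    have "F (shift T w1 \<cdot> g2) = F (shift T w1) \<star> F g2" by (rule F_cmp) simp_all
    then have "shift Q A \<star> F (shift T w1 \<cdot> g2) = shift Q A \<star> (F (shift T w1) \<star> F g2)" by (simp only:)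
    also have "\<dots> = shift Q \<phi>1 \<star> (F (shift T r) \<star> F g2)"
      by (rule Q.cmp_eq_cmp[OF sA]) simp_all
    also have "\<dots> = shift Q \<phi>1 \<star> (\<psi>2 \<star> B)" by (simp only: sB)
    also have "\<dots> = (shift Q \<phi>1 \<star> \<psi>2) \<star> B"
      by (rule Q.cmp_assoc[symmetric]) simp_all
    finally show "shift Q A \<star> F (shift T w1 \<cdot> g2) = (shift Q \<phi>1 \<star> \<psi>2) \<star> B" .
  qed simp_all
  have tUV': "triangle Q (C \<star> (F U \<star> A')) (B \<star> (F V \<star> C')) (shift Q \<phi>1 \<star> \<psi>2)"
    by (rule Q.triangleI) simp_all
  have "dist Q (C \<star> (F U \<star> A')) (B \<star> (F V \<star> C')) (shift Q \<phi>1 \<star> \<psi>2)"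
    unfolding dist_Q_iff triangle_iso_def using UV tUV' 3 A B C by blast
  then show "\<exists>u v. dist Q u v (shift Q \<phi>1 \<star> \<psi>2) \<and>
      triangle_mor Q \<phi> \<phi>1 \<phi>2 (\<psi> \<star> \<phi>) \<kappa>1 \<kappa>2 (src Q \<phi>) \<psi> u \<and>
      triangle_mor Q (\<psi> \<star> \<phi>) \<kappa>1 \<kappa>2 \<psi> \<psi>1 \<psi>2 \<phi> (tgt Q \<psi>) v"
    using 1 2 by blast
qed

lemma triangulated_Q: "triangulated Q"
  unfolding triangulated_iff using octahedral_Q Q.pretri_axioms by blast

lemma quotient_functor_function: "is_function (quotient_functor T D) (Mor T) (Mor Q)"
  and app_quotient_functor: "f \<in> mor T \<Longrightarrow> app (quotient_functor T D) f = F f"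
proof -
  have eq: "quotient_functor T D = mkset {opair f (F f) | f. f \<in> elts (Mor T)}"
    unfolding quotient_functor_def F_def mor_def ..
  have "F x \<in> elts (Mor Q)" if "x \<in> elts (Mor T)" for x
    using that by (simp add: mor_def)
  note graph = is_function_graph[of "Mor T" F "Mor Q", OF this]
  show "is_function (quotient_functor T D) (Mor T) (Mor Q)" unfolding eq by (rule graph(1))
  show "f \<in> mor T \<Longrightarrow> app (quotient_functor T D) f = F f"
    unfolding eq mor_def by (rule graph(2))
qed

text \<open>Every morphism of the quotient is a fraction \<open>F f \<circ> (F s)\<^sup>-\<^sup>1\<close>.\<close>

lemma functor_fixes_Q:
  assumes G: "is_functor Q Q G" and GF: "\<And>f. f \<in> mor T \<Longrightarrow> app G (F f) = F f" and a: "a \<in> mor Q"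
  shows "app G a = a"
proof -
  obtain s f where s [simp]: "s \<in> W" "f \<in> mor T" "src T f = src T s" and af: "a = K s f"
    using a by (rule mor_QE)
  have func: "is_function G (Mor Q) (Mor Q)"
    and st: "\<forall>f\<in>mor Q. app G (src Q f) = src Q (app G f) \<and> app G (tgt Q f) = tgt Q (app G f)"
    and cmp: "\<forall>f\<in>mor Q. \<forall>g\<in>mor Q. src Q g = tgt Q f \<longrightarrow> app G (g \<star> f) = app G g \<star> app G f"
    using G unfolding is_functor_def by blast+
  have Ga: "app G a \<in> mor Q" using is_function_app(2)[OF func] a unfolding mor_def by blast
  have src: "src Q (app G a) = src Q a"
    using st[rule_format, OF a] GF[of "tgt T s"] by (simp add: af)
  have "app G (a \<star> F s) = app G a \<star> app G (F s)" by (rule cmp[rule_format]) (simp_all add: af)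
  then have "app G a \<star> F s = a \<star> F s" using GF[of s] GF[of f] by (simp add: af K_cmp_F)
  then show ?thesis
    by (rule Q.iso_cancel_right[OF iso_F_W[OF s(1)]]) (use Ga src a in \<open>simp_all add: af\<close>)
qed

end

section \<open>Transfer\<close>

locale enlarged =
  fixes S :: "'v::zermelo" and star :: "'v \<Rightarrow> 'v"
  assumes enlargement: "enlargement S star"
begin

lemma level_mono: "m \<le> n \<Longrightarrow> level S m \<subseteq> level S n"
  by (rule lift_Suc_mono_le[of "level S"]) auto

lemma
  shows base: "base_set S" and base_star: "base_set (star S)"
    and star_hat_ax: "\<forall>x \<in> hat S. star x \<in> hat (star S)"
    and transfer_ax: "\<forall>p. statement_in (hat S) p \<longrightarrow> (is_true p \<longleftrightarrow> is_true (map_fm star p))"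
  by (insert enlargement[unfolded enlargement_def], elim conjE, assumption)+

lemma base_atom: "s \<in> elts S \<Longrightarrow> atom s"
  using base unfolding base_set_def by blast

lemma hat_levelE:
  assumes "x \<in> hat S" "\<not> atom x"
  obtains n where "elts x \<subseteq> level S n"
proof -
  obtain n where "x \<in> level S n" using assms(1) unfolding hat_def by blast
  then have "\<exists>n. elts x \<subseteq> level S n"
    by (induction n) (use assms(2) base_atom in auto)
  then show ?thesis using that by blast
qed

lemma in_hatI: "\<not> atom x \<Longrightarrow> elts x \<subseteq> level S n \<Longrightarrow> x \<in> hat S"
  unfolding hat_def by (rule UN_I[of "Suc n"]) auto

text \<open>In \<open>hat S\<close> only the elements of S are urelements, so these are the members
  of \<open>hat S\<close> outside S.\<close>

definition std :: "'v \<Rightarrow> bool" where "std x \<longleftrightarrow> \<not> atom x \<and> x \<in> hat S"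

lemma std_hat: "std x \<Longrightarrow> x \<in> hat S"
  by (simp add: std_def)

lemma std_levelE:
  assumes "std x"
  obtains n where "elts x \<subseteq> level S n"
  using assms hat_levelE unfolding std_def by blast

lemma std_subset: "std x \<Longrightarrow> \<not> atom y \<Longrightarrow> elts y \<subseteq> elts x \<Longrightarrow> std y"
  by (metis in_hatI std_def std_levelE subset_trans)

lemma set_in_level:
  "\<not> atom x \<Longrightarrow> elts x \<subseteq> level S n \<Longrightarrow> x \<in> level S (Suc n)"
  by simp

text \<open>Each layer of braces in {{x}, {x, y}} costs one level.\<close>

lemma opair_in_level:
  assumes "x \<in> level S n" "y \<in> level S n"
  shows "opair x y \<in> level S (Suc (Suc n))"
  unfolding opair_def using assms
  by (intro set_in_level)
    (auto simp: elts_mkset atom_mkset small_insert2 small_singleton simp del: level.simps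
      intro!: set_in_level)

lemma pairs_in_level:
  assumes "A \<subseteq> level S n" "B \<subseteq> level S n"
  shows "pairs A B \<subseteq> level S (Suc (Suc n))"
  using assms opair_in_level unfolding pairs_def by blast

lemma std_pairs:
  assumes "std A" "std B" "\<not> atom F" "elts F \<subseteq> pairs (elts A) (elts B)"
  shows "std F"
proof -
  obtain m n where m: "elts A \<subseteq> level S m" "elts B \<subseteq> level S n"
    using assms(1,2) by (meson std_levelE)
  then have "elts A \<subseteq> level S (max m n)" "elts B \<subseteq> level S (max m n)"
    using level_mono[of m "max m n"] level_mono[of n "max m n"] by auto
  then have "elts F \<subseteq> level S (Suc (Suc (max m n)))" using pairs_in_level assms(4) by blast
  then show ?thesis using in_hatI assms(3) unfolding std_def by blast
qed

lemma std_triples: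
  assumes "std A" "\<not> atom F" "elts F \<subseteq> triples (elts A)"
  shows "std F"
proof -
  obtain n where n: "elts A \<subseteq> level S n" using assms(1) by (rule std_levelE)
  have "pairs (elts A) (elts A) \<subseteq> level S (Suc (Suc n))" using n by (rule pairs_in_level[OF n])
  moreover have "elts A \<subseteq> level S (Suc (Suc n))" using n level_mono[of n "Suc (Suc n)"] by auto
  ultimately have "triples (elts A) \<subseteq> level S (Suc (Suc (Suc (Suc n))))"
    unfolding triples_eq by (rule pairs_in_level)
  then show ?thesis using in_hatI assms unfolding std_def by blast
qed

lemma std_power:
  assumes "std A" "\<not> atom F" "\<And>x. x \<in> elts F \<Longrightarrow> \<not> atom x \<and> elts x \<subseteq> elts A"
  shows "std F"
proof -
  obtain n where n: "elts A \<subseteq> level S n" using assms(1) by (rule std_levelE)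
  have "elts F \<subseteq> level S (Suc n)" using n assms(3) by auto
  then show ?thesis using in_hatI assms(2) unfolding std_def by blast
qed

text \<open>\<open>trm k t t'\<close> and \<open>frm k P P'\<close>: some term (formula) with constants in
  \<open>hat S\<close> and free variables below \<open>k\<close> has the value \<open>t\<close>, and its image under
  \<open>star\<close> has the value \<open>t'\<close>, as functions of the assignment. The closure rules below
  construct the formulas by unification, so that they need never be written down.\<close>

definition trm :: "nat \<Rightarrow> ((nat \<Rightarrow> 'v) \<Rightarrow> 'v) \<Rightarrow> ((nat \<Rightarrow> 'v) \<Rightarrow> 'v) \<Rightarrow> bool" where
  "trm k t t' \<longleftrightarrow> (\<exists>p. set_tm p \<subseteq> hat S \<and> tm_vars p \<subseteq> {..<k} \<and>
     (\<forall>e. tm_val e p = t e \<and> tm_val e (map_tm star p) = t' e))"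

definition frm :: "nat \<Rightarrow> ((nat \<Rightarrow> 'v) \<Rightarrow> bool) \<Rightarrow> ((nat \<Rightarrow> 'v) \<Rightarrow> bool) \<Rightarrow> bool" where
  "frm k P P' \<longleftrightarrow> (\<exists>p. set_fm p \<subseteq> hat S \<and> free_vars p \<subseteq> {..<k} \<and>
     (\<forall>e. sat e p = P e \<and> sat e (map_fm star p) = P' e))"

lemma trm_const: "a \<in> hat S \<Longrightarrow> trm k (\<lambda>e. a) (\<lambda>e. star a)"
  unfolding trm_def by (rule exI[of _ "Const a"]) simp

lemma trm_var: "i < k \<Longrightarrow> trm k (\<lambda>e. e i) (\<lambda>e. e i)"
  unfolding trm_def by (rule exI[of _ "Var i"]) simp

lemma trm_opair:
  assumes "trm k t t'" "trm k u u'"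
  shows "trm k (\<lambda>e. opair (t e) (u e)) (\<lambda>e. opair (t' e) (u' e))"
proof -
  obtain p q where
    "set_tm p \<subseteq> hat S \<and> tm_vars p \<subseteq> {..<k} \<and> (\<forall>e. tm_val e p = t e \<and> tm_val e (map_tm star p) = t' e)"
    "set_tm q \<subseteq> hat S \<and> tm_vars q \<subseteq> {..<k} \<and> (\<forall>e. tm_val e q = u e \<and> tm_val e (map_tm star q) = u' e)"
    using assms unfolding trm_def by blast
  then show ?thesis unfolding trm_def by (intro exI[of _ "OPair p q"]) simp
qed

lemma trm_app:
  assumes "trm k t t'" "trm k u u'"
  shows "trm k (\<lambda>e. app (t e) (u e)) (\<lambda>e. app (t' e) (u' e))"
proof -
  obtain p q where
    "set_tm p \<subseteq> hat S \<and> tm_vars p \<subseteq> {..<k} \<and> (\<forall>e. tm_val e p = t e \<and> tm_val e (map_tm star p) = t' e)"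
    "set_tm q \<subseteq> hat S \<and> tm_vars q \<subseteq> {..<k} \<and> (\<forall>e. tm_val e q = u e \<and> tm_val e (map_tm star q) = u' e)"
    using assms unfolding trm_def by blast
  then show ?thesis unfolding trm_def by (intro exI[of _ "Apply p q"]) simp
qed

lemma trm_triple:
  assumes "trm k t t'" "trm k u u'" "trm k v v'"
  shows "trm k (\<lambda>e. triple (t e) (u e) (v e)) (\<lambda>e. triple (t' e) (u' e) (v' e))"
  unfolding triple_def using assms by (intro trm_opair)

lemma frm_eq:
  assumes "trm k t t'" "trm k u u'"
  shows "frm k (\<lambda>e. t e = u e) (\<lambda>e. t' e = u' e)"
proof -
  obtain p q where
    "set_tm p \<subseteq> hat S \<and> tm_vars p \<subseteq> {..<k} \<and> (\<forall>e. tm_val e p = t e \<and> tm_val e (map_tm star p) = t' e)"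
    "set_tm q \<subseteq> hat S \<and> tm_vars q \<subseteq> {..<k} \<and> (\<forall>e. tm_val e q = u e \<and> tm_val e (map_tm star q) = u' e)"
    using assms unfolding trm_def by blast
  then show ?thesis unfolding frm_def by (intro exI[of _ "Equal p q"]) simp
qed

lemma frm_in:
  assumes "trm k t t'" "trm k u u'"
  shows "frm k (\<lambda>e. t e \<in> elts (u e)) (\<lambda>e. t' e \<in> elts (u' e))"
proof -
  obtain p q where
    "set_tm p \<subseteq> hat S \<and> tm_vars p \<subseteq> {..<k} \<and> (\<forall>e. tm_val e p = t e \<and> tm_val e (map_tm star p) = t' e)"
    "set_tm q \<subseteq> hat S \<and> tm_vars q \<subseteq> {..<k} \<and> (\<forall>e. tm_val e q = u e \<and> tm_val e (map_tm star q) = u' e)"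
    using assms unfolding trm_def by blast
  then show ?thesis unfolding frm_def by (intro exI[of _ "Elem p q"]) simp
qed

lemma frm_not:
  assumes "frm k P P'"
  shows "frm k (\<lambda>e. \<not> P e) (\<lambda>e. \<not> P' e)"
proof -
  obtain p where
    "set_fm p \<subseteq> hat S \<and> free_vars p \<subseteq> {..<k} \<and> (\<forall>e. sat e p = P e \<and> sat e (map_fm star p) = P' e)"
    using assms unfolding frm_def by blast
  then show ?thesis unfolding frm_def by (intro exI[of _ "Neg p"]) simp
qed

lemma frm_conj:
  assumes "frm k P P'" "frm k R R'"
  shows "frm k (\<lambda>e. P e \<and> R e) (\<lambda>e. P' e \<and> R' e)"
proof -
  obtain p q where
    "set_fm p \<subseteq> hat S \<and> free_vars p \<subseteq> {..<k} \<and> (\<forall>e. sat e p = P e \<and> sat e (map_fm star p) = P' e)"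
    "set_fm q \<subseteq> hat S \<and> free_vars q \<subseteq> {..<k} \<and> (\<forall>e. sat e q = R e \<and> sat e (map_fm star q) = R' e)"
    using assms unfolding frm_def by blast
  then show ?thesis unfolding frm_def by (intro exI[of _ "Conj p q"]) simp
qed

lemma frm_imp:
  assumes "frm k P P'" "frm k R R'"
  shows "frm k (\<lambda>e. P e \<longrightarrow> R e) (\<lambda>e. P' e \<longrightarrow> R' e)"
  using frm_not[OF frm_conj[OF assms(1) frm_not[OF assms(2)]]] by simp

lemma frm_iff:
  assumes "frm k P P'" "frm k R R'"
  shows "frm k (\<lambda>e. P e \<longleftrightarrow> R e) (\<lambda>e. P' e \<longleftrightarrow> R' e)"
  unfolding iff_conv_conj_imp using assms by (intro frm_conj frm_imp)

text \<open>The side conditions say that \<open>P\<close> and \<open>P'\<close> do not depend on the variable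
  \<open>k\<close> that is being bound.\<close>

lemma frm_ball:
  assumes "trm k A A'" "frm (Suc k) (\<lambda>e. P e (e k)) (\<lambda>e. P' e (e k))"
    and P: "\<And>e x. P (e(k := x)) x = P e x" "\<And>e x. P' (e(k := x)) x = P' e x"
  shows "frm k (\<lambda>e. \<forall>x\<in>elts (A e). P e x) (\<lambda>e. \<forall>x\<in>elts (A' e). P' e x)"
proof -
  obtain p q where p:
    "set_tm p \<subseteq> hat S \<and> tm_vars p \<subseteq> {..<k} \<and> (\<forall>e. tm_val e p = A e \<and> tm_val e (map_tm star p) = A' e)"
    and q: "set_fm q \<subseteq> hat S \<and> free_vars q \<subseteq> {..<Suc k} \<and>
      (\<forall>e. sat e q = P e (e k) \<and> sat e (map_fm star q) = P' e (e k))"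
    using assms(1,2) unfolding trm_def frm_def by blast
  have "set_fm (BAll k p q) \<subseteq> hat S" using p q by simp
  moreover have "free_vars (BAll k p q) \<subseteq> {..<k}" using p q by (auto simp: less_Suc_eq)
  moreover have "sat e (BAll k p q) = (\<forall>x\<in>elts (A e). P e x) \<and>
      sat e (map_fm star (BAll k p q)) = (\<forall>x\<in>elts (A' e). P' e x)" for e
    using p q P by simp
  ultimately show ?thesis unfolding frm_def by blast
qed

lemma frm_bex:
  assumes "trm k A A'" "frm (Suc k) (\<lambda>e. P e (e k)) (\<lambda>e. P' e (e k))"
    and P: "\<And>e x. P (e(k := x)) x = P e x" "\<And>e x. P' (e(k := x)) x = P' e x"
  shows "frm k (\<lambda>e. \<exists>x\<in>elts (A e). P e x) (\<lambda>e. \<exists>x\<in>elts (A' e). P' e x)"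
proof -
  have "frm k (\<lambda>e. \<forall>x\<in>elts (A e). \<not> P e x) (\<lambda>e. \<forall>x\<in>elts (A' e). \<not> P' e x)"
    by (rule frm_ball[where P = "\<lambda>e x. \<not> P e x" and P' = "\<lambda>e x. \<not> P' e x",
          OF assms(1) frm_not[OF assms(2)]]) (simp_all add: P)
  from frm_not[OF this] show ?thesis by simp
qed

lemmas frm_intros = frm_eq frm_in frm_not frm_conj frm_imp frm_iff frm_ball frm_bex
  trm_opair trm_app trm_triple trm_var trm_const

text \<open>Without free variables the values do not depend on the assignment, so P and P' are the
  truth values of a statement and of its image under \<open>star\<close>.\<close>

lemma transfer:
  assumes "frm 0 (\<lambda>e. P) (\<lambda>e. P')"
  shows "P \<longleftrightarrow> P'"
proof -
  obtain p where p: "set_fm p \<subseteq> hat S" "free_vars p = {}" "\<And>e. sat e p = P"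
    "\<And>e. sat e (map_fm star p) = P'"
    using assms unfolding frm_def by auto
  have "is_true p \<longleftrightarrow> is_true (map_fm star p)"
    using transfer_ax p(1,2) unfolding statement_in_def by blast
  then show ?thesis unfolding is_true_def p(3,4) by simp
qed

section \<open>Urelements, functions and relations under the enlargement\<close>

lemma S_hat: "S \<in> hat S"
  using base in_hatI[of S 0] unfolding base_set_def by simp

text \<open>No formula says directly that something is a urelement, but S is itself a constant of
  the language, and inside the superstructure being a urelement means belonging to S.\<close>

lemma star_base: "x \<in> hat S \<Longrightarrow> star x \<in> elts (star S) \<longleftrightarrow> x \<in> elts S"
  by (rule transfer[symmetric]) (intro frm_intros S_hat)

lemma star_level_trans: "x \<in> hat (star S) \<Longrightarrow> y \<in> elts x \<Longrightarrow> y \<in> hat (star S)"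
proof -
  assume "x \<in> hat (star S)" and y: "y \<in> elts x"
  then obtain n where "x \<in> level (star S) n" unfolding hat_def by blast
  then have "\<exists>n. y \<in> level (star S) n"
  proof (induction n)
    case 0
    then have "atom x" using base_star unfolding base_set_def by simp
    then show ?case using y elts_atom by blast
  next
    case (Suc n)
    then show ?case using y by auto
  qed
  then show ?thesis unfolding hat_def by blast
qed

lemma star_hat_cases:
  assumes "x \<in> hat (star S)"
  shows "x \<in> elts (star S) \<or> \<not> atom x"
proof -
  obtain n where "x \<in> level (star S) n" using assms unfolding hat_def by blast
  then show ?thesis by (induction n) auto
qed

lemma star_hat: "x \<in> hat S \<Longrightarrow> star x \<in> hat (star S)"
  using star_hat_ax by blast

lemma atom_star: "std A \<Longrightarrow> \<not> atom (star A)"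
  using star_base[of A] star_hat_cases[OF star_hat] base_atom unfolding std_def by blast

text \<open>Members of \<open>star A\<close> lie in the target superstructure, where everything
  outside the base set is a set. That they avoid the base set is transferred from A and S.\<close>

lemma atom_elts_star:
  assumes A: "A \<in> hat S" and na: "\<And>x. x \<in> elts A \<Longrightarrow> \<not> atom x" and x: "x \<in> elts (star A)"
  shows "\<not> atom x"
proof -
  have "(\<forall>x\<in>elts A. x \<notin> elts S) \<longleftrightarrow> (\<forall>x\<in>elts (star A). x \<notin> elts (star S))"
    by (rule transfer) (intro frm_intros S_hat A; simp)
  then have "x \<notin> elts (star S)" using na base_atom x by blast
  then show ?thesis using star_hat_cases[OF star_level_trans[OF star_hat[OF A] x]] by blast
qed

lemma is_function_star:
  assumes std: "std F" "std A" "std B" and f: "is_function F A B"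
  shows "is_function (star F) (star A) (star B)"
proof -
  note [simp] = std[THEN std_hat]
  have "\<forall>z\<in>elts F. \<exists>x\<in>elts A. \<exists>y\<in>elts B. z = opair x y"
    using f unfolding is_function_def pairs_def by blast
  moreover have "(\<forall>z\<in>elts F. \<exists>x\<in>elts A. \<exists>y\<in>elts B. z = opair x y) \<longleftrightarrow>
      (\<forall>z\<in>elts (star F). \<exists>x\<in>elts (star A). \<exists>y\<in>elts (star B). z = opair x y)"
    by (rule transfer) (intro frm_intros; simp)
  ultimately have 1: "elts (star F) \<subseteq> pairs (elts (star A)) (elts (star B))"
    unfolding pairs_def by blast
  \<comment> \<open>Unique existence is spelled out with both quantifiers bounded by B. After
    transfer the inclusion in the product removes the bound again.\<close>
  have "\<forall>x\<in>elts A. \<exists>y\<in>elts B. opair x y \<in> elts F \<and> (\<forall>z\<in>elts B. opair x z \<in> elts F \<longrightarrow> z = y)"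
  proof
    fix x assume "x \<in> elts A"
    then have "opair x (app F x) \<in> elts F \<and> app F x \<in> elts B" using is_function_app[OF f] by blast
    then show "\<exists>y\<in>elts B. opair x y \<in> elts F \<and> (\<forall>z\<in>elts B. opair x z \<in> elts F \<longrightarrow> z = y)"
      using f \<open>x \<in> elts A\<close> unfolding is_function_def by blast
  qed
  moreover have "(\<forall>x\<in>elts A. \<exists>y\<in>elts B. opair x y \<in> elts F \<and> (\<forall>z\<in>elts B. opair x z \<in> elts F \<longrightarrow> z = y)) \<longleftrightarrow>
    (\<forall>x\<in>elts (star A). \<exists>y\<in>elts (star B). opair x y \<in> elts (star F) \<and>
      (\<forall>z\<in>elts (star B). opair x z \<in> elts (star F) \<longrightarrow> z = y))"
    by (rule transfer) (intro frm_intros; simp)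
  ultimately have "\<forall>x\<in>elts (star A). \<exists>y\<in>elts (star B). opair x y \<in> elts (star F) \<and>
      (\<forall>z\<in>elts (star B). opair x z \<in> elts (star F) \<longrightarrow> z = y)" by blast
  then have "\<forall>x\<in>elts (star A). \<exists>!y. opair x y \<in> elts (star F)"
    using 1 by (meson in_pairs subsetD)
  then show ?thesis using 1 atom_star[OF std(1)] unfolding is_function_def by blast
qed

lemma is_relation3_star:
  assumes std: "std R" "std A" and r: "is_relation3 R A"
  shows "is_relation3 (star R) (star A)"
proof -
  note [simp] = std[THEN std_hat]
  have "\<forall>t\<in>elts R. \<exists>x\<in>elts A. \<exists>y\<in>elts A. \<exists>z\<in>elts A. t = triple x y z"
    using r unfolding is_relation3_def triples_def by blast
  moreover have "(\<forall>t\<in>elts R. \<exists>x\<in>elts A. \<exists>y\<in>elts A. \<exists>z\<in>elts A. t = triple x y z) \<longleftrightarrow>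
    (\<forall>t\<in>elts (star R). \<exists>x\<in>elts (star A). \<exists>y\<in>elts (star A). \<exists>z\<in>elts (star A). t = triple x y z)"
    by (rule transfer) (intro frm_intros; simp)
  ultimately show ?thesis using atom_star[OF std(1)] unfolding is_relation3_def triples_def by blast
qed

end

section \<open>The axioms in bounded form\<close>

text \<open>The axioms restated with bounded quantifiers and without descriptions: \<open>e + e = e\<close>
  says that \<open>e\<close> is a zero morphism.\<close>

definition category_laws :: "'v::zermelo tri_cat \<Rightarrow> bool" where
  "category_laws C \<longleftrightarrow>
     (\<forall>f\<in>mor C. src C (src C f) = src C f \<and> tgt C (src C f) = src C f \<and>
                src C (tgt C f) = tgt C f \<and> tgt C (tgt C f) = tgt C f) \<and>
     (\<forall>f\<in>mor C. \<forall>g\<in>mor C. (\<exists>h\<in>mor C. triple g f h \<in> elts (Cmp C)) \<longleftrightarrow> src C g = tgt C f) \<and>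
     (\<forall>f\<in>mor C. \<forall>g\<in>mor C. \<forall>h\<in>mor C. \<forall>h'\<in>mor C.
        triple g f h \<in> elts (Cmp C) \<and> triple g f h' \<in> elts (Cmp C) \<longrightarrow> h = h') \<and>
     (\<forall>f\<in>mor C. \<forall>g\<in>mor C. src C g = tgt C f \<longrightarrow>
        src C (cmp C g f) = src C f \<and> tgt C (cmp C g f) = tgt C g) \<and>
     (\<forall>f\<in>mor C. cmp C f (src C f) = f \<and> cmp C (tgt C f) f = f) \<and>
     (\<forall>f\<in>mor C. \<forall>g\<in>mor C. \<forall>h\<in>mor C. src C g = tgt C f \<and> src C h = tgt C g \<longrightarrow>
        cmp C h (cmp C g f) = cmp C (cmp C h g) f)"

definition preadditive_laws :: "'v::zermelo tri_cat \<Rightarrow> bool" where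
  "preadditive_laws C \<longleftrightarrow>
     (\<forall>f\<in>mor C. \<forall>g\<in>mor C. (\<exists>h\<in>mor C. triple f g h \<in> elts (Add C)) \<longleftrightarrow>
        src C f = src C g \<and> tgt C f = tgt C g) \<and>
     (\<forall>f\<in>mor C. \<forall>g\<in>mor C. \<forall>h\<in>mor C. \<forall>h'\<in>mor C.
        triple f g h \<in> elts (Add C) \<and> triple f g h' \<in> elts (Add C) \<longrightarrow> h = h') \<and>
     (\<forall>x\<in>ob C. \<forall>y\<in>ob C.
        (\<forall>f\<in>hom C x y. \<forall>g\<in>hom C x y. add C f g \<in> hom C x y) \<and>
        (\<forall>f\<in>hom C x y. \<forall>g\<in>hom C x y. \<forall>h\<in>hom C x y.
           add C (add C f g) h = add C f (add C g h)) \<and>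
        (\<forall>f\<in>hom C x y. \<forall>g\<in>hom C x y. add C f g = add C g f) \<and>
        (\<exists>z\<in>hom C x y. (\<forall>f\<in>hom C x y. add C z f = f) \<and>
           (\<forall>f\<in>hom C x y. \<exists>g\<in>hom C x y. add C f g = z))) \<and>
     (\<forall>x\<in>ob C. \<forall>y\<in>ob C. \<forall>z\<in>ob C.
        (\<forall>f\<in>hom C x y. \<forall>g\<in>hom C y z. \<forall>g'\<in>hom C y z.
           cmp C (add C g g') f = add C (cmp C g f) (cmp C g' f)) \<and>
        (\<forall>f\<in>hom C x y. \<forall>f'\<in>hom C x y. \<forall>g\<in>hom C y z.
           cmp C g (add C f f') = add C (cmp C g f) (cmp C g f')))"

definition zero_object_law :: "'v::zermelo tri_cat \<Rightarrow> 'v \<Rightarrow> bool" where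
  "zero_object_law C z \<longleftrightarrow> z \<in> ob C \<and>
     (\<forall>x\<in>ob C. (\<exists>f\<in>hom C z x. \<forall>g\<in>hom C z x. g = f) \<and> (\<exists>f\<in>hom C x z. \<forall>g\<in>hom C x z. g = f))"

definition biproduct_law :: "'v::zermelo tri_cat \<Rightarrow> 'v \<Rightarrow> 'v \<Rightarrow> 'v \<Rightarrow> 'v \<Rightarrow> 'v \<Rightarrow> 'v \<Rightarrow> 'v \<Rightarrow> bool" where
  "biproduct_law C x y b i j p q \<longleftrightarrow>
     b \<in> ob C \<and> i \<in> hom C x b \<and> j \<in> hom C y b \<and> p \<in> hom C b x \<and> q \<in> hom C b y \<and>
     cmp C p i = x \<and> cmp C q j = y \<and>
     add C (cmp C p j) (cmp C p j) = cmp C p j \<and> add C (cmp C q i) (cmp C q i) = cmp C q i \<and>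
     add C (cmp C i p) (cmp C j q) = b"

definition additive_laws :: "'v::zermelo tri_cat \<Rightarrow> bool" where
  "additive_laws C \<longleftrightarrow>
     (\<exists>z\<in>mor C. zero_object_law C z) \<and>
     (\<forall>x\<in>ob C. \<forall>y\<in>ob C. \<exists>b\<in>mor C. \<exists>i\<in>mor C. \<exists>j\<in>mor C. \<exists>p\<in>mor C. \<exists>q\<in>mor C.
        biproduct_law C x y b i j p q)"

definition shift_laws :: "'v::zermelo tri_cat \<Rightarrow> bool" where
  "shift_laws C \<longleftrightarrow>
     (\<forall>f\<in>mor C. shift C (src C f) = src C (shift C f) \<and> shift C (tgt C f) = tgt C (shift C f)) \<and>
     (\<forall>f\<in>mor C. \<forall>g\<in>mor C. src C g = tgt C f \<longrightarrow>
        shift C (cmp C g f) = cmp C (shift C g) (shift C f)) \<and>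
     (\<forall>f\<in>mor C. \<forall>g\<in>mor C. src C f = src C g \<and> tgt C f = tgt C g \<longrightarrow>
        shift C (add C f g) = add C (shift C f) (shift C g)) \<and>
     (\<forall>f\<in>mor C. \<forall>g\<in>mor C. shift C f = shift C g \<longrightarrow> f = g) \<and>
     (\<forall>g\<in>mor C. \<exists>f\<in>mor C. shift C f = g)"

definition triangle_laws :: "'v::zermelo tri_cat \<Rightarrow> bool" where
  "triangle_laws C \<longleftrightarrow>
     (\<forall>f\<in>mor C. \<forall>g\<in>mor C. \<forall>h\<in>mor C. dist C f g h \<longrightarrow> triangle C f g h) \<and>
     (\<forall>f\<in>mor C. \<forall>g\<in>mor C. \<forall>h\<in>mor C. \<forall>f'\<in>mor C. \<forall>g'\<in>mor C. \<forall>h'\<in>mor C.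
        dist C f g h \<and> triangle C f' g' h' \<and>
        (\<exists>a\<in>mor C. \<exists>b\<in>mor C. \<exists>c\<in>mor C. iso C a \<and> iso C b \<and> iso C c \<and>
           triangle_mor C f g h f' g' h' a b c) \<longrightarrow> dist C f' g' h') \<and>
     (\<forall>x\<in>ob C. \<forall>z\<in>ob C. zero_object_law C z \<longrightarrow>
        (\<forall>u\<in>hom C x z. \<forall>v\<in>hom C z (shift C x). dist C x u v)) \<and>
     (\<forall>f\<in>mor C. \<exists>g\<in>mor C. \<exists>h\<in>mor C. dist C f g h)"

text \<open>In the first clause n stands for -\<Sigma>f: it is parallel to \<Sigma>f, and the sum of
  the two is idempotent, hence zero. Quantifying over such n avoids the description
  \<open>neg\<close>.\<close>

definition rotation_laws :: "'v::zermelo tri_cat \<Rightarrow> bool" where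
  "rotation_laws C \<longleftrightarrow>
     (\<forall>f\<in>mor C. \<forall>g\<in>mor C. \<forall>h\<in>mor C. \<forall>n\<in>mor C. triangle C f g h \<and>
        src C n = src C (shift C f) \<and> tgt C n = tgt C (shift C f) \<and>
        add C (add C (shift C f) n) (add C (shift C f) n) = add C (shift C f) n \<longrightarrow>
        (dist C f g h \<longleftrightarrow> dist C g h n)) \<and>
     (\<forall>f\<in>mor C. \<forall>g\<in>mor C. \<forall>h\<in>mor C. \<forall>f'\<in>mor C. \<forall>g'\<in>mor C. \<forall>h'\<in>mor C. \<forall>a\<in>mor C. \<forall>b\<in>mor C.
        dist C f g h \<and> dist C f' g' h' \<and>
        a \<in> hom C (src C f) (src C f') \<and> b \<in> hom C (tgt C f) (tgt C f') \<and>
        cmp C b f = cmp C f' a \<longrightarrow>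
        (\<exists>c\<in>mor C. triangle_mor C f g h f' g' h' a b c))"

definition octahedral_law :: "'v::zermelo tri_cat \<Rightarrow> bool" where
  "octahedral_law C \<longleftrightarrow>
     (\<forall>f\<in>mor C. \<forall>f1\<in>mor C. \<forall>f2\<in>mor C. \<forall>g\<in>mor C. \<forall>g1\<in>mor C. \<forall>g2\<in>mor C. \<forall>k1\<in>mor C. \<forall>k2\<in>mor C.
        src C g = tgt C f \<and>
        dist C f f1 f2 \<and> dist C g g1 g2 \<and> dist C (cmp C g f) k1 k2 \<longrightarrow>
        (\<exists>u\<in>mor C. \<exists>v\<in>mor C. dist C u v (cmp C (shift C f1) g2) \<and>
           triangle_mor C f f1 f2 (cmp C g f) k1 k2 (src C f) g u \<and>
           triangle_mor C (cmp C g f) k1 k2 g g1 g2 f (tgt C g) v))"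

text \<open>The set-theoretic conditions are kept apart from the laws. Not being a urelement and
  being included in a product are, as they stand, no bounded formulas; they pass to the star by
  arguments of their own.\<close>

definition well_typed :: "'v::zermelo tri_cat \<Rightarrow> bool" where
  "well_typed C \<longleftrightarrow> \<not> atom (Mor C) \<and> is_function (Src C) (Mor C) (Mor C) \<and>
     is_function (Tgt C) (Mor C) (Mor C) \<and> is_relation3 (Cmp C) (Mor C) \<and>
     is_relation3 (Add C) (Mor C) \<and> is_function (Shift C) (Mor C) (Mor C) \<and>
     is_relation3 (Tri C) (Mor C)"

lemma is_relation3_mor:
  assumes "is_relation3 R (Mor C)" "triple f g h \<in> elts R"
  shows "f \<in> mor C" "g \<in> mor C" "h \<in> mor C"
proof -
  have "triple f g h \<in> triples (elts (Mor C))" using assms unfolding is_relation3_def by blast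
  then show "f \<in> mor C" "g \<in> mor C" "h \<in> mor C" by (simp_all add: mor_def)
qed

lemma category_iff_laws:
  assumes "well_typed C"
  shows "category C \<longleftrightarrow> category_laws C"
proof -
  have wt: "\<not> atom (Mor C)" "is_function (Src C) (Mor C) (Mor C)" "is_function (Tgt C) (Mor C) (Mor C)"
    and r: "is_relation3 (Cmp C) (Mor C)" using assms unfolding well_typed_def by blast+
  have 1: "(\<exists>h. triple g f h \<in> elts (Cmp C)) \<longleftrightarrow> (\<exists>h\<in>mor C. triple g f h \<in> elts (Cmp C))" for f g
    using is_relation3_mor[OF r] by blast
  have 2: "(\<forall>f g h h'. triple g f h \<in> elts (Cmp C) \<and> triple g f h' \<in> elts (Cmp C) \<longrightarrow> h = h') \<longleftrightarrow>
    (\<forall>f\<in>mor C. \<forall>g\<in>mor C. \<forall>h\<in>mor C. \<forall>h'\<in>mor C.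
        triple g f h \<in> elts (Cmp C) \<and> triple g f h' \<in> elts (Cmp C) \<longrightarrow> h = h')"
    using is_relation3_mor[OF r] by blast
  show ?thesis unfolding category_def category_laws_def 1 2
    by (simp only: wt r simp_thms)
qed

lemma preadditive_iff_laws:
  assumes "well_typed C" "category C"
  shows "preadditive C \<longleftrightarrow> preadditive_laws C"
proof -
  have r: "is_relation3 (Add C) (Mor C)" using assms unfolding well_typed_def by blast
  have 1: "(\<exists>h. triple g f h \<in> elts (Add C)) \<longleftrightarrow> (\<exists>h\<in>mor C. triple g f h \<in> elts (Add C))" for f g
    using is_relation3_mor[OF r] by blast
  have 2: "(\<forall>f g h h'. triple f g h \<in> elts (Add C) \<and> triple f g h' \<in> elts (Add C) \<longrightarrow> h = h') \<longleftrightarrow>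
    (\<forall>f\<in>mor C. \<forall>g\<in>mor C. \<forall>h\<in>mor C. \<forall>h'\<in>mor C.
        triple f g h \<in> elts (Add C) \<and> triple f g h' \<in> elts (Add C) \<longrightarrow> h = h')"
    using is_relation3_mor[OF r] by blast
  show ?thesis unfolding preadditive_def preadditive_laws_def 1 2
    by (simp only: assms r simp_thms)
qed

lemma zero_object_iff_law: "zero_object C z \<longleftrightarrow> zero_object_law C z"
proof -
  have "(\<exists>!f. f \<in> H) \<longleftrightarrow> (\<exists>f\<in>H. \<forall>g\<in>H. g = f)" for H :: "'a set"
    unfolding Ex1_def Ball_def Bex_def ..
  then show ?thesis unfolding zero_object_def zero_object_law_def by simp
qed

context preadd
begin

lemma zero_iff_idem:
  assumes "x \<in> ob C" "y \<in> ob C" "e \<in> mor C" "src C e = x" "tgt C e = y"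
  shows "e = zero C x y \<longleftrightarrow> e \<oplus> e = e"
proof
  assume "e = zero C x y"
  moreover have "zero C x y \<oplus> zero C x y = zero C x y" using assms(1,2) by simp
  ultimately show "e \<oplus> e = e" by (simp only:)
next
  assume "e \<oplus> e = e"
  from zero_of_idem[OF assms(3) this] show "e = zero C x y" unfolding assms(4,5) .
qed

end

lemma biproduct_iff_law:
  assumes "preadditive C" "x \<in> ob C" "y \<in> ob C"
  shows "biproduct C x y b i j p q \<longleftrightarrow> biproduct_law C x y b i j p q"
proof -
  interpret preadd C by unfold_locales (rule assms(1))
  have "p \<cdot> j = zero C y x \<longleftrightarrow> p \<cdot> j \<oplus> p \<cdot> j = p \<cdot> j" "q \<cdot> i = zero C x y \<longleftrightarrow> q \<cdot> i \<oplus> q \<cdot> i = q \<cdot> i"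
    if "i \<in> hom C x b" "j \<in> hom C y b" "p \<in> hom C b x" "q \<in> hom C b y"
    using that assms(2,3) by (simp_all add: zero_iff_idem hom_def)
  then show ?thesis unfolding biproduct_def biproduct_law_def by blast
qed

lemma additive_iff_laws:
  assumes "preadditive C"
  shows "additive_cat C \<longleftrightarrow> additive_laws C"
proof -
  have 1: "(\<exists>z. zero_object C z) \<longleftrightarrow> (\<exists>z\<in>mor C. zero_object_law C z)"
    unfolding zero_object_iff_law zero_object_law_def ob_def by blast
  have 2: "(\<exists>b i j p q. biproduct C x y b i j p q) \<longleftrightarrow>
    (\<exists>b\<in>mor C. \<exists>i\<in>mor C. \<exists>j\<in>mor C. \<exists>p\<in>mor C. \<exists>q\<in>mor C. biproduct_law C x y b i j p q)"
    if "x \<in> ob C" "y \<in> ob C" for x y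
  proof -
    have "biproduct_law C x y b i j p q \<Longrightarrow>
        b \<in> mor C \<and> i \<in> mor C \<and> j \<in> mor C \<and> p \<in> mor C \<and> q \<in> mor C" for b i j p q
      unfolding biproduct_law_def ob_def hom_def by blast
    then show ?thesis unfolding biproduct_iff_law[OF assms that] by blast
  qed
  have "(\<forall>x\<in>ob C. \<forall>y\<in>ob C. \<exists>b i j p q. biproduct C x y b i j p q) \<longleftrightarrow> (\<forall>x\<in>ob C. \<forall>y\<in>ob C.
    \<exists>b\<in>mor C. \<exists>i\<in>mor C. \<exists>j\<in>mor C. \<exists>p\<in>mor C. \<exists>q\<in>mor C. biproduct_law C x y b i j p q)"
    by (intro ball_cong refl 2)
  then show ?thesis unfolding additive_cat_def additive_laws_def 1 using assms by blast
qed

lemma shift_iff_laws: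
  assumes "well_typed C" "category C"
  shows "is_functor C C (Shift C) \<and> is_additive C C (Shift C) \<and> bij_betw (shift C) (mor C) (mor C) \<longleftrightarrow>
    shift_laws C"
proof -
  have f: "is_function (Shift C) (Mor C) (Mor C)" using assms unfolding well_typed_def by blast
  then have m: "shift C f \<in> mor C" if "f \<in> mor C" for f
    using that is_function_app(2)[OF f] unfolding mor_def shift_def by blast
  have "shift C ` mor C = mor C \<longleftrightarrow> mor C \<subseteq> shift C ` mor C" using m by (simp add: set_eq_subset image_subset_iff)
  also have "\<dots> \<longleftrightarrow> (\<forall>g\<in>mor C. \<exists>f\<in>mor C. shift C f = g)"
    unfolding subset_eq image_iff by (rule ball_cong[OF refl]) (rule bex_cong[OF refl], rule eq_commute)
  finally have img: "shift C ` mor C = mor C \<longleftrightarrow> (\<forall>g\<in>mor C. \<exists>f\<in>mor C. shift C f = g)" .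
  have "bij_betw (shift C) (mor C) (mor C) \<longleftrightarrow>
     (\<forall>f\<in>mor C. \<forall>g\<in>mor C. shift C f = shift C g \<longrightarrow> f = g) \<and> (\<forall>g\<in>mor C. \<exists>f\<in>mor C. shift C f = g)"
    unfolding bij_betw_def inj_on_def img ..
  then show ?thesis
    unfolding is_functor_def is_additive_def shift_laws_def shift_def[symmetric]
    by (simp only: assms f simp_thms conj_assoc)
qed

text \<open>A universal quantifier can be bounded when its body holds vacuously off the bound. The
  long prefixes of TR3 and TR4 are bounded in this way, one variable at a time.\<close>

lemma all_bounded:
  assumes "\<And>x. x \<in> A \<Longrightarrow> P x \<longleftrightarrow> Q x" "\<And>x. x \<notin> A \<Longrightarrow> P x"
  shows "(\<forall>x. P x) \<longleftrightarrow> (\<forall>x\<in>A. Q x)"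
  using assms by blast

lemma octahedral_iff_law:
  assumes "is_relation3 (Tri C) (Mor C)"
  shows "octahedral C \<longleftrightarrow> octahedral_law C"
proof -
  have m: "f \<in> mor C \<and> g \<in> mor C \<and> h \<in> mor C" if "dist C f g h" for f g h
    using is_relation3_mor[OF assms] that unfolding dist_def by blast
  then have e: "(\<exists>u v. dist C u v a \<and> P u \<and> R v) \<longleftrightarrow>
      (\<exists>u\<in>mor C. \<exists>v\<in>mor C. dist C u v a \<and> P u \<and> R v)" for a P R by blast
  show ?thesis unfolding octahedral_def octahedral_law_def e
    by (intro all_bounded; (rule refl | use m in blast))
qed

lemma pretri_iff_laws:
  assumes "shift_preadd C" and wt: "well_typed C"
  shows "pretri C \<longleftrightarrow> additive_laws C \<and> triangle_laws C \<and> rotation_laws C"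
proof -
  interpret shift_preadd C by (rule assms(1))
  have r: "is_relation3 (Tri C) (Mor C)" using wt unfolding well_typed_def by blast
  have m: "f \<in> mor C \<and> g \<in> mor C \<and> h \<in> mor C" if "dist C f g h" for f g h
    using is_relation3_mor[OF r] that unfolding dist_def by blast
  have add: "(\<exists>z. zero_object C z) \<and> (\<forall>x\<in>ob C. \<forall>y\<in>ob C. \<exists>b i j p q. biproduct C x y b i j p q) \<longleftrightarrow>
      additive_laws C"
    using additive_iff_laws[OF preadditive] preadditive unfolding additive_cat_def by blast
  have 1: "(\<forall>f g h. dist C f g h \<longrightarrow> triangle C f g h) \<longleftrightarrow>
      (\<forall>f\<in>mor C. \<forall>g\<in>mor C. \<forall>h\<in>mor C. dist C f g h \<longrightarrow> triangle C f g h)"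
    using m by blast
  have iso: "triangle_iso C f g h f' g' h' \<longleftrightarrow>
      (\<exists>a\<in>mor C. \<exists>b\<in>mor C. \<exists>c\<in>mor C. iso C a \<and> iso C b \<and> iso C c \<and>
           triangle_mor C f g h f' g' h' a b c)" for f g h f' g' h'
    unfolding triangle_iso_def using iso_mor by blast
  have 2: "(\<forall>f g h f' g' h'. dist C f g h \<and> triangle C f' g' h' \<and> triangle_iso C f g h f' g' h' \<longrightarrow>
        dist C f' g' h') \<longleftrightarrow>
      (\<forall>f\<in>mor C. \<forall>g\<in>mor C. \<forall>h\<in>mor C. \<forall>f'\<in>mor C. \<forall>g'\<in>mor C. \<forall>h'\<in>mor C.
        dist C f g h \<and> triangle C f' g' h' \<and> triangle_iso C f g h f' g' h' \<longrightarrow> dist C f' g' h')"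
    using m triangleD(1-3) by blast
  have 3: "(\<forall>x z. x \<in> ob C \<and> zero_object C z \<longrightarrow> dist C x (zero C x z) (zero C z (shift C x))) \<longleftrightarrow>
      (\<forall>x\<in>ob C. \<forall>z\<in>ob C. zero_object_law C z \<longrightarrow>
        (\<forall>u\<in>hom C x z. \<forall>v\<in>hom C z (shift C x). dist C x u v))"
  proof -
    \<comment> \<open>Morphisms to and from a zero object are unique, so a condition on all u and v
      is a condition on the two described zero morphisms.\<close>
    have "(\<forall>u\<in>hom C x z. \<forall>v\<in>hom C z (shift C x). dist C x u v) \<longleftrightarrow>
        dist C x (zero C x z) (zero C z (shift C x))" if x: "x \<in> ob C" and z: "zero_object C z" for x z
    proof -
      have "hom C x z = {zero C x z}"
      proof (intro equalityI subsetI)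
        fix u assume "u \<in> hom C x z"
        then have u: "u \<in> mor C" "src C u = x" "tgt C u = z" by (simp_all add: hom_def)
        show "u \<in> {zero C x z}" using to_zero_object[OF z u(1,3)] u(2) by simp
      qed (use zero_ob[OF z] x in \<open>simp add: hom_def\<close>)
      moreover have "hom C z (shift C x) = {zero C z (shift C x)}"
      proof (intro equalityI subsetI)
        fix u assume "u \<in> hom C z (shift C x)"
        then have u: "u \<in> mor C" "src C u = z" "tgt C u = shift C x" by (simp_all add: hom_def)
        show "u \<in> {zero C z (shift C x)}" using from_zero_object[OF z u(1,2)] u(3) by simp
      qed (use zero_ob[OF z] x in \<open>simp add: hom_def\<close>)
      ultimately show ?thesis by simp
    qed
    then show ?thesis unfolding zero_object_iff_law[symmetric] using zero_ob by blast
  qed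
  have 4: "(\<forall>f\<in>mor C. \<exists>g h. dist C f g h) \<longleftrightarrow> (\<forall>f\<in>mor C. \<exists>g\<in>mor C. \<exists>h\<in>mor C. dist C f g h)"
    using m by blast
  have 5: "(\<forall>f g h. triangle C f g h \<longrightarrow> (dist C f g h \<longleftrightarrow> dist C g h (neg C (shift C f)))) \<longleftrightarrow>
      (\<forall>f\<in>mor C. \<forall>g\<in>mor C. \<forall>h\<in>mor C. \<forall>n\<in>mor C. triangle C f g h \<and>
        src C n = src C (shift C f) \<and> tgt C n = tgt C (shift C f) \<and>
        add C (add C (shift C f) n) (add C (shift C f) n) = add C (shift C f) n \<longrightarrow>
        (dist C f g h \<longleftrightarrow> dist C g h n))"
  proof -
    \<comment> \<open>For a morphism n this says that n is a negative of \<Sigma>f. Negatives are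
      unique, so the quantifier over n collapses to the value
      \<open>neg C (shift C f)\<close>.\<close>
    define N where "N f n \<longleftrightarrow> src C n = src C (shift C f) \<and> tgt C n = tgt C (shift C f) \<and>
        add C (add C (shift C f) n) (add C (shift C f) n) = add C (shift C f) n" for f n
    have "n \<in> mor C \<and> src C n = src C (shift C f) \<and> tgt C n = tgt C (shift C f) \<and>
        add C (add C (shift C f) n) (add C (shift C f) n) = add C (shift C f) n \<longleftrightarrow>
        n = neg C (shift C f)" if f: "f \<in> mor C" for f n
    proof
      assume n: "n \<in> mor C \<and> src C n = src C (shift C f) \<and> tgt C n = tgt C (shift C f) \<and>
        add C (add C (shift C f) n) (add C (shift C f) n) = add C (shift C f) n"
      then have "shift C f \<oplus> n = zero C (src C (shift C f)) (tgt C (shift C f))"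
        using zero_of_idem[of "shift C f \<oplus> n"] f by simp
      then show "n = neg C (shift C f)" using n f by - (rule neg_eqI[symmetric], simp_all)
    next
      assume "n = neg C (shift C f)"
      then show "n \<in> mor C \<and> src C n = src C (shift C f) \<and> tgt C n = tgt C (shift C f) \<and>
        add C (add C (shift C f) n) (add C (shift C f) n) = add C (shift C f) n"
        using f by (simp add: add_neg)
    qed
    then have N: "n \<in> mor C \<and> N f n \<longleftrightarrow> n = neg C (shift C f)" if "f \<in> mor C" for f n
      unfolding N_def using that by blast
    have *: "(\<forall>n\<in>mor C. triangle C f g h \<and> N f n \<longrightarrow> P n) \<longleftrightarrow>
        (triangle C f g h \<longrightarrow> P (neg C (shift C f)))" if "f \<in> mor C" for f g h P
      using N[OF that] by metis
    have "(\<forall>f g h. triangle C f g h \<longrightarrow> P f g h) \<longleftrightarrow>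
        (\<forall>f\<in>mor C. \<forall>g\<in>mor C. \<forall>h\<in>mor C. triangle C f g h \<longrightarrow> P f g h)" for P
      using triangleD(1-3) by blast
    then show ?thesis unfolding N_def[symmetric] by (simp add: *)
  qed
  have 6: "(\<forall>f g h f' g' h' a b. dist C f g h \<and> dist C f' g' h' \<and>
        a \<in> hom C (src C f) (src C f') \<and> b \<in> hom C (tgt C f) (tgt C f') \<and>
        cmp C b f = cmp C f' a \<longrightarrow>
        (\<exists>c. triangle_mor C f g h f' g' h' a b c)) \<longleftrightarrow>
     (\<forall>f\<in>mor C. \<forall>g\<in>mor C. \<forall>h\<in>mor C. \<forall>f'\<in>mor C. \<forall>g'\<in>mor C. \<forall>h'\<in>mor C. \<forall>a\<in>mor C. \<forall>b\<in>mor C.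
        dist C f g h \<and> dist C f' g' h' \<and>
        a \<in> hom C (src C f) (src C f') \<and> b \<in> hom C (tgt C f) (tgt C f') \<and>
        cmp C b f = cmp C f' a \<longrightarrow>
        (\<exists>c\<in>mor C. triangle_mor C f g h f' g' h' a b c))"
  proof -
    have h: "a \<in> mor C" if "a \<in> hom C x y" for a x y using that by (simp add: hom_def)
    have e: "(\<exists>c. triangle_mor C f g h f' g' h' a b c) \<longleftrightarrow>
        (\<exists>c\<in>mor C. triangle_mor C f g h f' g' h' a b c)" for f g h f' g' h' a b
      using triangle_morD(7) by blast
    show ?thesis unfolding e by (intro all_bounded; (rule refl | use m h in blast))
  qed
  show ?thesis
    unfolding pretri_def pretri_axioms_def triangle_laws_def rotation_laws_def add[symmetric]
      1 2 3 4 5 6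
    unfolding iso using assms(1) r by (simp only: simp_thms conj_assoc)
qed

text \<open>The restated forms of later axioms are equivalent to the originals only in the presence
  of earlier ones: idempotence means vanishing only in a preadditive category. So the laws are
  brought in by stages, beginning with \<open>well_typed\<close>.\<close>

lemma triangulated_iff_laws:
  "triangulated C \<longleftrightarrow> well_typed C \<and> category_laws C \<and> preadditive_laws C \<and> additive_laws C \<and>
     shift_laws C \<and> triangle_laws C \<and> rotation_laws C \<and> octahedral_law C"
proof -
  have wt: "well_typed C" if "triangulated C"
  proof -
    interpret pretri C using that unfolding triangulated_iff by blast
    have "\<not> atom (Mor C)" using category unfolding category_def by blast
    then show ?thesis unfolding well_typed_def
      using is_function_Src is_function_Tgt is_relation3_Cmp is_relation3_Add is_function_Shift
        is_relation3_Tri by blast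
  qed
  have "triangulated C \<longleftrightarrow> category_laws C \<and> preadditive_laws C \<and> additive_laws C \<and>
     shift_laws C \<and> triangle_laws C \<and> rotation_laws C \<and> octahedral_law C" if w: "well_typed C"
  proof -
    have r: "is_relation3 (Tri C) (Mor C)" using w unfolding well_typed_def by blast
    have "preadditive C \<Longrightarrow> category C" unfolding preadditive_def by blast
    then have "shift_preadd C \<longleftrightarrow> category_laws C \<and> preadditive_laws C \<and> shift_laws C"
      unfolding shift_preadd_def preadd_def shift_preadd_axioms_def
      using category_iff_laws[OF w] preadditive_iff_laws[OF w] shift_iff_laws[OF w]
      by blast
    moreover have "pretri C \<Longrightarrow> shift_preadd C" by (simp add: pretri_def)
    ultimately show ?thesis
      unfolding triangulated_iff octahedral_iff_law[OF r] using pretri_iff_laws[OF _ w] by blast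
  qed
  then show ?thesis using wt by blast
qed

section \<open>Transfer of the axioms of a triangulated category\<close>

lemma hom_bounded:
  "f \<in> hom C x y \<longleftrightarrow> f \<in> elts (Mor C) \<and> app (Src C) f = x \<and> app (Tgt C) f = y"
  "(\<forall>f\<in>hom C x y. P f) \<longleftrightarrow> (\<forall>f\<in>elts (Mor C). app (Src C) f = x \<and> app (Tgt C) f = y \<longrightarrow> P f)"
  "(\<exists>f\<in>hom C x y. P f) \<longleftrightarrow> (\<exists>f\<in>elts (Mor C). (app (Src C) f = x \<and> app (Tgt C) f = y) \<and> P f)"
  by (auto simp: hom_def mor_def src_def tgt_def)

lemma ob_bounded:
  "x \<in> ob C \<longleftrightarrow> x \<in> elts (Mor C) \<and> app (Src C) x = x"
  "(\<forall>x\<in>ob C. Q x) \<longleftrightarrow> (\<forall>x\<in>elts (Mor C). app (Src C) x = x \<longrightarrow> Q x)"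
  "(\<exists>x\<in>ob C. Q x) \<longleftrightarrow> (\<exists>x\<in>elts (Mor C). app (Src C) x = x \<and> Q x)"
  by (auto simp: ob_def mor_def src_def)

text \<open>\<open>hom\<close> and \<open>ob\<close> are HOL sets and not terms of the language.
  Unfolded in this way, every quantifier ranges over the elements of a component and every operation
  is an application of a component, as the closure rules for formulas require.\<close>

lemmas bounded = hom_bounded ob_bounded mor_def src_def tgt_def cmp_def add_def shift_def dist_def
  triangle_def iso_def triangle_mor_def

context enlarged
begin

abbreviation enl where "enl T \<equiv> enlarge star T"

lemma enlarge_sel [simp]:
  "Mor (enl T) = star (Mor T)" "Src (enl T) = star (Src T)" "Tgt (enl T) = star (Tgt T)"
  "Cmp (enl T) = star (Cmp T)" "Add (enl T) = star (Add T)" "Shift (enl T) = star (Shift T)"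
  "Tri (enl T) = star (Tri T)"
  by (simp_all add: enlarge_def)

definition std_cat :: "'v tri_cat \<Rightarrow> bool" where
  "std_cat T \<longleftrightarrow> std (Mor T) \<and> std (Src T) \<and> std (Tgt T) \<and> std (Cmp T) \<and> std (Add T) \<and>
     std (Shift T) \<and> std (Tri T)"

lemma std_catD:
  assumes "std_cat T"
  shows "Mor T \<in> hat S" "Src T \<in> hat S" "Tgt T \<in> hat S" "Cmp T \<in> hat S" "Add T \<in> hat S"
    "Shift T \<in> hat S" "Tri T \<in> hat S"
  using assms by (simp_all add: std_cat_def std_def)

text \<open>Every component is a binary or ternary relation on the morphisms, so it sits a fixed
  number of levels above \<open>Mor T\<close>; this is why smallness is imposed on
  \<open>Mor T\<close> only.\<close>

lemma std_catI:
  assumes "std (Mor T)" "well_typed T"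
  shows "std_cat T"
  using assms std_pairs[OF assms(1) assms(1)] std_triples[OF assms(1)]
  unfolding std_cat_def well_typed_def is_function_def is_relation3_def by blast

lemma well_typed_enlarge:
  assumes "std_cat T" "well_typed T"
  shows "well_typed (enl T)"
  using assms is_function_star is_relation3_star atom_star unfolding well_typed_def std_cat_def by simp

lemma category_laws_enlarge:
  assumes "std_cat T"
  shows "category_laws T \<longleftrightarrow> category_laws (enl T)"
  unfolding category_laws_def bounded enlarge_sel
  by (rule transfer) (intro frm_intros; simp add: std_catD[OF assms])

lemma preadditive_laws_enlarge:
  assumes "std_cat T"
  shows "preadditive_laws T \<longleftrightarrow> preadditive_laws (enl T)"
  unfolding preadditive_laws_def bounded enlarge_sel
  by (rule transfer) (intro frm_intros; simp add: std_catD[OF assms])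

lemma additive_laws_enlarge:
  assumes "std_cat T"
  shows "additive_laws T \<longleftrightarrow> additive_laws (enl T)"
  unfolding additive_laws_def zero_object_law_def biproduct_law_def bounded enlarge_sel
  by (rule transfer) (intro frm_intros; simp add: std_catD[OF assms])

lemma shift_laws_enlarge:
  assumes "std_cat T"
  shows "shift_laws T \<longleftrightarrow> shift_laws (enl T)"
  unfolding shift_laws_def bounded enlarge_sel
  by (rule transfer) (intro frm_intros; simp add: std_catD[OF assms])

lemma triangle_laws_enlarge:
  assumes "std_cat T"
  shows "triangle_laws T \<longleftrightarrow> triangle_laws (enl T)"
  unfolding triangle_laws_def zero_object_law_def bounded enlarge_sel
  by (rule transfer) (intro frm_intros; simp add: std_catD[OF assms])

lemma rotation_laws_enlarge:
  assumes "std_cat T"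
  shows "rotation_laws T \<longleftrightarrow> rotation_laws (enl T)"
  unfolding rotation_laws_def bounded enlarge_sel
  by (rule transfer) (intro frm_intros; simp add: std_catD[OF assms])

lemma octahedral_law_enlarge:
  assumes "std_cat T"
  shows "octahedral_law T \<longleftrightarrow> octahedral_law (enl T)"
  unfolding octahedral_law_def bounded enlarge_sel
  by (rule transfer) (intro frm_intros; simp add: std_catD[OF assms])

lemma triangulated_enlarge:
  assumes "std (Mor T)" "triangulated T"
  shows "triangulated (enl T)"
proof -
  have "std_cat T" using std_catI assms unfolding triangulated_iff_laws by blast
  then show ?thesis
    using assms(2) well_typed_enlarge category_laws_enlarge preadditive_laws_enlarge
      additive_laws_enlarge shift_laws_enlarge triangle_laws_enlarge rotation_laws_enlarge
      octahedral_law_enlarge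
    unfolding triangulated_iff_laws by blast
qed

end

section \<open>The quotient in bounded form\<close>

definition thick_laws :: "'v::zermelo tri_cat \<Rightarrow> 'v tri_cat \<Rightarrow> bool" where
  "thick_laws T D \<longleftrightarrow>
     (\<exists>z\<in>ob D. zero_object_law T z) \<and>
     (\<forall>a\<in>mor T. iso T a \<and> src T a \<in> ob D \<longrightarrow> tgt T a \<in> ob D) \<and>
     (\<forall>x\<in>ob T. x \<in> ob D \<longleftrightarrow> shift T x \<in> ob D) \<and>
     (\<forall>f\<in>mor T. \<forall>g\<in>mor T. \<forall>h\<in>mor T.
        dist T f g h \<and> src T f \<in> ob D \<and> tgt T f \<in> ob D \<longrightarrow> tgt T g \<in> ob D) \<and>
     (\<forall>x\<in>ob T. \<forall>y\<in>ob T. \<forall>b\<in>mor T. \<forall>i\<in>mor T. \<forall>j\<in>mor T. \<forall>p\<in>mor T. \<forall>q\<in>mor T.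
        biproduct_law T x y b i j p q \<and> b \<in> ob D \<longrightarrow> x \<in> ob D)"

lemma thick_iff_laws: "thick T D \<longleftrightarrow> triangulated T \<and> full_subcategory T D \<and> thick_laws T D"
proof (cases "triangulated T")
  case True
  then interpret pretri T unfolding triangulated_iff by blast
  have 1: "(\<forall>a. iso T a \<and> src T a \<in> ob D \<longrightarrow> tgt T a \<in> ob D) \<longleftrightarrow>
      (\<forall>a\<in>mor T. iso T a \<and> src T a \<in> ob D \<longrightarrow> tgt T a \<in> ob D)"
    unfolding iso_def by blast
  have 2: "(\<forall>f g h. dist T f g h \<and> src T f \<in> ob D \<and> tgt T f \<in> ob D \<longrightarrow> tgt T g \<in> ob D) \<longleftrightarrow>
      (\<forall>f\<in>mor T. \<forall>g\<in>mor T. \<forall>h\<in>mor T.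
        dist T f g h \<and> src T f \<in> ob D \<and> tgt T f \<in> ob D \<longrightarrow> tgt T g \<in> ob D)"
    using distD(1-3) by blast
  have 3: "(\<forall>b i j p q. biproduct T x y b i j p q \<and> b \<in> ob D \<longrightarrow> x \<in> ob D) \<longleftrightarrow>
      (\<forall>b\<in>mor T. \<forall>i\<in>mor T. \<forall>j\<in>mor T. \<forall>p\<in>mor T. \<forall>q\<in>mor T.
        biproduct_law T x y b i j p q \<and> b \<in> ob D \<longrightarrow> x \<in> ob D)" if "x \<in> ob T" "y \<in> ob T" for x y
  proof -
    have "biproduct_law T x y b i j p q \<Longrightarrow>
        b \<in> mor T \<and> i \<in> mor T \<and> j \<in> mor T \<and> p \<in> mor T \<and> q \<in> mor T" for b i j p q
      unfolding biproduct_law_def ob_def hom_def by blast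
    then show ?thesis unfolding biproduct_iff_law[OF preadditive that] by blast
  qed
  have "(\<forall>x\<in>ob T. \<forall>y\<in>ob T. \<forall>b i j p q. biproduct T x y b i j p q \<and> b \<in> ob D \<longrightarrow> x \<in> ob D) \<longleftrightarrow>
      (\<forall>x\<in>ob T. \<forall>y\<in>ob T. \<forall>b\<in>mor T. \<forall>i\<in>mor T. \<forall>j\<in>mor T. \<forall>p\<in>mor T. \<forall>q\<in>mor T.
        biproduct_law T x y b i j p q \<and> b \<in> ob D \<longrightarrow> x \<in> ob D)"
    by (intro ball_cong refl 3)
  then show ?thesis
    unfolding thick_def triangulated_subcategory_def thick_laws_def zero_object_iff_law 1 2
    by (simp only: conj_assoc)
qed (simp add: thick_def triangulated_subcategory_def)

text \<open>The condition that s is a morphism is split off from \<open>cone_in\<close>, since the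
  bounded quantifiers over s or the typing of a composite supply it.\<close>

definition cone_law :: "'v::zermelo tri_cat \<Rightarrow> 'v tri_cat \<Rightarrow> 'v \<Rightarrow> bool" where
  "cone_law T D s \<longleftrightarrow> (\<exists>g\<in>mor T. \<exists>h\<in>mor T. dist T s g h \<and> tgt T g \<in> ob D)"

definition roof_equiv_law :: "'v::zermelo tri_cat \<Rightarrow> 'v tri_cat \<Rightarrow> 'v \<Rightarrow> 'v \<Rightarrow> 'v \<Rightarrow> 'v \<Rightarrow> bool" where
  "roof_equiv_law T D s f s' f' \<longleftrightarrow>
     (cone_law T D s \<and> src T f = src T s) \<and> (cone_law T D s' \<and> src T f' = src T s') \<and>
     tgt T s = tgt T s' \<and> tgt T f = tgt T f' \<and>
     (\<exists>w\<in>ob T. \<exists>u \<in> hom T w (src T s). \<exists>v \<in> hom T w (src T s').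
        cone_law T D (cmp T s u) \<and> cmp T s u = cmp T s' v \<and> cmp T f u = cmp T f' v)"

text \<open>\<open>X = {t s f | s, f \<in> M, P s f}\<close> and its analogues with more parameters, spelled out
  with bounded quantifiers.\<close>

definition describes2 :: "'v set \<Rightarrow> ('v \<Rightarrow> 'v \<Rightarrow> bool) \<Rightarrow> ('v \<Rightarrow> 'v \<Rightarrow> 'v) \<Rightarrow> 'v::zermelo \<Rightarrow> bool" where
  "describes2 M P t X \<longleftrightarrow> (\<forall>z\<in>elts X. \<exists>s\<in>M. \<exists>f\<in>M. P s f \<and> z = t s f) \<and>
     (\<forall>s\<in>M. \<forall>f\<in>M. P s f \<longrightarrow> t s f \<in> elts X)"

definition describes3 ::
  "'v set \<Rightarrow> ('v \<Rightarrow> 'v \<Rightarrow> 'v \<Rightarrow> bool) \<Rightarrow> ('v \<Rightarrow> 'v \<Rightarrow> 'v \<Rightarrow> 'v) \<Rightarrow> 'v::zermelo \<Rightarrow> bool" where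
  "describes3 M P t X \<longleftrightarrow> (\<forall>z\<in>elts X. \<exists>a\<in>M. \<exists>b\<in>M. \<exists>c\<in>M. P a b c \<and> z = t a b c) \<and>
     (\<forall>a\<in>M. \<forall>b\<in>M. \<forall>c\<in>M. P a b c \<longrightarrow> t a b c \<in> elts X)"

definition describes6 ::
  "'v set \<Rightarrow> ('v \<Rightarrow> 'v \<Rightarrow> 'v \<Rightarrow> 'v \<Rightarrow> 'v \<Rightarrow> 'v \<Rightarrow> bool) \<Rightarrow> ('v \<Rightarrow> 'v \<Rightarrow> 'v \<Rightarrow> 'v \<Rightarrow> 'v \<Rightarrow> 'v \<Rightarrow> 'v) \<Rightarrow>
     'v::zermelo \<Rightarrow> bool" where
  "describes6 M P t X \<longleftrightarrow>
     (\<forall>z\<in>elts X. \<exists>s\<in>M. \<exists>f\<in>M. \<exists>r\<in>M. \<exists>g\<in>M. \<exists>u\<in>M. \<exists>w\<in>M. P s f r g u w \<and> z = t s f r g u w) \<and>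
     (\<forall>s\<in>M. \<forall>f\<in>M. \<forall>r\<in>M. \<forall>g\<in>M. \<forall>u\<in>M. \<forall>w\<in>M. P s f r g u w \<longrightarrow> t s f r g u w \<in> elts X)"

lemma describes2_iff: "describes2 M P t X \<longleftrightarrow> elts X = {t s f | s f. s \<in> M \<and> f \<in> M \<and> P s f}"
  unfolding describes2_def set_eq_iff mem_Collect_eq by (intro iffI conjI ballI allI; metis)

lemma describes3_iff:
  "describes3 M P t X \<longleftrightarrow> elts X = {t a b c | a b c. a \<in> M \<and> b \<in> M \<and> c \<in> M \<and> P a b c}"
  unfolding describes3_def set_eq_iff mem_Collect_eq by (intro iffI conjI ballI allI; metis)

lemma describes6_iff:
  "describes6 M P t X \<longleftrightarrow> elts X = {t s f r g u w | s f r g u w.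
     s \<in> M \<and> f \<in> M \<and> r \<in> M \<and> g \<in> M \<and> u \<in> M \<and> w \<in> M \<and> P s f r g u w}"
  unfolding describes6_def set_eq_iff mem_Collect_eq by (intro iffI conjI ballI allI; metis)

text \<open>The constant \<open>k\<close> stands for the set-theoretic function
  \<open>(s, f) \<mapsto> roof_class T D s f\<close>, so that classes become terms of the formal language.\<close>

definition class_law :: "'v::zermelo tri_cat \<Rightarrow> 'v tri_cat \<Rightarrow> 'v \<Rightarrow> 'v \<Rightarrow> bool" where
  "class_law T D k c \<longleftrightarrow> (\<forall>s\<in>mor T. \<forall>f\<in>mor T. app k (opair s f) \<in> elts c \<and>
     describes2 (mor T) (roof_equiv_law T D s f) opair (app k (opair s f)))"

definition fills_law :: "'v::zermelo tri_cat \<Rightarrow> 'v tri_cat \<Rightarrow> 'v \<Rightarrow> 'v \<Rightarrow> 'v \<Rightarrow> 'v \<Rightarrow> 'v \<Rightarrow> 'v \<Rightarrow> bool" where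
  "fills_law T D s f r g u w \<longleftrightarrow> cone_law T D s \<and> src T f = src T s \<and> cone_law T D r \<and>
     src T g = src T r \<and> tgt T r = tgt T f \<and> cone_law T D u \<and> src T u = src T w \<and>
     tgt T u = src T s \<and> tgt T w = src T r \<and> cmp T f u = cmp T r w"

definition quotient_cat_laws :: "'v::zermelo tri_cat \<Rightarrow> 'v tri_cat \<Rightarrow> 'v \<Rightarrow> 'v tri_cat \<Rightarrow> bool" where
  "quotient_cat_laws T D k Q \<longleftrightarrow>
     describes2 (mor T) (\<lambda>s f. cone_law T D s \<and> src T f = src T s)
       (\<lambda>s f. app k (opair s f)) (Mor Q) \<and>
     describes2 (mor T) (\<lambda>s f. cone_law T D s \<and> src T f = src T s)
       (\<lambda>s f. opair (app k (opair s f)) (app k (opair (tgt T s) (tgt T s)))) (Src Q) \<and>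
     describes2 (mor T) (\<lambda>s f. cone_law T D s \<and> src T f = src T s)
       (\<lambda>s f. opair (app k (opair s f)) (app k (opair (tgt T f) (tgt T f)))) (Tgt Q) \<and>
     describes6 (mor T) (fills_law T D)
       (\<lambda>s f r g u w. triple (app k (opair r g)) (app k (opair s f))
          (app k (opair (cmp T s u) (cmp T g w)))) (Cmp Q) \<and>
     describes3 (mor T) (\<lambda>s f g. cone_law T D s \<and> src T f = src T s \<and>
          src T g = src T s \<and> tgt T f = tgt T g)
       (\<lambda>s f g. triple (app k (opair s f)) (app k (opair s g)) (app k (opair s (add T f g)))) (Add Q) \<and>
     describes2 (mor T) (\<lambda>s f. cone_law T D s \<and> src T f = src T s)
       (\<lambda>s f. opair (app k (opair s f)) (app k (opair (shift T s) (shift T f)))) (Shift Q)"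

text \<open>Applied to the identity of the source and f, k yields the image of f under the quotient
  functor. The isomorphism of triangles is unfolded so that its three components are bounded as
  well.\<close>

definition quotient_tri_law :: "'v::zermelo tri_cat \<Rightarrow> 'v \<Rightarrow> 'v tri_cat \<Rightarrow> bool" where
  "quotient_tri_law T k Q \<longleftrightarrow> describes3 (mor Q) (\<lambda>a b c. triangle Q a b c \<and>
     (\<exists>f\<in>mor T. \<exists>g\<in>mor T. \<exists>h\<in>mor T. dist T f g h \<and>
        (\<exists>i\<in>mor Q. \<exists>j\<in>mor Q. \<exists>l\<in>mor Q. iso Q i \<and> iso Q j \<and> iso Q l \<and>
           triangle_mor Q (app k (opair (src T f) f)) (app k (opair (src T g) g))
             (app k (opair (src T h) h)) a b c i j l))) triple (Tri Q)"

text \<open>Each law fixes the elements of one component, and \<open>well_typed\<close> excludes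
  urelements, so extensionality applies componentwise.\<close>

lemma quotient_laws_unique:
  assumes l: "quotient_cat_laws T D k Q" "quotient_cat_laws T D k Q'"
    and t: "quotient_tri_law T k Q" "quotient_tri_law T k Q'" and wt: "well_typed Q" "well_typed Q'"
  shows "Q = Q'"
proof -
  have na: "\<not> atom (Mor Q)" "\<not> atom (Src Q)" "\<not> atom (Tgt Q)" "\<not> atom (Cmp Q)" "\<not> atom (Add Q)"
    "\<not> atom (Shift Q)" "\<not> atom (Tri Q)" "\<not> atom (Mor Q')" "\<not> atom (Src Q')" "\<not> atom (Tgt Q')"
    "\<not> atom (Cmp Q')" "\<not> atom (Add Q')" "\<not> atom (Shift Q')" "\<not> atom (Tri Q')"
    using wt unfolding well_typed_def is_function_def is_relation3_def by blast+
  note d = l[unfolded quotient_cat_laws_def describes2_iff describes3_iff describes6_iff]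
  have eq: "Mor Q = Mor Q'" "Src Q = Src Q'" "Tgt Q = Tgt Q'" "Cmp Q = Cmp Q'" "Add Q = Add Q'"
    "Shift Q = Shift Q'"
    by (rule set_ext, rule na, rule na, simp only: d)+
  \<comment> \<open>The law for \<open>Tri\<close> speaks of triangles and isomorphisms in Q itself,
    so it becomes conclusive only once the other components are known to agree.\<close>
  have "elts (Tri Q) = elts (Tri Q')"
    unfolding t[unfolded quotient_tri_law_def describes3_iff] bounded eq ..
  then have "Tri Q = Tri Q'" by (rule set_ext[OF na(7,14)])
  then show ?thesis using eq by (cases Q, cases Q') simp
qed

context verdier
begin

lemma cone_iff_law: "s \<in> W \<longleftrightarrow> s \<in> mor T \<and> cone_law T D s"
  unfolding cone_in_def cone_law_def using distD(1-3) by blast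

lemma roof_equiv_iff_law:
  "roof_equiv T D s f s' f' \<longleftrightarrow> s \<in> mor T \<and> f \<in> mor T \<and> s' \<in> mor T \<and> f' \<in> mor T \<and>
     roof_equiv_law T D s f s' f'"
proof -
  have "s \<cdot> u \<in> W \<longleftrightarrow> cone_law T D (s \<cdot> u)" if "s \<in> mor T" "u \<in> hom T w (src T s)" for u w
    using that cone_iff_law by (simp add: hom_def)
  then show ?thesis
    unfolding roof_equiv_def roof_equiv_law_def roof_iff cone_iff_law[of s] cone_iff_law[of s'] by blast
qed

lemma fills_iff_law:
  "fills s f r g u w \<longleftrightarrow> s \<in> mor T \<and> f \<in> mor T \<and> r \<in> mor T \<and> g \<in> mor T \<and> u \<in> mor T \<and> w \<in> mor T \<and>
     fills_law T D s f r g u w"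
  unfolding fills_def fills_law_def cone_iff_law by blast

lemma quotient_cat_laws_Q:
  assumes k: "\<And>s f. s \<in> mor T \<Longrightarrow> f \<in> mor T \<Longrightarrow> app k (opair s f) = K s f"
  shows "quotient_cat_laws T D k Q"
proof -
  have kF: "app k (opair x x) = F x" if "x \<in> ob T" for x using that by (simp add: F_ob k)
  have "elts (Mor Q) = {K s f | s f. s \<in> W \<and> f \<in> mor T \<and> src T f = src T s}"
    using mor_Q by (simp only: mor_def)
  also have "\<dots> = {app k (opair s f) | s f. s \<in> mor T \<and> f \<in> mor T \<and> cone_law T D s \<and> src T f = src T s}"
    unfolding cone_iff_law by (rule Collect_cong, intro iff_exI) (use k in metis)
  finally have 1: "elts (Mor Q) =
    {app k (opair s f) | s f. s \<in> mor T \<and> f \<in> mor T \<and> cone_law T D s \<and> src T f = src T s}" .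
  have 2: "elts (Src Q) = {opair (app k (opair s f)) (app k (opair (tgt T s) (tgt T s))) | s f.
      s \<in> mor T \<and> f \<in> mor T \<and> cone_law T D s \<and> src T f = src T s}"
    unfolding elts_Src_Q cone_iff_law
    by (rule Collect_cong, intro iff_exI) (use k kF src_tgt_ob(2) in metis)
  have 3: "elts (Tgt Q) = {opair (app k (opair s f)) (app k (opair (tgt T f) (tgt T f))) | s f.
      s \<in> mor T \<and> f \<in> mor T \<and> cone_law T D s \<and> src T f = src T s}"
    unfolding elts_Tgt_Q cone_iff_law
    by (rule Collect_cong, intro iff_exI) (use k kF src_tgt_ob(2) in metis)
  have 4: "elts (Cmp Q) = {triple (app k (opair r g)) (app k (opair s f))
      (app k (opair (s \<cdot> u) (g \<cdot> w))) | s f r g u w. s \<in> mor T \<and> f \<in> mor T \<and> r \<in> mor T \<and>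
      g \<in> mor T \<and> u \<in> mor T \<and> w \<in> mor T \<and> fills_law T D s f r g u w}"
    unfolding elts_Cmp_Q
  proof (rule Collect_cong, intro iff_exI)
    fix z s f r g u w
    have "app k (opair r g) = K r g" "app k (opair s f) = K s f"
      "app k (opair (s \<cdot> u) (g \<cdot> w)) = K (s \<cdot> u) (g \<cdot> w)" if c: "fills s f r g u w"
      using fillsD(1-12)[OF c] by (simp_all add: k)
    then show "(z = triple (K r g) (K s f) (K (s \<cdot> u) (g \<cdot> w)) \<and> fills s f r g u w) \<longleftrightarrow>
      (z = triple (app k (opair r g)) (app k (opair s f)) (app k (opair (s \<cdot> u) (g \<cdot> w))) \<and>
       s \<in> mor T \<and> f \<in> mor T \<and> r \<in> mor T \<and> g \<in> mor T \<and> u \<in> mor T \<and> w \<in> mor T \<and>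
       fills_law T D s f r g u w)"
      unfolding fills_iff_law[symmetric] by (cases "fills s f r g u w") simp_all
  qed
  have 5: "elts (Add Q) = {triple (app k (opair s f)) (app k (opair s g)) (app k (opair s (f \<oplus> g))) | s f g.
      s \<in> mor T \<and> f \<in> mor T \<and> g \<in> mor T \<and> cone_law T D s \<and> src T f = src T s \<and>
      src T g = src T s \<and> tgt T f = tgt T g}"
    unfolding elts_Add_Q cone_iff_law
    by (rule Collect_cong, intro iff_exI) (use k add_mor(1) in metis)
  have 6: "elts (Shift Q) = {opair (app k (opair s f)) (app k (opair (shift T s) (shift T f))) | s f.
      s \<in> mor T \<and> f \<in> mor T \<and> cone_law T D s \<and> src T f = src T s}"
    unfolding elts_Shift_Q cone_iff_law
    by (rule Collect_cong, intro iff_exI) (use k shift_mor in metis)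
  show ?thesis
    unfolding quotient_cat_laws_def describes2_iff describes3_iff describes6_iff
    using 1 2 3 4 5 6 by blast
qed

lemma quotient_tri_law_Q:
  assumes k: "\<And>s f. s \<in> mor T \<Longrightarrow> f \<in> mor T \<Longrightarrow> app k (opair s f) = K s f"
  shows "quotient_tri_law T k Q"
proof -
  have kF: "app k (opair (src T f) f) = F f" if "f \<in> mor T" for f using that by (simp add: F_def k)
  let ?P = "\<lambda>a b c. triangle Q a b c \<and>
     (\<exists>f\<in>mor T. \<exists>g\<in>mor T. \<exists>h\<in>mor T. dist T f g h \<and>
        (\<exists>i\<in>mor Q. \<exists>j\<in>mor Q. \<exists>l\<in>mor Q. iso Q i \<and> iso Q j \<and> iso Q l \<and>
           triangle_mor Q (app k (opair (src T f) f)) (app k (opair (src T g) g))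
             (app k (opair (src T h) h)) a b c i j l))"
  have iso: "(\<exists>i\<in>mor Q. \<exists>j\<in>mor Q. \<exists>l\<in>mor Q. iso Q i \<and> iso Q j \<and> iso Q l \<and>
           triangle_mor Q (app k (opair (src T f) f)) (app k (opair (src T g) g))
             (app k (opair (src T h) h)) a b c i j l) \<longleftrightarrow> triangle_iso Q (F f) (F g) (F h) a b c"
    if "dist T f g h" for f g h a b c
    unfolding triangle_iso_def kF[OF distD(1)[OF that]] kF[OF distD(2)[OF that]]
      kF[OF distD(3)[OF that]] using Q.iso_mor by blast
  have P: "dist Q a b c \<longleftrightarrow> ?P a b c" for a b c
  proof -
    have "(\<exists>f\<in>mor T. \<exists>g\<in>mor T. \<exists>h\<in>mor T. dist T f g h \<and> Y f g h) \<longleftrightarrow>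
        (\<exists>f g h. dist T f g h \<and> X f g h)"
      if "\<And>f g h. dist T f g h \<Longrightarrow> Y f g h \<longleftrightarrow> X f g h" for X Y :: "'v \<Rightarrow> 'v \<Rightarrow> 'v \<Rightarrow> bool"
      using that distD(1-3) by blast
    from this[OF iso] show ?thesis unfolding dist_Q_iff by (simp only:)
  qed
  have "z \<in> elts (Tri Q) \<longleftrightarrow> (\<exists>a b c. z = triple a b c \<and> dist Q a b c)" for z
    using relation3_Tri_Q unfolding dist_def is_relation3_def triples_def by blast
  moreover have "dist Q a b c \<Longrightarrow> a \<in> mor Q \<and> b \<in> mor Q \<and> c \<in> mor Q" for a b c
    using Q.distD(1-3) by blast
  ultimately have "elts (Tri Q) = {triple a b c | a b c. a \<in> mor Q \<and> b \<in> mor Q \<and> c \<in> mor Q \<and> dist Q a b c}"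
    by blast
  then show ?thesis unfolding quotient_tri_law_def describes3_iff P .
qed

end

section \<open>Full and thick subcategories under the enlargement\<close>

context enlarged
begin

text \<open>Both inclusions between the restriction and its description are transferred. The star of
  a set is no urelement, so its elements determine it.\<close>

lemma restrict_star:
  assumes std: "std R" "std A"
  shows "star (mkset (elts R \<inter> pairs (elts A) (elts A))) =
    mkset (elts (star R) \<inter> pairs (elts (star A)) (elts (star A)))"
proof -
  define X where "X = mkset (elts R \<inter> pairs (elts A) (elts A))"
  have "small (elts R \<inter> pairs (elts A) (elts A))" by (rule small_subset[OF small_elts[of R]]) blast
  from mkset_works[OF this, folded X_def] have X: "\<not> atom X" "elts X = elts R \<inter> pairs (elts A) (elts A)" by blast+
  have sX: "std X" by (rule std_subset[OF std(1) X(1)]) (simp add: X(2))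
  note [simp] = std[THEN std_hat] sX[THEN std_hat]
  have "(\<forall>z\<in>elts X. z \<in> elts R \<and> (\<exists>x\<in>elts A. \<exists>y\<in>elts A. z = opair x y)) \<and>
      (\<forall>x\<in>elts A. \<forall>y\<in>elts A. opair x y \<in> elts R \<longrightarrow> opair x y \<in> elts X) \<longleftrightarrow>
    (\<forall>z\<in>elts (star X). z \<in> elts (star R) \<and> (\<exists>x\<in>elts (star A). \<exists>y\<in>elts (star A). z = opair x y)) \<and>
      (\<forall>x\<in>elts (star A). \<forall>y\<in>elts (star A). opair x y \<in> elts (star R) \<longrightarrow> opair x y \<in> elts (star X))"
    by (rule transfer) (intro frm_intros; simp)
  moreover have "(\<forall>z\<in>elts X. z \<in> elts R \<and> (\<exists>x\<in>elts A. \<exists>y\<in>elts A. z = opair x y)) \<and>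
      (\<forall>x\<in>elts A. \<forall>y\<in>elts A. opair x y \<in> elts R \<longrightarrow> opair x y \<in> elts X)"
    unfolding X(2) pairs_def by blast
  ultimately have "elts (star X) = elts (star R) \<inter> pairs (elts (star A)) (elts (star A))"
    unfolding pairs_def by blast
  then show ?thesis using mkset_elts[OF atom_star[OF sX]] unfolding X_def by simp
qed

lemma restrict3_star:
  assumes std: "std R" "std A"
  shows "star (mkset (elts R \<inter> triples (elts A))) = mkset (elts (star R) \<inter> triples (elts (star A)))"
proof -
  define X where "X = mkset (elts R \<inter> triples (elts A))"
  have "small (elts R \<inter> triples (elts A))" by (rule small_subset[OF small_elts[of R]]) blast
  from mkset_works[OF this, folded X_def] have X: "\<not> atom X" "elts X = elts R \<inter> triples (elts A)" by blast+
  have sX: "std X" by (rule std_subset[OF std(1) X(1)]) (simp add: X(2))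
  note [simp] = std[THEN std_hat] sX[THEN std_hat]
  have "(\<forall>z\<in>elts X. z \<in> elts R \<and> (\<exists>x\<in>elts A. \<exists>y\<in>elts A. \<exists>w\<in>elts A. z = triple x y w)) \<and>
      (\<forall>x\<in>elts A. \<forall>y\<in>elts A. \<forall>w\<in>elts A. triple x y w \<in> elts R \<longrightarrow> triple x y w \<in> elts X) \<longleftrightarrow>
    (\<forall>z\<in>elts (star X). z \<in> elts (star R) \<and>
      (\<exists>x\<in>elts (star A). \<exists>y\<in>elts (star A). \<exists>w\<in>elts (star A). z = triple x y w)) \<and>
      (\<forall>x\<in>elts (star A). \<forall>y\<in>elts (star A). \<forall>w\<in>elts (star A).
        triple x y w \<in> elts (star R) \<longrightarrow> triple x y w \<in> elts (star X))"
    by (rule transfer) (intro frm_intros; simp)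
  moreover have "(\<forall>z\<in>elts X. z \<in> elts R \<and> (\<exists>x\<in>elts A. \<exists>y\<in>elts A. \<exists>w\<in>elts A. z = triple x y w)) \<and>
      (\<forall>x\<in>elts A. \<forall>y\<in>elts A. \<forall>w\<in>elts A. triple x y w \<in> elts R \<longrightarrow> triple x y w \<in> elts X)"
    unfolding X(2) triples_def by blast
  ultimately have "elts (star X) = elts (star R) \<inter> triples (elts (star A))"
    unfolding triples_def by blast
  then show ?thesis using mkset_elts[OF atom_star[OF sX]] unfolding X_def by simp
qed

text \<open>Everything in a full subcategory besides its morphisms is a restriction of a component
  of T: a subset of a standard set, and with a star that is again a restriction.\<close>

lemma
  assumes T: "std_cat T" and D: "full_subcategory T D"
  shows std_full_subcategory: "std_cat D"
    and full_subcategory_enlarge: "full_subcategory (enl T) (enl D)"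
proof -
  have na: "\<not> atom (Mor D)" and sub: "mor D \<subseteq> mor T"
    and full: "\<forall>f\<in>mor T. f \<in> mor D \<longleftrightarrow> src T f \<in> mor D \<and> tgt T f \<in> mor D"
    and eqs: "Src D = mkset (elts (Src T) \<inter> pairs (mor D) (mor D))"
      "Tgt D = mkset (elts (Tgt T) \<inter> pairs (mor D) (mor D))"
      "Cmp D = mkset (elts (Cmp T) \<inter> triples (mor D))"
      "Add D = mkset (elts (Add T) \<inter> triples (mor D))"
      "Shift D = mkset (elts (Shift T) \<inter> pairs (mor D) (mor D))"
      "Tri D = mkset (elts (Tri T) \<inter> triples (mor D))"
    using D unfolding full_subcategory_def by blast+
  note sT = T[unfolded std_cat_def]
  have M: "std (Mor D)" by (rule std_subset[of "Mor T"]) (use sT na sub in \<open>auto simp: mor_def\<close>)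
  have "std (mkset (elts R \<inter> B))" if "std R" for R B
  proof -
    have "small (elts R \<inter> B)" by (rule small_subset[OF small_elts[of R]]) blast
    from mkset_works[OF this] show ?thesis by (intro std_subset[OF that]) auto
  qed
  then show "std_cat D" unfolding std_cat_def eqs using M sT by blast
  note [simp] = std_catD[OF T] std_hat[OF M]
  have "(\<forall>f\<in>elts (Mor D). f \<in> elts (Mor T)) \<and>
      (\<forall>f\<in>mor T. f \<in> mor D \<longleftrightarrow> src T f \<in> mor D \<and> tgt T f \<in> mor D) \<longleftrightarrow>
    (\<forall>f\<in>elts (star (Mor D)). f \<in> elts (star (Mor T))) \<and>
      (\<forall>f\<in>mor (enl T). f \<in> mor (enl D) \<longleftrightarrow> src (enl T) f \<in> mor (enl D) \<and> tgt (enl T) f \<in> mor (enl D))"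
    unfolding bounded enlarge_sel by (rule transfer) (intro frm_intros; simp)
  then have "mor (enl D) \<subseteq> mor (enl T)"
    "\<forall>f\<in>mor (enl T). f \<in> mor (enl D) \<longleftrightarrow> src (enl T) f \<in> mor (enl D) \<and> tgt (enl T) f \<in> mor (enl D)"
    using sub full unfolding mor_def enlarge_sel by blast+
  then show "full_subcategory (enl T) (enl D)"
    unfolding full_subcategory_def mor_def enlarge_sel eqs[unfolded mor_def]
    using sT M atom_star[OF M] by (simp add: restrict_star restrict3_star)
qed

lemma thick_laws_enlarge:
  assumes T: "std_cat T" and D: "std_cat D"
  shows "thick_laws T D \<longleftrightarrow> thick_laws (enl T) (enl D)"
  unfolding thick_laws_def zero_object_law_def biproduct_law_def bounded enlarge_sel
  by (rule transfer) (intro frm_intros; simp add: std_catD[OF T] std_catD[OF D])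

lemma thick_enlarge:
  assumes "std (Mor T)" "thick T D"
  shows "thick (enl T) (enl D)"
proof -
  have t: "triangulated T" "full_subcategory T D" "thick_laws T D"
    using assms(2) unfolding thick_iff_laws by blast+
  have "std_cat T" using std_catI assms(1) t(1) unfolding triangulated_iff_laws by blast
  then show ?thesis
    unfolding thick_iff_laws
    using triangulated_enlarge[OF assms(1) t(1)] full_subcategory_enlarge[OF _ t(2)]
      thick_laws_enlarge[OF _ std_full_subcategory[OF _ t(2)]] t(3) by blast
qed

end

section \<open>Enlargement of the quotient\<close>

context verdier
begin

lemma K_subset: "elts (K s f) \<subseteq> pairs (mor T) (mor T)"
  unfolding elts_K roof_equiv_def roof_iff by auto

lemma class_map:
  obtains k c where "\<not> atom k" "\<not> atom c" "elts c = {K s f | s f. s \<in> mor T \<and> f \<in> mor T}"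
    "elts k \<subseteq> pairs (pairs (mor T) (mor T)) (elts c)"
    "\<And>s f. s \<in> mor T \<Longrightarrow> f \<in> mor T \<Longrightarrow> app k (opair s f) = K s f"
proof -
  have M: "small (pairs (mor T) (mor T))" unfolding mor_def by (rule small_pairs) simp_all
  let ?C = "{K s f | s f. s \<in> mor T \<and> f \<in> mor T}"
  have "?C \<subseteq> {y. \<not> atom y \<and> elts y \<subseteq> pairs (mor T) (mor T)}" using atom_K K_subset by blast
  then have "small ?C" by (rule small_subset[OF small_power[OF M]])
  then obtain c where c: "\<not> atom c" "elts c = ?C" by (rule smallE)
  let ?G = "{opair (opair s f) (K s f) | s f. s \<in> mor T \<and> f \<in> mor T}"
  have sub: "?G \<subseteq> pairs (pairs (mor T) (mor T)) (elts c)"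
  proof
    fix z assume "z \<in> ?G"
    then obtain s f where "z = opair (opair s f) (K s f)" "s \<in> mor T" "f \<in> mor T" by blast
    then show "z \<in> pairs (pairs (mor T) (mor T)) (elts c)" unfolding c by auto
  qed
  then have "small ?G" by (rule small_subset[OF small_pairs[OF M small_elts]])
  then obtain k where k: "\<not> atom k" "elts k = ?G" by (rule smallE)
  have app: "app k (opair s f) = K s f" if "s \<in> mor T" "f \<in> mor T" for s f
  proof (rule app_eqI)
    show "opair (opair s f) (K s f) \<in> elts k" unfolding k using that by blast
    show "z = K s f" if "opair (opair s f) z \<in> elts k" for z
      using that unfolding k mem_Collect_eq opair_iff by blast
  qed
  show ?thesis using that[OF k(1) c(1,2) _ app] sub unfolding k(2) by blast
qed

lemma class_law_K:
  assumes k: "\<And>s f. s \<in> mor T \<Longrightarrow> f \<in> mor T \<Longrightarrow> app k (opair s f) = K s f"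
    and c: "elts c = {K s f | s f. s \<in> mor T \<and> f \<in> mor T}"
  shows "class_law T D k c"
  unfolding class_law_def describes2_iff
proof (intro ballI conjI)
  fix s f assume s: "s \<in> mor T" "f \<in> mor T"
  show "app k (opair s f) \<in> elts c" unfolding k[OF s] c using s by blast
  show "elts (app k (opair s f)) =
    {opair s' f' | s' f'. s' \<in> mor T \<and> f' \<in> mor T \<and> roof_equiv_law T D s f s' f'}"
    unfolding k[OF s] elts_K roof_equiv_iff_law by (rule Collect_cong, intro iff_exI) (use s in blast)
qed

text \<open>The law fixes a class only through its elements, and a urelement shares these with the
  empty class. Membership in c, all of whose members are sets, excludes this.\<close>

lemma class_law_unique:
  assumes l: "class_law T D k c" and na: "\<And>x. x \<in> elts c \<Longrightarrow> \<not> atom x" and s: "s \<in> mor T" "f \<in> mor T"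
  shows "app k (opair s f) = K s f"
proof (rule set_ext)
  have "app k (opair s f) \<in> elts c"
    and e: "elts (app k (opair s f)) =
      {opair s' f' | s' f'. s' \<in> mor T \<and> f' \<in> mor T \<and> roof_equiv_law T D s f s' f'}"
    using l s unfolding class_law_def describes2_iff by blast+
  then show "\<not> atom (app k (opair s f))" using na by blast
  show "elts (app k (opair s f)) = elts (K s f)"
    unfolding e elts_K roof_equiv_iff_law by (rule Collect_cong, intro iff_exI) (use s in blast)
qed (rule atom_K)

lemma well_typed_Q: "well_typed Q"
  using triangulated_Q unfolding triangulated_iff_laws by blast

lemma quotient_functor_eqI:
  assumes "is_function G (Mor T) (Mor Q)" "\<And>f. f \<in> mor T \<Longrightarrow> app G f = F f"
  shows "G = quotient_functor T D"
  by (rule is_function_ext[OF assms(1) quotient_functor_function])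
    (use assms(2) app_quotient_functor in \<open>simp add: mor_def\<close>)

end

lemma (in enlarged) class_law_enlarge:
  assumes T: "std_cat T" and D: "std_cat D" and k: "k \<in> hat S" "c \<in> hat S"
  shows "class_law T D k c \<longleftrightarrow> class_law (enl T) (enl D) (star k) (star c)"
  unfolding class_law_def describes2_def roof_equiv_law_def cone_law_def bounded enlarge_sel
  by (rule transfer) (intro frm_intros; simp add: std_catD[OF T] std_catD[OF D] k)

lemma (in enlarged) quotient_cat_laws_enlarge:
  assumes T: "std_cat T" and D: "std_cat D" and Q: "std_cat Q" and k: "k \<in> hat S"
  shows "quotient_cat_laws T D k Q \<longleftrightarrow> quotient_cat_laws (enl T) (enl D) (star k) (enl Q)"
  unfolding quotient_cat_laws_def describes2_def describes3_def describes6_def fills_law_def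
    cone_law_def bounded enlarge_sel
  by (rule transfer)
    (intro frm_intros; simp add: std_catD[OF T] std_catD[OF D] std_catD[OF Q] k)

lemma (in enlarged) quotient_tri_law_enlarge:
  assumes T: "std_cat T" and Q: "std_cat Q" and k: "k \<in> hat S"
  shows "quotient_tri_law T k Q \<longleftrightarrow> quotient_tri_law (enl T) (star k) (enl Q)"
  unfolding quotient_tri_law_def describes3_def bounded enlarge_sel
  by (rule transfer) (intro frm_intros; simp add: std_catD[OF T] std_catD[OF Q] k)

lemma verdier_thick: "thick T D \<Longrightarrow> verdier T D"
  unfolding thick_def by (simp add: verdier_def)

lemma (in enlarged)
  assumes M: "std (Mor T)" and th: "thick T D"
  shows enlarge_quotient: "enl (verdier_quotient T D) = verdier_quotient (enl T) (enl D)"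
    and star_quotient_functor: "star (quotient_functor T D) = quotient_functor (enl T) (enl D)"
proof -
  interpret V: verdier T D by (rule verdier_thick[OF th])
  interpret V': verdier "enl T" "enl D" by (rule verdier_thick[OF thick_enlarge[OF M th]])
  have tr: "triangulated T" "full_subcategory T D"
    using th unfolding thick_iff_laws by blast+
  have T: "std_cat T" using std_catI M tr(1) unfolding triangulated_iff_laws by blast
  have D: "std_cat D" by (rule std_full_subcategory[OF T tr(2)])
  obtain k c where kc: "\<not> atom k" "\<not> atom c" "elts c = {V.K s f | s f. s \<in> mor T \<and> f \<in> mor T}"
    "elts k \<subseteq> pairs (pairs (mor T) (mor T)) (elts c)"
    and k: "\<And>s f. s \<in> mor T \<Longrightarrow> f \<in> mor T \<Longrightarrow> app k (opair s f) = V.K s f"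
    by (rule V.class_map) blast
  \<comment> \<open>P, the square of the morphisms, is a standard set that contains every class; c
    and the morphisms of the quotient are therefore sets of subsets of P, and P is the domain of
    k.\<close>
  have "small (pairs (mor T) (mor T))" unfolding mor_def by (rule small_pairs) simp_all
  then obtain P where P: "\<not> atom P" "elts P = pairs (mor T) (mor T)" by (rule smallE)
  have sP: "std P" by (rule std_pairs[OF M M P(1)]) (simp add: P(2) mor_def)
  have K: "\<not> atom (V.K s f) \<and> elts (V.K s f) \<subseteq> elts P" for s f
    using V.atom_K V.K_subset unfolding P(2) by blast
  have "\<not> atom x \<and> elts x \<subseteq> elts P" if "x \<in> elts c" for x
    using that K unfolding kc(3) by blast
  then have sc: "std c" by (rule std_power[OF sP kc(2)])
  have sk: "std k" by (rule std_pairs[OF sP sc kc(1)]) (use kc(4) P(2) in simp)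
  have "\<not> atom x \<and> elts x \<subseteq> elts P" if "x \<in> elts (Mor V.Q)" for x
    using that K V.mor_QE[of x] unfolding mor_def[of V.Q] by metis
  then have "std (Mor V.Q)" by (rule std_power[OF sP V.atom_Mor_Q])
  then have Q: "std_cat V.Q" by (rule std_catI) (rule V.well_typed_Q)
  note h = std_hat[OF sk] std_hat[OF sc]
  have "class_law T D k c" using k kc(3) by (rule V.class_law_K)
  then have "class_law (enl T) (enl D) (star k) (star c)" using class_law_enlarge[OF T D h] by blast
  moreover have "\<not> atom x" if "x \<in> elts (star c)" for x
    by (rule atom_elts_star[OF h(2) _ that]) (use kc(3) V.atom_K in auto)
  \<comment> \<open>The transferred law and the absence of urelements from \<open>star c\<close>
    identify \<open>star k\<close> with the class map of the enlarged pair. Both quotients can now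
    be described over this one constant.\<close>
  ultimately have k': "app (star k) (opair s f) = V'.K s f"
    if "s \<in> mor (enl T)" "f \<in> mor (enl T)" for s f using that by (rule V'.class_law_unique)
  show eq: "enl V.Q = V'.Q"
  proof (rule quotient_laws_unique)
    show "quotient_cat_laws (enl T) (enl D) (star k) (enl V.Q)"
      using V.quotient_cat_laws_Q[OF k] quotient_cat_laws_enlarge[OF T D Q h(1)] by blast
    show "quotient_tri_law (enl T) (star k) (enl V.Q)"
      using V.quotient_tri_law_Q[OF k] quotient_tri_law_enlarge[OF T Q h(1)] by blast
    show "quotient_cat_laws (enl T) (enl D) (star k) V'.Q"
      using k' by (rule V'.quotient_cat_laws_Q)
    show "quotient_tri_law (enl T) (star k) V'.Q"
      using k' by (rule V'.quotient_tri_law_Q)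
    show "well_typed (enl V.Q)" by (rule well_typed_enlarge[OF Q V.well_typed_Q])
    show "well_typed V'.Q" by (rule V'.well_typed_Q)
  qed
  let ?q = "quotient_functor T D"
  have sQ: "std (Mor V.Q)" using Q unfolding std_cat_def by blast
  have fq: "is_function ?q (Mor T) (Mor V.Q)" by (rule V.quotient_functor_function)
  then have sq: "std ?q" using std_pairs[OF M sQ] unfolding is_function_def by blast
  note [simp] = std_catD[OF T] h std_hat[OF sq]
  show "star ?q = quotient_functor (enl T) (enl D)"
  proof (rule V'.quotient_functor_eqI)
    show "is_function (star ?q) (Mor (enl T)) (Mor V'.Q)"
      using is_function_star[OF sq M sQ fq] unfolding eq[symmetric] enlarge_sel .
    \<comment> \<open>The quotient functor is expressed through k, so that its star is computed from
      the values of \<open>star k\<close> found above.\<close>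
    have "\<forall>f\<in>mor T. app ?q f = app k (opair (src T f) f)"
      using V.app_quotient_functor by (simp add: k V.F_def)
    moreover have "(\<forall>f\<in>mor T. app ?q f = app k (opair (src T f) f)) \<longleftrightarrow>
      (\<forall>f\<in>mor (enl T). app (star ?q) f = app (star k) (opair (src (enl T) f) f))"
      unfolding bounded enlarge_sel by (rule transfer) (intro frm_intros; simp)
    ultimately show "app (star ?q) f = V'.F f" if "f \<in> mor (enl T)" for f
      using that by (simp add: k' V'.F_def)
  qed
qed

section \<open>The canonical functor\<close>

context verdier
begin

text \<open>A functor is a set of the universe, so even the identity has to be produced as a
  graph.\<close>

lemma identity_Q:
  obtains I where "triangulated_functor Q Q I" "is_function I (Mor Q) (Mor Q)"
    "\<And>a. a \<in> mor Q \<Longrightarrow> app I a = a"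
proof -
  define I where "I = mkset {opair a a | a. a \<in> elts (Mor Q)}"
  have I: "is_function I (Mor Q) (Mor Q)" "\<And>a. a \<in> mor Q \<Longrightarrow> app I a = a"
    unfolding I_def mor_def using is_function_graph[of "Mor Q" "\<lambda>a. a" "Mor Q"] by auto
  have "is_functor Q Q I" unfolding is_functor_def using category_Q I by (simp add: I(2))
  moreover have "is_additive Q Q I" unfolding is_additive_def using I(2) by simp
  ultimately have "triangulated_functor Q Q I"
    unfolding triangulated_functor_def using triangulated_Q I(2) Q.distD(1-3) by simp
  then show ?thesis using I that by blast
qed

lemma induced_by_quotient_functor_iff:
  "induced_by T D Q (quotient_functor T D) G \<longleftrightarrow>
     is_functor Q Q G \<and> (\<forall>a\<in>mor Q. app G a = a)"
proof
  assume "induced_by T D Q (quotient_functor T D) G"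
  then have G: "is_functor Q Q G" "\<And>f. f \<in> mor T \<Longrightarrow> app G (F f) = F f"
    unfolding induced_by_def using app_quotient_functor by auto
  then show "is_functor Q Q G \<and> (\<forall>a\<in>mor Q. app G a = a)" using functor_fixes_Q by blast
qed (simp add: induced_by_def app_quotient_functor)

end

theorem proposition6p4:
  fixes S :: "'v::zermelo" and star :: "'v \<Rightarrow> 'v" and T D :: "'v tri_cat"
  assumes "enlargement S star"
    and "triangulated T" and "hat_small S T"
    and "thick T D"
  shows "thick (enlarge star T) (enlarge star D) \<and>
    (\<exists>F. induced_by (enlarge star T) (enlarge star D) (enlarge star (verdier_quotient T D))
            (star (quotient_functor T D)) F \<and>
         (\<forall>G. induced_by (enlarge star T) (enlarge star D) (enlarge star (verdier_quotient T D))
                (star (quotient_functor T D)) G \<longrightarrow> G = F) \<and>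
         triangulated_isomorphism (verdier_quotient (enlarge star T) (enlarge star D))
            (enlarge star (verdier_quotient T D)) F)"
proof -
  interpret enlarged S star by (rule enlarged.intro[OF assms(1)])
  have "\<not> atom (Mor T)" using assms(2) unfolding triangulated_iff_laws well_typed_def by blast
  then have M: "std (Mor T)" using assms(3) unfolding std_def hat_small_def by blast
  have th: "thick (enl T) (enl D)" by (rule thick_enlarge[OF M assms(4)])
  interpret verdier "enl T" "enl D" by (rule verdier_thick[OF th])
  obtain I where I: "triangulated_functor Q Q I" "is_function I (Mor Q) (Mor Q)"
    "\<And>a. a \<in> mor Q \<Longrightarrow> app I a = a" by (rule identity_Q) blast
  have "induced_by (enl T) (enl D) Q (quotient_functor (enl T) (enl D)) I"
    unfolding induced_by_quotient_functor_iff using I unfolding triangulated_functor_def by blast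
  \<comment> \<open>The theorem claims uniqueness of the functor as a set; both functors are graphs
    on \<open>Mor Q\<close>, so agreement on all morphisms suffices.\<close>
  moreover have "G = I" if "induced_by (enl T) (enl D) Q (quotient_functor (enl T) (enl D)) G" for G
  proof (rule is_function_ext[OF _ I(2)])
    show "is_function G (Mor Q) (Mor Q)" using that unfolding induced_by_def is_functor_def by blast
    show "app G a = app I a" if "a \<in> elts (Mor Q)" for a
      using \<open>induced_by _ _ _ _ G\<close> I(3) that unfolding induced_by_quotient_functor_iff mor_def by simp
  qed
  \<comment> \<open>The identity is its own inverse.\<close>
  moreover have "triangulated_isomorphism Q Q I"
    unfolding triangulated_isomorphism_def using I(1,3) by auto
  \<comment> \<open>The starred quotient and the starred quotient functor in the goal are rewritten
    to those of the enlarged pair, for which the claims have just been shown.\<close>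
  ultimately show ?thesis
    unfolding enlarge_quotient[OF M assms(4)] star_quotient_functor[OF M assms(4)] using th by blast
qed

end
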